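(* Let $0<\alpha\le1$, let $f:[0,1]^d\to\mathbb{R}^+$ be $\alpha$-Lipschitzian with $\inf f>0$, and assume that, as $n\to\infty$, (i) $n^{-1}k_n\log n\to0$, (ii) $h_n^dk_n\to\infty$ and (iii) $nk_n^{-1/2}h_n^{\alpha+d/2}\to0$. Then for all pairwise distinct points $x_1,\dots,x_p$ in $(0,1)^d$, $$\left\{v_nc\left(\widehat f_n(x_j)-f(x_j)\right):1\le j\le p\right\}\underset{\mathcal D}{\to}N\left(0,\|K^{PR}\|_2^2\,I_p\right),$$ where $I_p$ is the identity matrix of $\mathbb{R}^p$, $v_n=nh_n^{d/2}k_n^{-1/2}$, $\|K^{PR}\|_2^2=\int_{\mathbb{R}^d}K^{PR}(u)^2du$, and $\underset{\mathcal D}{\to}$ denotes convergence in distribution to the indicated centered Gaussian law. The choice $h_n=n^{-\frac1{\alpha+d}}$ and $k_n=n^{\frac d{\alpha+d}}u_n^2$, where $u_n\to\infty$ arbitrarily slowly, leads to $v_n=n^{\frac\alpha{\alpha+d}}u_n^{-1}$.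
   Context: $d\ge1$ is an integer, $E=[0,1]^d$, $\nu$ is Lebesgue measure on $E$, $S=\{(x,y)\in E\times\mathbb{R}:0\le y\le f(x)\}$, $c>0$ is a constant and $\lambda$ is Lebesgue measure on $\mathbb{R}^+$. $f$ is $\alpha$-Lipschitzian means $|f(x)-f(y)|\le L\|x-y\|^\alpha$ for some constant $L$ and all $x,y\in E$. For each $n\ge1$, $N_n$ is a Poisson point process on $E\times\mathbb{R}^+$ with intensity measure $nc(\nu\otimes\lambda)\mathbf{1}_S$, with points $\{(X_{n,i},Y_{n,i}):1\le i\le N_n(S)\}$. $(k_n)$ is a sequence of positive integers with $k_n\uparrow\infty$, and $\{I_{n,r}:1\le r\le k_n\}$ is an adjacent equidistant partition of $E$ with $I_{n,r}=\prod_{j=1}^dJ_{n,r,j}$, the $J_{n,r,j}$ being subintervals of $[0,1]$ of length $k_n^{-1/d}$ (so $k_n^{1/d}$ is an integer and $\nu(I_{n,r})=k_n^{-1}$). Put $D_{n,r}=\{(x,y):x\in I_{n,r},\,0\le y\le f(x)\}$, $N_{n,r}=N_n(D_{n,r})$, $Y^*_{n,r}=\max\{Y_{n,i}:(X_{n,i},Y_{n,i})\in D_{n,r}\}$ if $N_{n,r}\ne0$ and $Y^*_{n,r}=0$ otherwise, with $(1+1/N_{n,r})Y^*_{n,r}=0$ when $N_{n,r}=0$. $K^{PR}:\mathbb{R}^d\to\mathbb{R}^+$ is a Parzen--Rosenblatt kernel (nonnegative, with $\int_{\mathbb{R}^d}K^{PR}(u)\,du=1$) with compact support which is $1$-Lipschitzian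 (i.e. Lipschitzian of order $1$: $|K^{PR}(u)-K^{PR}(v)|\le L'\|u-v\|$ for some constant $L'$), $(h_n)$ is a sequence of positive reals tending to $0$, $K_n(x,t)=h_n^{-d}K^{PR}((x-t)/h_n)$, and $$\widehat f_n(x)=\sum_{r=1}^{k_n}\left(\int_{I_{n,r}}K_n(x,t)\,dt\right)\left(1+\frac1{N_{n,r}}\right)Y^*_{n,r}.$$ *)

theory Defs
  imports "HOL-Probability.Probability"
begin

definition hoelder_on :: "real \<Rightarrow> 'a::real_normed_vector set \<Rightarrow> ('a \<Rightarrow> real) \<Rightarrow> bool" where
  "hoelder_on \<alpha> A f \<longleftrightarrow> (\<exists>L. \<forall>x\<in>A. \<forall>y\<in>A. \<bar>f x - f y\<bar> \<le> L * norm (x - y) powr \<alpha>)"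

definition Parzen_Rosenblatt_kernel :: "('a::euclidean_space \<Rightarrow> real) \<Rightarrow> bool" where
  "Parzen_Rosenblatt_kernel K \<longleftrightarrow>
     (\<forall>u. 0 \<le> K u) \<and> integrable lborel K \<and> integral\<^sup>L lborel K = 1"

definition compactly_supported :: "('a::topological_space \<Rightarrow> real) \<Rightarrow> bool" where
  "compactly_supported K \<longleftrightarrow> compact (closure {u. K u \<noteq> 0})"

definition region_below :: "('a \<Rightarrow> real) \<Rightarrow> 'a set \<Rightarrow> ('a \<times> real) set" where
  "region_below f A = {(x, y). x \<in> A \<and> 0 \<le> y \<and> y \<le> f x}"

text \<open>
  A point process is represented by the finite multiset of its points, which suffices because
  all intensity measures considered are finite. \<open>num_points\<close> is the associated counting measure.
\<close>

definition num_points :: "'a multiset \<Rightarrow> 'a set \<Rightarrow> nat" where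
  "num_points Z B = size {#z \<in># Z. z \<in> B#}"

text \<open>
  The Poisson law is written out, since \<open>poisson_pmf\<close> is only specified for a positive rate
  whereas null sets of the intensity measure lead to rate \<open>0\<close> (with \<open>0 ^ 0 = 1\<close>).
\<close>

definition poisson_process :: "'w measure \<Rightarrow> 'a measure \<Rightarrow> ('w \<Rightarrow> 'a multiset) \<Rightarrow> bool" where
  "poisson_process M \<mu> N \<longleftrightarrow>
     prob_space M \<and> finite_measure \<mu> \<and>
     (\<forall>\<omega>\<in>space M. set_mset (N \<omega>) \<subseteq> space \<mu>) \<and>
     (\<forall>B\<in>sets \<mu>.
        (\<lambda>\<omega>. num_points (N \<omega>) B) \<in> measurable M (count_space UNIV) \<and>
        (\<forall>j. measure M {\<omega>\<in>space M. num_points (N \<omega>) B = j}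
               = exp (- measure \<mu> B) * measure \<mu> B ^ j / fact j)) \<and>
     (\<forall>(m::nat) B. (\<forall>i<m. B i \<in> sets \<mu>) \<and> disjoint_family_on B {..<m} \<longrightarrow>
        prob_space.indep_vars M (\<lambda>_. count_space UNIV) (\<lambda>i \<omega>. num_points (N \<omega>) (B i)) {..<m})"

text \<open>
  The intensity \<open>a (\<nu> \<otimes> \<lambda>) 1\<^sub>S\<close>, where \<open>\<nu>\<close> and \<open>\<lambda>\<close> are the Lebesgue measures on the
  unit cube and on the nonnegative half-line, and \<open>S\<close> is the region below \<open>f\<close>.
\<close>

definition intensity :: "(real^'d \<Rightarrow> real) \<Rightarrow> real \<Rightarrow> ((real^'d) \<times> real) measure" where
  "intensity f a =
     density (restrict_space lborel (cbox 0 1) \<Otimes>\<^sub>M restrict_space lborel {0..})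
       (\<lambda>z. ennreal a * indicator (region_below f (cbox 0 1)) z)"

text \<open>
  The intervals \<open>J j\<close> may or may not contain their end points; since the cells are disjoint and
  cover the cube, they necessarily form a regular grid, and \<open>k\<close> is the \<open>CARD('d)\<close>-th power of
  an integer.
\<close>

definition equidistant_partition :: "nat \<Rightarrow> (nat \<Rightarrow> (real^'d) set) \<Rightarrow> bool" where
  "equidistant_partition k I \<longleftrightarrow>
     (\<Union>r\<in>{1..k}. I r) = cbox 0 1 \<and> disjoint_family_on I {1..k} \<and>
     (\<forall>r\<in>{1..k}. \<exists>J :: 'd \<Rightarrow> real set.
        (\<forall>j. is_interval (J j) \<and> J j \<subseteq> {0..1} \<and>
             measure lborel (J j) = real k powr (- 1 / real CARD('d))) \<and>
        I r = {x. \<forall>j. x $ j \<in> J j})"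

definition Y_star :: "('a \<times> real) multiset \<Rightarrow> ('a \<times> real) set \<Rightarrow> real" where
  "Y_star Z D = (if num_points Z D \<noteq> 0 then Max (snd ` {z \<in> set_mset Z. z \<in> D}) else 0)"

definition scaled_kernel :: "(real^'d \<Rightarrow> real) \<Rightarrow> real \<Rightarrow> real^'d \<Rightarrow> real^'d \<Rightarrow> real" where
  "scaled_kernel K h x t = K ((1 / h) *\<^sub>R (x - t)) / h ^ CARD('d)"

text \<open>
  An empty cell contributes \<open>0\<close>, because \<open>Y_star\<close> vanishes there.
\<close>

definition f_hat ::
  "(real^'d \<Rightarrow> real) \<Rightarrow> (real^'d \<Rightarrow> real) \<Rightarrow> real \<Rightarrow> nat \<Rightarrow> (nat \<Rightarrow> (real^'d) set) \<Rightarrow>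
   ((real^'d) \<times> real) multiset \<Rightarrow> real^'d \<Rightarrow> real" where
  "f_hat f K h k I Z x =
     (\<Sum>r=1..k. set_lebesgue_integral lborel (I r) (\<lambda>t. scaled_kernel K h x t) *
        ((1 + 1 / real (num_points Z (region_below f (I r)))) * Y_star Z (region_below f (I r))))"

definition norming :: "nat \<Rightarrow> nat \<Rightarrow> nat \<Rightarrow> real \<Rightarrow> real" where
  "norming d n k h = real n * h powr (real d / 2) * real k powr (- 1 / 2)"

definition multivariate_normal :: "real^'p \<Rightarrow> real^'p^'p \<Rightarrow> (real^'p) measure" where
  "multivariate_normal m \<Sigma> = density lborel (\<lambda>z. ennreal
     (exp (- ((z - m) \<bullet> (matrix_inv \<Sigma> *v (z - m))) / 2) / sqrt ((2 * pi) ^ CARD('p) * det \<Sigma>)))"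

text \<open>
  The random vectors may live on different probability spaces. Measurability is only required
  for large indices.
\<close>

definition converges_in_distribution ::
  "(nat \<Rightarrow> 'w measure) \<Rightarrow> (nat \<Rightarrow> 'w \<Rightarrow> 'e::euclidean_space) \<Rightarrow> 'e measure \<Rightarrow> bool" where
  "converges_in_distribution M Z \<mu> \<longleftrightarrow>
     (\<forall>\<^sub>F n in sequentially. Z n \<in> borel_measurable (M n)) \<and>
     (\<forall>g :: 'e \<Rightarrow> real. continuous_on UNIV g \<and> bounded (range g) \<longrightarrow>
        (\<lambda>n. \<integral>\<omega>. g (Z n \<omega>) \<partial>M n) \<longlonglongrightarrow> (\<integral>z. g z \<partial>\<mu>))"

definition bandwidth_conditions :: "nat \<Rightarrow> real \<Rightarrow> (nat \<Rightarrow> nat) \<Rightarrow> (nat \<Rightarrow> real) \<Rightarrow> bool" where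
  "bandwidth_conditions d \<alpha> k h \<longleftrightarrow>
     (\<lambda>n. real (k n) * ln (real n) / real n) \<longlonglongrightarrow> 0 \<and>
     filterlim (\<lambda>n. h n ^ d * real (k n)) at_top sequentially \<and>
     (\<lambda>n. real n * real (k n) powr (- 1 / 2) * h n powr (\<alpha> + real d / 2)) \<longlonglongrightarrow> 0"

text \<open>
  \<open>u\<close> tends to infinity slowly enough, the last clause being the growth restriction that
  \<open>k n = n powr (d / (\<alpha> + d)) * (u n)\<^sup>2\<close> must respect for \<open>k n * ln n / n\<close> to vanish.
\<close>

definition slowly_divergent :: "nat \<Rightarrow> real \<Rightarrow> (nat \<Rightarrow> real) \<Rightarrow> bool" where
  "slowly_divergent d \<alpha> u \<longleftrightarrow>
     (\<forall>n\<ge>1. 0 < u n) \<and> filterlim u at_top sequentially \<and>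
     (\<lambda>n. (u n)\<^sup>2 * ln (real n) * real n powr (- \<alpha> / (\<alpha> + real d))) \<longlonglongrightarrow> 0"

end

theory Submission
  imports Defs "HOL-Real_Asymp.Real_Asymp"
begin

text \<open>
  A cell is a set of the partition together with the region above it and below \<open>f\<close>. Let \<open>m\<close> be the
  mean number of points in a cell and let \<open>F(y)\<close> be the intensity of the part of the cell below
  height \<open>y\<close>. Given that there are \<open>j \<ge> 1\<close> points, \<open>B = F(Y*)/m\<close> has the distribution function \<open>s^j\<close>
  of the maximum of \<open>j\<close> uniform variables, whatever the shape of \<open>f\<close>: this is the probability
  integral transform (\<open>count_quantile_law\<close>). Therefore \<open>U = (1 + 1/N) B\<close>, put equal to \<open>1\<close> in an
  empty cell, has mean exactly \<open>1\<close>. The factor \<open>1 + 1/N\<close> removes the bias of the maximum for every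
  count. This is essential: a bias of order \<open>m^-2\<close>, although negligible against the standard
  deviation, which is of order \<open>1/m\<close>, need not vanish after normalization. The conditional variance
  is \<open>1/(j (j + 2))\<close>, and averaging over the Poisson count gives variance \<open>m^-2 (1 + O(1/m))\<close> and
  fourth central moment \<open>O(m^-4)\<close> (\<open>U_mean\<close>, \<open>U_second_moment\<close>, \<open>U_fourth_moment\<close>).

  Rescaled to heights, the transform moves a point by at most the oscillation of \<open>f\<close> over the cell,
  so the estimator of a nonempty cell differs from \<open>U\<close> times the mean \<open>\<phi>\<close> of \<open>f\<close> over the cell by at
  most twice that oscillation. With kernel weights \<open>w\<^sub>r\<close> of sum \<open>1\<close>, the error of the estimator at
  \<open>x\<close> is thus \<open>\<Sum> w\<^sub>r \<phi>\<^sub>r (U\<^sub>r - 1)\<close>, a sum of independent centred variables, up to an oscillation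
  term, the kernel bias and the effect of empty cells (\<open>weighted_sum_near_ratios\<close>). Since
  \<open>h^d k \<rightarrow> \<infinity>\<close>, the cells are much smaller than the bandwidth, so the first two are \<open>O(h^\<alpha>)\<close>, and
  they vanish after normalization because \<open>n k^(-1/2) h^(\<alpha> + d/2) \<rightarrow> 0\<close>. The condition
  \<open>k log n / n \<rightarrow> 0\<close> makes the probability \<open>exp(-m)\<close> of an empty cell eventually smaller than \<open>1/n\<close>.

  After normalization the sum has coefficients \<open>w\<^sub>r sqrt(q) m\<^sub>r\<close> with \<open>q = h^d k\<close>, so its variance
  is close to \<open>q \<Sum> w\<^sub>r^2\<close>, a Riemann sum of the integral of \<open>K^2\<close> (\<open>scaled_kernel_weights\<close>). Each
  weight is \<open>O(1/q)\<close>, so the fourth moments add up to \<open>O(1/q)\<close>, and Lyapunov's method yields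
  convergence of the characteristic functions (\<open>char_sum_gaussian_approx\<close>).

  At distinct points the kernel windows are eventually disjoint, also after they are enlarged to
  unions of cells, and then the coordinates are independent. Joint convergence follows from
  convergence of the coordinates by taking Skorohod couplings on a product space
  (\<open>converges_in_distribution_independent_coordinates\<close>).

  For the special bandwidths the powers of \<open>n\<close> cancel (\<open>exponent_conditions\<close>). Suitable numbers of
  cells that are \<open>d\<close>-th powers exist because rounding the side of the grid up to an integer changes
  it by a bounded factor (\<open>slowly_divergent_grid_exists\<close>).
\<close>

section \<open>Bandwidths with the optimal rate\<close>

lemma exponent_conditions:
  assumes d: "0 < d" and alpha: "0 < \<alpha>" and n: "1 \<le> n" and u: "0 < u"
    and h: "h = real n powr (- 1 / (\<alpha> + real d))"
    and k: "real k = real n powr (real d / (\<alpha> + real d)) * u\<^sup>2"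
  shows "h ^ d * real k = u\<^sup>2"
    and "real k * ln (real n) / real n = u\<^sup>2 * ln (real n) * real n powr (- \<alpha> / (\<alpha> + real d))"
    and "real n * real k powr (- 1 / 2) * h powr (\<alpha> + real d / 2) = 1 / u"
    and "norming d n k h = real n powr (\<alpha> / (\<alpha> + real d)) / u"
proof -
  define s where "s = \<alpha> + real d"
  have s: "0 < s" using alpha d by (simp add: s_def)
  have n0: "0 < real n" using n by simp
  have n1: "real n = real n powr 1" using n0 by simp
  have hd: "h ^ d = real n powr (- real d / s)"
    unfolding h using n0 by (subst powr_realpow[symmetric]) (auto simp: powr_powr s_def)
  show "h ^ d * real k = u\<^sup>2"
    unfolding hd k s_def[symmetric] using n0 by (simp add: powr_add[symmetric] mult.assoc[symmetric])
  show "real k * ln (real n) / real n = u\<^sup>2 * ln (real n) * real n powr (- \<alpha> / (\<alpha> + real d))"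
  proof -
    have "real n powr (real d / s) / real n = real n powr (real d / s - 1)"
      using n0 by (simp add: powr_diff)
    also have "real d / s - 1 = - \<alpha> / s" using s by (simp add: field_simps s_def)
    finally have e: "real n powr (real d / s) / real n = real n powr (- \<alpha> / s)" .
    have "real k * ln (real n) / real n = u\<^sup>2 * ln (real n) * (real n powr (real d / s) / real n)"
      unfolding k s_def[symmetric] by simp
    then show ?thesis unfolding e[unfolded s_def] s_def .
  qed
  have kh: "real k powr (- 1 / 2) = real n powr (- real d / (2 * s)) / u"
  proof -
    have "real k powr (- 1 / 2) = real n powr (- real d / (2 * s)) * (u\<^sup>2) powr (- 1 / 2)"
      unfolding k s_def[symmetric] using u by (simp add: powr_mult powr_powr mult.commute)
    also have "(u\<^sup>2) powr (- 1 / 2) = 1 / u"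
      using u by (simp add: powr_minus_divide powr_half_sqrt)
    finally show ?thesis by simp
  qed
  have "h powr (\<alpha> + real d / 2) = real n powr (- (\<alpha> + real d / 2) / s)"
    by (simp add: h powr_powr s_def diff_divide_distrib add_divide_distrib)
  then have "real n * real k powr (- 1 / 2) * h powr (\<alpha> + real d / 2)
    = real n powr (1 + - real d / (2 * s) + - (\<alpha> + real d / 2) / s) / u"
    unfolding kh powr_add n1[symmetric] by simp
  also have "1 + - real d / (2 * s) + - (\<alpha> + real d / 2) / s = 0"
    using s by (simp add: field_simps) (simp add: s_def algebra_simps)
  finally show "real n * real k powr (- 1 / 2) * h powr (\<alpha> + real d / 2) = 1 / u"
    using n0 by simp
  have "h powr (real d / 2) = real n powr (- real d / (2 * s))"
    by (simp add: h powr_powr s_def mult.commute)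
  then have "norming d n k h = real n powr (1 + - real d / (2 * s) + - real d / (2 * s)) / u"
    unfolding kh powr_add n1[symmetric] norming_def by simp
  also have "1 + - real d / (2 * s) + - real d / (2 * s) = \<alpha> / s"
    using s by (simp add: field_simps) (simp add: s_def algebra_simps)
  finally show "norming d n k h = real n powr (\<alpha> / (\<alpha> + real d)) / u"
    by (simp add: s_def)
qed

lemma bandwidth_conditions_optimal_rate:
  assumes d: "0 < d" and alpha: "0 < \<alpha>" and u: "slowly_divergent d \<alpha> u"
    and hk: "\<And>n. 1 \<le> n \<Longrightarrow> h n = real n powr (- 1 / (\<alpha> + real d))"
      "\<And>n. 1 \<le> n \<Longrightarrow> real (k n) = real n powr (real d / (\<alpha> + real d)) * (u n)\<^sup>2"
  shows "bandwidth_conditions d \<alpha> k h"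
proof -
  have u0: "0 < u n" if "1 \<le> n" for n using u that by (simp add: slowly_divergent_def)
  note ec = exponent_conditions[OF d alpha _ u0 hk]
  have ulim: "filterlim u at_top sequentially"
    using u by (simp add: slowly_divergent_def)
  show ?thesis
    unfolding bandwidth_conditions_def
  proof (intro conjI)
    have "(\<lambda>n. (u n)\<^sup>2 * ln (real n) * real n powr (- \<alpha> / (\<alpha> + real d))) \<longlonglongrightarrow> 0"
      using u by (simp add: slowly_divergent_def)
    then show "(\<lambda>n. real (k n) * ln (real n) / real n) \<longlonglongrightarrow> 0"
      by (rule Lim_transform_eventually) (use ec(2) in \<open>auto intro!: eventually_sequentiallyI[of 1]\<close>)
    have "filterlim (\<lambda>n. (u n)\<^sup>2) at_top sequentially"
      by (rule filterlim_pow_at_top[OF _ ulim]) simp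
    then show "filterlim (\<lambda>n. h n ^ d * real (k n)) at_top sequentially"
      by (subst filterlim_cong[OF refl refl, of _ "\<lambda>n. (u n)\<^sup>2"])
        (use ec(1) in \<open>auto intro!: eventually_sequentiallyI[of 1]\<close>)
    have "(\<lambda>n. 1 / u n) \<longlonglongrightarrow> 0"
      using tendsto_inverse_0_at_top[OF ulim] by (simp add: inverse_eq_divide)
    then show "(\<lambda>n. real n * real (k n) powr (- 1 / 2) * h n powr (\<alpha> + real d / 2)) \<longlonglongrightarrow> 0"
      by (rule Lim_transform_eventually) (use ec(3) in \<open>auto intro!: eventually_sequentiallyI[of 1]\<close>)
  qed
qed

text \<open>
  Infima over tails increase, and they diverge because \<open>q\<close> does. The maximum with \<open>1\<close> bounds the
  tails from below, so that the infima exist.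
\<close>

lemma monotone_minorant_at_top:
  fixes q :: "nat \<Rightarrow> real"
  assumes "filterlim q at_top sequentially"
  obtains s :: "nat \<Rightarrow> real" where "mono s" "filterlim s at_top sequentially" "\<And>n. 1 \<le> s n" "\<forall>\<^sub>F n in sequentially. s n \<le> q n"
proof
  define s where "s n = (INF m\<in>{n..}. max 1 (q m))" for n
  have bdd: "bdd_below ((\<lambda>m. max 1 (q m)) ` A)" for A by (rule bdd_belowI[of _ 1]) auto
  show "mono s"
    unfolding s_def by (intro monoI cINF_superset_mono bdd) auto
  show s1: "1 \<le> s n" for n unfolding s_def by (rule cINF_greatest) auto
  have s_le: "s n \<le> max 1 (q n)" for n unfolding s_def by (rule cINF_lower[OF bdd]) simp
  have "\<forall>\<^sub>F n in sequentially. 1 \<le> q n"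
    using assms by (simp add: filterlim_at_top)
  then show "\<forall>\<^sub>F n in sequentially. s n \<le> q n"
  proof eventually_elim
    case (elim n)
    then show ?case using s_le[of n] by simp
  qed
  show "filterlim s at_top sequentially"
    unfolding filterlim_at_top
  proof
    fix Z :: real
    obtain n0 where n0: "\<And>n. n \<ge> n0 \<Longrightarrow> Z \<le> q n"
      using assms by (auto simp: filterlim_at_top eventually_sequentially)
    have "Z \<le> s n" if "n \<ge> n0" for n
      unfolding s_def using n0 that by (intro cINF_greatest) (auto intro: max.coboundedI2)
    then show "\<forall>\<^sub>F n in sequentially. Z \<le> s n" by (auto simp: eventually_sequentially)
  qed
qed

text \<open>
  Since the number of cells has to be a \<open>d\<close>-th power, \<open>u\<close> cannot be prescribed. The side \<open>m n\<close> of the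
  grid is \<open>n powr \<beta>\<close> times a slowly increasing \<open>s n\<close>, rounded up, and \<open>u\<close> is read off from it. Rounding
  at most doubles \<open>s\<close>, so it is enough that \<open>2 * s\<close> respects the bounds by \<open>w\<close> and by a small power of
  \<open>n\<close>.
\<close>

lemma slowly_divergent_grid_exists:
  fixes w :: "nat \<Rightarrow> real"
  assumes d: "0 < d" and alpha: "0 < \<alpha>" and w: "filterlim w at_top sequentially"
  shows "\<exists>u (\<kappa>::nat \<Rightarrow> nat).
           slowly_divergent d \<alpha> u \<and> (\<forall>\<^sub>F n in sequentially. u n \<le> w n) \<and>
           mono_on {1..} \<kappa> \<and> filterlim \<kappa> at_top sequentially \<and>
           (\<forall>n\<ge>1. 0 < \<kappa> n \<and> (\<exists>m. \<kappa> n = m ^ d) \<and>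
              real (\<kappa> n) = real n powr (real d / (\<alpha> + real d)) * (u n)\<^sup>2)"
proof -
  define \<beta> where "\<beta> = 1 / (\<alpha> + real d)"
  define \<gamma> where "\<gamma> = \<alpha> / (\<alpha> + real d)"
  have \<beta>: "0 < \<beta>" and \<gamma>: "0 < \<gamma>" using alpha d by (auto simp: \<beta>_def \<gamma>_def)
  have "filterlim (\<lambda>n. min (w n powr (2 / real d) / 2) (real n powr (\<gamma> / (2 * real d)))) at_top sequentially"
  proof -
    have 1: "filterlim (\<lambda>n. w n powr (2 / real d) / 2) at_top sequentially"
    proof (rule filterlim_compose[OF _ w])
      show "filterlim (\<lambda>x. x powr (2 / real d) / 2) at_top at_top"
        using d by real_asymp
    qed
    have 2: "filterlim (\<lambda>n. real n powr (\<gamma> / (2 * real d))) at_top sequentially"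
    proof (rule filterlim_compose[OF _ filterlim_real_sequentially])
      show "filterlim (\<lambda>x. x powr (\<gamma> / (2 * real d))) at_top at_top"
        using d \<gamma> by real_asymp
    qed
    show ?thesis unfolding filterlim_at_top
    proof
      fix Z :: real
      have "\<forall>\<^sub>F n in sequentially. Z \<le> w n powr (2 / real d) / 2" "\<forall>\<^sub>F n in sequentially. Z \<le> real n powr (\<gamma> / (2 * real d))"
        using 1 2 by (simp_all add: filterlim_at_top)
      then show "\<forall>\<^sub>F n in sequentially. Z \<le> min (w n powr (2 / real d) / 2) (real n powr (\<gamma> / (2 * real d)))"
        by eventually_elim simp
    qed
  qed
  then obtain s :: "nat \<Rightarrow> real" where s: "mono s" "filterlim s at_top sequentially" "\<And>n. 1 \<le> s n"
    and sle: "\<forall>\<^sub>F n in sequentially. s n \<le> min (w n powr (2 / real d) / 2) (real n powr (\<gamma> / (2 * real d)))"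
    using monotone_minorant_at_top by blast
  define m where "m n = nat \<lceil>real n powr \<beta> * s n\<rceil>" for n
  define v where "v n = real (m n) * real n powr (- \<beta>)" for n
  define u where "u n = sqrt (v n ^ d)" for n
  define \<kappa> where "\<kappa> n = m n ^ d" for n
  have s0: "0 < s n" for n using s(3)[of n] by simp
  have m_lower: "real n powr \<beta> * s n \<le> real (m n)" for n
    unfolding m_def by (rule real_nat_ceiling_ge)
  have m_upper: "real (m n) \<le> real n powr \<beta> * s n + 1" for n
    unfolding m_def using s0[of n] by simp
  have v_lower: "s n \<le> v n" if "1 \<le> n" for n
  proof -
    have "s n = real n powr \<beta> * s n * real n powr (- \<beta>)"
      using that by (simp add: powr_minus field_simps)
    also have "\<dots> \<le> v n" unfolding v_def by (intro mult_right_mono m_lower) simp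
    finally show ?thesis .
  qed
  have v_upper: "v n \<le> 2 * s n" if "1 \<le> n" for n
  proof -
    have "v n \<le> (real n powr \<beta> * s n + 1) * real n powr (- \<beta>)"
      unfolding v_def by (intro mult_right_mono m_upper) simp
    also have "\<dots> = s n + real n powr (- \<beta>)"
      using that by (simp add: powr_minus field_simps)
    also have "real n powr (- \<beta>) \<le> 1"
      using that \<beta> by (simp add: powr_minus ge_one_powr_ge_zero inverse_le_1_iff)
    finally show ?thesis using s(3)[of n] by simp
  qed
  have v1: "1 \<le> v n" if "1 \<le> n" for n using v_lower[OF that] s(3)[of n] by simp
  have u2: "(u n)\<^sup>2 = v n ^ d" if "1 \<le> n" for n
    unfolding u_def using v1[OF that] by simp
  have \<kappa>: "real (\<kappa> n) = real n powr (real d / (\<alpha> + real d)) * (u n)\<^sup>2" if "1 \<le> n" for n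
  proof -
    have "real (\<kappa> n) = (real n powr \<beta> * v n) ^ d"
      unfolding \<kappa>_def v_def using that by (simp add: powr_minus field_simps)
    also have "\<dots> = real n powr (real d * \<beta>) * v n ^ d"
      using that by (simp add: power_mult_distrib powr_realpow[symmetric] powr_powr mult.commute)
    finally show ?thesis using u2[OF that] by (simp add: \<beta>_def)
  qed
  have ulim: "filterlim u at_top sequentially"
  proof (rule filterlim_at_top_mono)
    have *: "filterlim (\<lambda>x::real. sqrt x) at_top at_top" by (rule sqrt_at_top)
    show "filterlim (\<lambda>n. sqrt (s n)) at_top sequentially"
      by (rule filterlim_compose[OF * s(2)])
    show "\<forall>\<^sub>F n in sequentially. sqrt (s n) \<le> u n"
    proof (rule eventually_sequentiallyI[of 1])
      fix n :: nat assume n: "1 \<le> n"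
      have "s n \<le> v n" by (rule v_lower[OF n])
      also have "\<dots> \<le> v n ^ d" using power_increasing[of 1 d "v n"] d v1[OF n] by simp
      finally show "sqrt (s n) \<le> u n" unfolding u_def by simp
    qed
  qed
  have slow: "(\<lambda>n. (u n)\<^sup>2 * ln (real n) * real n powr (- \<alpha> / (\<alpha> + real d))) \<longlonglongrightarrow> 0"
  proof (rule tendsto_sandwich[OF _ _ tendsto_const])
    show "\<forall>\<^sub>F n in sequentially. 0 \<le> (u n)\<^sup>2 * ln (real n) * real n powr (- \<alpha> / (\<alpha> + real d))"
      by (rule eventually_sequentiallyI[of 1]) auto
    have "((\<lambda>x::real. ln x * x powr (- (\<gamma>/2))) \<longlongrightarrow> 0) at_top"
      using \<gamma> by real_asymp
    then have "(\<lambda>n. ln (real n) * real n powr (- (\<gamma>/2))) \<longlonglongrightarrow> 0"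
      by (rule filterlim_compose[OF _ filterlim_real_sequentially])
    from tendsto_mult_left[OF this, of "2 ^ d"]
    show "(\<lambda>n. 2 ^ d * (ln (real n) * real n powr (- (\<gamma>/2)))) \<longlonglongrightarrow> 0" by simp
    show "\<forall>\<^sub>F n in sequentially. (u n)\<^sup>2 * ln (real n) * real n powr (- \<alpha> / (\<alpha> + real d))
      \<le> 2 ^ d * (ln (real n) * real n powr (- (\<gamma>/2)))"
      using sle eventually_ge_at_top[of 1]
    proof eventually_elim
      case (elim n)
      have "(u n)\<^sup>2 \<le> (2 * real n powr (\<gamma> / (2 * real d))) ^ d"
        unfolding u2[OF elim(2)] using elim v1[of n] v_upper[of n] by (intro power_mono) auto
      also have "\<dots> = 2 ^ d * real n powr (\<gamma> / 2)"
        using elim d by (simp add: power_mult_distrib powr_realpow[symmetric] powr_powr)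
      finally have "(u n)\<^sup>2 * (ln (real n) * real n powr (- \<gamma>)) \<le> 2 ^ d * real n powr (\<gamma> / 2) * (ln (real n) * real n powr (- \<gamma>))"
        using elim by (intro mult_right_mono) auto
      also have "\<dots> = 2 ^ d * (ln (real n) * (real n powr (\<gamma> / 2) * real n powr (- \<gamma>)))" by simp
      also have "real n powr (\<gamma> / 2) * real n powr (- \<gamma>) = real n powr (- (\<gamma>/2))"
        by (simp add: powr_add[symmetric])
      finally show ?case by (simp add: \<gamma>_def mult.assoc)
    qed
  qed
  have upos: "0 < u n" if "1 \<le> n" for n
    unfolding u_def using v1[OF that] by simp
  have uw: "\<forall>\<^sub>F n in sequentially. u n \<le> w n"
    using sle eventually_ge_at_top[of 1] filterlim_at_top[THEN iffD1, OF w, rule_format, of 1]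
  proof eventually_elim
    case (elim n)
    have "(u n)\<^sup>2 \<le> (w n powr (2 / real d)) ^ d"
      unfolding u2[OF elim(2)] using elim v1[of n] v_upper[of n] by (intro power_mono) auto
    also have "\<dots> = w n powr (2 / real d * real d)"
      using elim by (subst powr_realpow[symmetric]) (auto simp: powr_powr)
    also have "\<dots> = (w n)\<^sup>2"
      using elim d by simp
    finally show ?case using elim(3) by (simp add: power2_le_iff_abs_le)
  qed
  have mono: "mono_on {1..} \<kappa>"
  proof (rule mono_onI)
    fix a b :: nat assume "a \<in> {1..}" "b \<in> {1..}" "a \<le> b"
    then have "real a powr \<beta> * s a \<le> real b powr \<beta> * s b"
      using \<beta> s0[of a] s0[of b] monoD[OF s(1), of a b] by (intro mult_mono powr_mono2) auto
    then show "\<kappa> a \<le> \<kappa> b"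
      unfolding \<kappa>_def m_def by (intro power_mono nat_mono ceiling_mono) auto
  qed
  have \<kappa>lim: "filterlim \<kappa> at_top sequentially"
  proof -
    have "filterlim (\<lambda>n. real (\<kappa> n)) at_top sequentially"
    proof (rule filterlim_at_top_mono[OF s(2)], rule eventually_sequentiallyI[of 1])
      fix n :: nat assume n: "1 \<le> n"
      have "s n \<le> v n" by (rule v_lower[OF n])
      also have "\<dots> \<le> v n ^ d" using power_increasing[of 1 d "v n"] d v1[OF n] by simp
      also have "\<dots> \<le> real n powr (real d / (\<alpha> + real d)) * v n ^ d"
        using n alpha d v1[OF n] ge_one_powr_ge_zero[of "real n" "real d / (\<alpha> + real d)"] by simp
      also have "\<dots> = real (\<kappa> n)" using \<kappa>[OF n] u2[OF n] by simp
      finally show "s n \<le> real (\<kappa> n)" .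
    qed
    then show ?thesis by (simp add: filterlim_sequentially_iff_filterlim_real)
  qed
  have "0 < \<kappa> n" if "1 \<le> n" for n
  proof -
    have "0 < real (\<kappa> n)" unfolding \<kappa>[OF that] using upos[OF that] that by simp
    then show ?thesis by simp
  qed
  then show ?thesis
    using slow ulim uw mono \<kappa>lim \<kappa> upos unfolding slowly_divergent_def
    by (intro exI[of _ u] exI[of _ \<kappa>]) (auto simp: \<kappa>_def)
qed

section \<open>A Lyapunov bound for characteristic functions\<close>

text \<open>
  Errors that are small in mean can be discarded at the level of characteristic functions. This
  replaces Slutsky's theorem throughout.
\<close>

lemma (in prob_space) char_distr_diff_le:
  assumes [measurable]: "random_variable borel X" "random_variable borel Y"
    and int: "integrable M (\<lambda>\<omega>. \<bar>X \<omega> - Y \<omega>\<bar>)"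
  shows "cmod (char (distr M borel X) t - char (distr M borel Y) t) \<le> \<bar>t\<bar> * expectation (\<lambda>\<omega>. \<bar>X \<omega> - Y \<omega>\<bar>)"
proof -
  have *: "cmod (iexp a - iexp b) \<le> \<bar>a - b\<bar>" for a b :: real
  proof -
    have "iexp a - iexp b = iexp b * (iexp (a - b) - 1)"
      by (simp add: algebra_simps exp_add[symmetric])
    then have "cmod (iexp a - iexp b) = cmod (iexp (a - b) - 1)"
      by (simp add: norm_mult)
    also have "\<dots> \<le> \<bar>a - b\<bar>"
      using iexp_approx1[of "a - b" 0] by simp
    finally show ?thesis .
  qed
  have i: "integrable M (\<lambda>\<omega>. iexp (t * X \<omega>))" "integrable M (\<lambda>\<omega>. iexp (t * Y \<omega>))"
    by (auto intro!: integrable_const_bound[of _ 1])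
  have "char (distr M borel X) t - char (distr M borel Y) t
    = expectation (\<lambda>\<omega>. iexp (t * X \<omega>) - iexp (t * Y \<omega>))"
    using i by (simp add: char_def integral_distr)
  also have "cmod \<dots> \<le> expectation (\<lambda>\<omega>. cmod (iexp (t * X \<omega>) - iexp (t * Y \<omega>)))"
    by (rule integral_norm_bound)
  also have "\<dots> \<le> expectation (\<lambda>\<omega>. \<bar>t\<bar> * \<bar>X \<omega> - Y \<omega>\<bar>)"
  proof (rule integral_mono)
    show "integrable M (\<lambda>\<omega>. cmod (iexp (t * X \<omega>) - iexp (t * Y \<omega>)))"
      using i by (intro integrable_norm Bochner_Integration.integrable_diff)
    show "integrable M (\<lambda>\<omega>. \<bar>t\<bar> * \<bar>X \<omega> - Y \<omega>\<bar>)" using int by simp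
    show "cmod (iexp (t * X \<omega>) - iexp (t * Y \<omega>)) \<le> \<bar>t\<bar> * \<bar>X \<omega> - Y \<omega>\<bar>" for \<omega>
      using *[of "t * X \<omega>" "t * Y \<omega>"] by (simp add: right_diff_distrib[symmetric] abs_mult)
  qed
  finally show ?thesis by simp
qed

lemma exp_minus_first_order:
  fixes s :: real
  assumes "0 \<le> s"
  shows "\<bar>exp (- s) - (1 - s)\<bar> \<le> s\<^sup>2 / 2"
proof -
  have 1: "1 - s \<le> exp (- s)" using exp_ge_add_one_self[of "- s"] by simp
  have "exp (-s) \<le> 1 - s + s\<^sup>2/2"
  proof -
    have "DERIV (\<lambda>s. 1 - s + s\<^sup>2/2 - exp (-s)) x :> - 1 + x + exp (-x)" for x :: real
      by (auto intro!: derivative_eq_intros)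
    moreover have "0 \<le> - 1 + x + exp (-x)" for x :: real
      using exp_ge_add_one_self[of "- x"] by simp
    ultimately have "(\<lambda>s. 1 - s + s\<^sup>2/2 - exp (-s)) 0 \<le> (\<lambda>s. 1 - s + s\<^sup>2/2 - exp (-s)) s"
      using DERIV_nonneg_imp_nondecreasing[of 0 s "\<lambda>s. 1 - s + s\<^sup>2/2 - exp (-s)"] assms by metis
    then show ?thesis by simp
  qed
  then show ?thesis using 1 by simp
qed

text \<open>
  The third absolute moment in the Taylor remainder is traded for moments of even order through
  \<open>\<bar>x\<bar>^3 \<le> \<epsilon> x^2 + x^4 / \<epsilon>\<close>. These are polynomial in \<open>X\<close> and hence accessible to exact computation.
\<close>

lemma (in prob_space) char_gaussian_approx:
  fixes X :: "'a \<Rightarrow> real"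
  assumes [measurable]: "random_variable borel X"
    and int4: "integrable M (\<lambda>\<omega>. X \<omega> ^ 4)" and mean: "expectation X = 0" and "0 < \<epsilon>"
  shows "cmod (char (distr M borel X) t - exp (- (t\<^sup>2 * expectation (\<lambda>\<omega>. (X \<omega>)\<^sup>2)) / 2))
    \<le> \<bar>t\<bar>^3 / 6 * (\<epsilon> * expectation (\<lambda>\<omega>. (X \<omega>)\<^sup>2) + expectation (\<lambda>\<omega>. X \<omega> ^ 4) / \<epsilon>)
      + t ^ 4 * expectation (\<lambda>\<omega>. X \<omega> ^ 4) / 8"
proof -
  have sq: "x\<^sup>2 \<le> 1 + x ^ 4" for x :: real
  proof -
    have "0 \<le> (x\<^sup>2 - 1)\<^sup>2" by simp
    also have "(x\<^sup>2 - 1)\<^sup>2 = x ^ 4 - 2 * x\<^sup>2 + 1"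
      by (simp add: power2_diff flip: power_mult)
    finally show ?thesis using zero_le_power2[of x] by linarith
  qed
  have ab: "\<bar>x\<bar> \<le> 2 + x ^ 4" for x :: real
  proof -
    have "0 \<le> (\<bar>x\<bar> - 1)\<^sup>2" by simp
    also have "(\<bar>x\<bar> - 1)\<^sup>2 = x\<^sup>2 - 2 * \<bar>x\<bar> + 1"
      by (simp add: power2_diff)
    finally show ?thesis using sq[of x] by linarith
  qed
  \<comment> \<open>expand the square of \<open>\<bar>x\<bar> / sqrt \<epsilon> - sqrt \<epsilon>\<close>\<close>
  have cube: "\<bar>x\<bar>^3 \<le> \<epsilon> * x\<^sup>2 + x ^ 4 / \<epsilon>" for x
  proof -
    have "0 \<le> (\<bar>x\<bar> / sqrt \<epsilon> - sqrt \<epsilon>)\<^sup>2" by simp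
    then have "2 * \<bar>x\<bar> \<le> x\<^sup>2 / \<epsilon> + \<epsilon>"
      using \<open>0 < \<epsilon>\<close> by (simp add: power2_diff power_divide)
    then have "\<bar>x\<bar> \<le> x\<^sup>2 / \<epsilon> + \<epsilon>" by simp
    then have "\<bar>x\<bar>\<^sup>2 * \<bar>x\<bar> \<le> \<bar>x\<bar>\<^sup>2 * (x\<^sup>2 / \<epsilon> + \<epsilon>)"
      by (rule mult_left_mono) simp
    then show ?thesis
      by (simp add: algebra_simps power2_eq_square power3_eq_cube power4_eq_xxxx)
  qed
  have i1: "integrable M X" 
    by (rule Bochner_Integration.integrable_bound[of M "\<lambda>\<omega>. 2 + X \<omega> ^ 4"]) (use int4 order_trans[OF ab abs_ge_self] in auto)
  have i2: "integrable M (\<lambda>\<omega>. (X \<omega>)\<^sup>2)"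
    by (rule Bochner_Integration.integrable_bound[of M "\<lambda>\<omega>. 1 + X \<omega> ^ 4"]) (use int4 order_trans[OF sq abs_ge_self] in auto)
  let ?s = "expectation (\<lambda>\<omega>. (X \<omega>)\<^sup>2)" and ?f = "expectation (\<lambda>\<omega>. X \<omega> ^ 4)"
  have s0: "0 \<le> ?s" by simp
  have s2: "?s\<^sup>2 \<le> ?f"
  proof -
    have "0 \<le> expectation (\<lambda>\<omega>. ((X \<omega>)\<^sup>2 - ?s)\<^sup>2)" by simp
    also have "(\<lambda>\<omega>. ((X \<omega>)\<^sup>2 - ?s)\<^sup>2) = (\<lambda>\<omega>. X \<omega> ^ 4 - 2 * ?s * (X \<omega>)\<^sup>2 + ?s\<^sup>2)"
      by (auto simp: power2_eq_square power4_eq_xxxx algebra_simps)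
    also have "expectation \<dots> = ?f - ?s\<^sup>2"
      using int4 i2 by (simp add: prob_space power2_eq_square)
    finally show ?thesis by simp
  qed
  have "cmod (char (distr M borel X) t - (1 - t\<^sup>2 * ?s / 2))
     \<le> t\<^sup>2 / 6 * expectation (\<lambda>\<omega>. min (6 * (X \<omega>)\<^sup>2) (\<bar>t\<bar> * \<bar>X \<omega>\<bar>^3))"
    using char_approx3'[of X ?s "distr M borel X" t] i1 i2 mean by simp
  also have "expectation (\<lambda>\<omega>. min (6 * (X \<omega>)\<^sup>2) (\<bar>t\<bar> * \<bar>X \<omega>\<bar>^3))
    \<le> expectation (\<lambda>\<omega>. \<bar>t\<bar> * (\<epsilon> * (X \<omega>)\<^sup>2 + X \<omega> ^ 4 / \<epsilon>))"
  proof (rule integral_mono)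
    show "integrable M (\<lambda>\<omega>. min (6 * (X \<omega>)\<^sup>2) (\<bar>t\<bar> * \<bar>X \<omega>\<bar>^3))"
      by (rule Bochner_Integration.integrable_bound[of M "\<lambda>\<omega>. 6 * (X \<omega>)\<^sup>2"]) (use i2 in auto)
    show "integrable M (\<lambda>\<omega>. \<bar>t\<bar> * (\<epsilon> * (X \<omega>)\<^sup>2 + X \<omega> ^ 4 / \<epsilon>))"
      using i2 int4 by simp
    show "min (6 * (X \<omega>)\<^sup>2) (\<bar>t\<bar> * \<bar>X \<omega>\<bar>^3) \<le> \<bar>t\<bar> * (\<epsilon> * (X \<omega>)\<^sup>2 + X \<omega> ^ 4 / \<epsilon>)" for \<omega>
      using mult_left_mono[OF cube[of "X \<omega>"], of "\<bar>t\<bar>"] by simp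
  qed
  also have "\<dots> = \<bar>t\<bar> * (\<epsilon> * ?s + ?f / \<epsilon>)"
    using i2 int4 by simp
  finally have "cmod (char (distr M borel X) t - (1 - t\<^sup>2 * ?s / 2)) \<le> t\<^sup>2 / 6 * (\<bar>t\<bar> * (\<epsilon> * ?s + ?f / \<epsilon>))"
    by (simp add: mult_left_mono)
  also have "\<dots> = \<bar>t\<bar>^3 / 6 * (\<epsilon> * ?s + ?f / \<epsilon>)"
    using power2_abs[of t] by (simp add: power3_eq_cube power2_eq_square)
  finally have 1: "cmod (char (distr M borel X) t - (1 - t\<^sup>2 * ?s / 2)) \<le> \<bar>t\<bar>^3 / 6 * (\<epsilon> * ?s + ?f / \<epsilon>)" .
  have "cmod (complex_of_real (1 - t\<^sup>2 * ?s / 2) - complex_of_real (exp (- (t\<^sup>2 * ?s) / 2)))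
    = \<bar>exp (- (t\<^sup>2 * ?s / 2)) - (1 - t\<^sup>2 * ?s / 2)\<bar>"
    unfolding of_real_diff[symmetric] norm_of_real by (simp add: abs_minus_commute)
  also have "\<dots> \<le> (t\<^sup>2 * ?s / 2)\<^sup>2 / 2"
    by (rule exp_minus_first_order) simp
  also have "\<dots> = t ^ 4 * ?s\<^sup>2 / 8"
    by (simp add: power_mult_distrib power_divide flip: power_mult)
  also have "\<dots> \<le> t ^ 4 * ?f / 8"
    using s2 by (intro divide_right_mono mult_left_mono) auto
  finally have 2: "cmod (complex_of_real (1 - t\<^sup>2 * ?s / 2) - complex_of_real (exp (- (t\<^sup>2 * ?s) / 2))) \<le> t ^ 4 * ?f / 8" .
  show ?thesis
    using norm_triangle_le[OF add_mono[OF 1 2]] by simp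
qed

text \<open>
  A quantitative form of Lyapunov's theorem. It concerns a single row of a triangular array, and the
  rows may live on different probability spaces.
\<close>

lemma (in prob_space) char_sum_gaussian_approx:
  fixes X :: "'i \<Rightarrow> 'a \<Rightarrow> real"
  assumes fin: "finite A" and indep: "indep_vars (\<lambda>_. borel) X A"
    and int4: "\<And>i. i \<in> A \<Longrightarrow> integrable M (\<lambda>\<omega>. X i \<omega> ^ 4)"
    and mean: "\<And>i. i \<in> A \<Longrightarrow> expectation (X i) = 0" and "0 < \<epsilon>"
  shows "cmod (char (distr M borel (\<lambda>\<omega>. \<Sum>i\<in>A. X i \<omega>)) t
            - exp (- (t\<^sup>2 * (\<Sum>i\<in>A. expectation (\<lambda>\<omega>. (X i \<omega>)\<^sup>2))) / 2))
    \<le> \<bar>t\<bar>^3 / 6 * (\<epsilon> * (\<Sum>i\<in>A. expectation (\<lambda>\<omega>. (X i \<omega>)\<^sup>2)) + (\<Sum>i\<in>A. expectation (\<lambda>\<omega>. X i \<omega> ^ 4)) / \<epsilon>)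
      + t ^ 4 * (\<Sum>i\<in>A. expectation (\<lambda>\<omega>. X i \<omega> ^ 4)) / 8"
proof -
  have rv: "random_variable borel (X i)" if "i \<in> A" for i
    using indep that by (auto simp: indep_vars_def)
  define s where "s i = expectation (\<lambda>\<omega>. (X i \<omega>)\<^sup>2)" for i
  define f where "f i = expectation (\<lambda>\<omega>. X i \<omega> ^ 4)" for i
  have e: "complex_of_real (exp (- (t\<^sup>2 * (\<Sum>i\<in>A. s i)) / 2)) = (\<Prod>i\<in>A. complex_of_real (exp (- (t\<^sup>2 * s i) / 2)))"
    unfolding of_real_prod[symmetric] exp_sum[OF fin, symmetric]
    by (simp add: sum_distrib_left sum_negf sum_divide_distrib)
  have "cmod (char (distr M borel (\<lambda>\<omega>. \<Sum>i\<in>A. X i \<omega>)) t - complex_of_real (exp (- (t\<^sup>2 * (\<Sum>i\<in>A. s i)) / 2)))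
    \<le> (\<Sum>i\<in>A. cmod (char (distr M borel (X i)) t - complex_of_real (exp (- (t\<^sup>2 * s i) / 2))))"
    unfolding e char_distr_sum[OF indep]
  proof (rule norm_prod_diff)
    fix i assume "i \<in> A"
    show "cmod (char (distr M borel (X i)) t) \<le> 1"
      by (intro real_distribution.cmod_char_le_1 real_distribution_distr rv \<open>i \<in> A\<close>)
    show "cmod (complex_of_real (exp (- (t\<^sup>2 * s i) / 2))) \<le> 1"
      by (simp add: s_def)
  qed
  also have "\<dots> \<le> (\<Sum>i\<in>A. \<bar>t\<bar>^3 / 6 * (\<epsilon> * s i + f i / \<epsilon>) + t ^ 4 * f i / 8)"
    unfolding s_def f_def
    by (intro sum_mono char_gaussian_approx rv int4 mean \<open>0 < \<epsilon>\<close>)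
  also have "\<dots> = \<bar>t\<bar>^3 / 6 * (\<epsilon> * (\<Sum>i\<in>A. s i) + (\<Sum>i\<in>A. f i) / \<epsilon>) + t ^ 4 * (\<Sum>i\<in>A. f i) / 8"
    by (simp only: sum.distrib sum_distrib_left[symmetric] sum_divide_distrib[symmetric])
  finally show ?thesis unfolding s_def f_def by simp
qed

section \<open>Convergence in distribution of independent coordinates\<close>

lemma vec_of_fun_measurable [measurable]:
  "(\<lambda>y. \<chi> j. y j) \<in> measurable (PiM UNIV (\<lambda>_::'p::finite. borel)) (borel :: (real^'p) measure)"
proof (subst borel_measurable_euclidean_space, rule ballI)
  fix b :: "real^'p" assume "b \<in> Basis"
  then obtain j where "b = axis j 1" by (auto simp: Basis_vec_def)
  then show "(\<lambda>y. (\<chi> j. y j) \<bullet> b) \<in> borel_measurable (PiM UNIV (\<lambda>_::'p. borel))"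
    by (simp add: inner_axis)
qed

text \<open>
  Each coordinate converges weakly by Levy's continuity theorem, so Skorohod's theorem realizes its
  laws by variables on some space that converge everywhere. On the product of these spaces all
  coordinates converge simultaneously, and for large \<open>n\<close> the vector formed there has the law of
  \<open>Z n\<close> by independence. Dominated convergence finishes the proof, without characteristic functions in
  several variables.
\<close>

lemma converges_in_distribution_independent_coordinates:
  fixes Z :: "nat \<Rightarrow> 'p::finite \<Rightarrow> 'w \<Rightarrow> real" and \<mu> :: "'p \<Rightarrow> real measure"
  assumes indep: "\<forall>\<^sub>F n in sequentially. prob_space (M n) \<and> prob_space.indep_vars (M n) (\<lambda>_. borel) (Z n) UNIV"
    and limit: "\<And>j. real_distribution (\<mu> j)"
    and char: "\<And>j t. (\<lambda>n. char (distr (M n) borel (Z n j)) t) \<longlonglongrightarrow> char (\<mu> j) t"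
  shows "converges_in_distribution M (\<lambda>n \<omega>. \<chi> j. Z n j \<omega>)
           (distr (PiM UNIV \<mu>) borel (\<lambda>y. \<chi> j. y j))"
proof -
  obtain n0 where n0: "\<And>n. n \<ge> n0 \<Longrightarrow> prob_space (M n)"
    "\<And>n. n \<ge> n0 \<Longrightarrow> prob_space.indep_vars (M n) (\<lambda>_. borel) (Z n) UNIV"
    using indep by (auto simp: eventually_sequentially)
  have rv: "Z n j \<in> borel_measurable (M n)" if "n \<ge> n0" for n j
    using n0[OF that] by (auto simp: prob_space.indep_vars_def)
  have vec: "(\<lambda>\<omega>. \<chi> j. Z n j \<omega>) \<in> borel_measurable (M n)" if "n \<ge> n0" for n
    using measurable_compose[OF measurable_PiM_single'[where I=UNIV and f="Z n"] vec_of_fun_measurable] rv[OF that]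
    by simp
  \<comment> \<open>Skorohod's theorem concerns full sequences, but only the spaces from \<open>n0\<close> on are known to be probability spaces\<close>
  define L where "L j n = distr (M (n + n0)) borel (Z (n + n0) j)" for j n
  have L: "real_distribution (L j n)" for j n
    unfolding L_def by (intro prob_space.real_distribution_distr n0 rv) auto
  have "weak_conv_m (L j) (\<mu> j)" for j
    by (rule levy_continuity[OF L limit]) (unfold L_def, rule LIMSEQ_ignore_initial_segment[OF char])
  then have "\<exists>(\<Omega> :: real measure) (Ys :: nat \<Rightarrow> real \<Rightarrow> real) (Y :: real \<Rightarrow> real).
    prob_space \<Omega> \<and> (\<forall>n. Ys n \<in> measurable \<Omega> borel) \<and> (\<forall>n. distr \<Omega> borel (Ys n) = L j n) \<and>
    Y \<in> measurable \<Omega> lborel \<and> distr \<Omega> borel Y = \<mu> j \<and> (\<forall>x \<in> space \<Omega>. (\<lambda>n. Ys n x) \<longlonglongrightarrow> Y x)" for j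
    by (intro Skorohod L limit)
  then obtain \<Omega> :: "'p \<Rightarrow> real measure" and Ys Y where
    \<Omega>: "\<And>j. prob_space (\<Omega> j)" and [measurable]: "\<And>j n. Ys j n \<in> borel_measurable (\<Omega> j)"
    and Ys: "\<And>j n. distr (\<Omega> j) borel (Ys j n) = L j n"
    and Y': "\<And>j. Y j \<in> measurable (\<Omega> j) lborel" and Y: "\<And>j. distr (\<Omega> j) borel (Y j) = \<mu> j"
    and lim: "\<And>j x. x \<in> space (\<Omega> j) \<Longrightarrow> (\<lambda>n. Ys j n x) \<longlonglongrightarrow> Y j x"
    by metis
  have [measurable]: "Y j \<in> borel_measurable (\<Omega> j)" for j using Y' by simp
  let ?P = "PiM UNIV \<Omega>"
  interpret P: product_prob_space \<Omega> by (intro product_prob_spaceI \<Omega>)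
  \<comment> \<open>the image of a product measure under a map acting on each coordinate separately\<close>
  have prod: "distr ?P (PiM UNIV (\<lambda>_. borel)) (\<lambda>x j. f j (x j)) = PiM UNIV (\<lambda>j. distr (\<Omega> j) borel (f j))"
    if [measurable]: "\<And>j. f j \<in> borel_measurable (\<Omega> j)" for f :: "'p \<Rightarrow> real \<Rightarrow> real"
  proof (rule product_sigma_finite.PiM_eqI)
    interpret D: prob_space "distr (\<Omega> j) borel (f j)" for j
      by (rule prob_space.prob_space_distr[OF \<Omega>]) simp
    show "product_sigma_finite (\<lambda>j. distr (\<Omega> j) borel (f j))"
      by standard
    show "sets (distr ?P (PiM UNIV (\<lambda>_. borel)) (\<lambda>x j. f j (x j))) = sets (PiM UNIV (\<lambda>j. distr (\<Omega> j) borel (f j)))"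
      by (auto intro!: sets_PiM_cong)
    fix A :: "'p \<Rightarrow> real set" assume "\<And>j. j \<in> UNIV \<Longrightarrow> A j \<in> sets (distr (\<Omega> j) borel (f j))"
    then have A[measurable]: "A j \<in> sets borel" for j by simp
    have "emeasure (distr ?P (PiM UNIV (\<lambda>_. borel)) (\<lambda>x j. f j (x j))) (Pi\<^sub>E UNIV A)
      = emeasure ?P ((\<lambda>x j. f j (x j)) -` Pi\<^sub>E UNIV A \<inter> space ?P)"
      by (rule emeasure_distr) (auto intro!: measurable_PiM_single' sets_PiM_I_finite simp: space_PiM)
    also have "(\<lambda>x j. f j (x j)) -` Pi\<^sub>E UNIV A \<inter> space ?P = (\<Pi>\<^sub>E j\<in>UNIV. f j -` A j \<inter> space (\<Omega> j))"
      by (auto simp: space_PiM PiE_def Pi_def)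
    also have "emeasure ?P \<dots> = (\<Prod>j\<in>UNIV. emeasure (\<Omega> j) (f j -` A j \<inter> space (\<Omega> j)))"
      by (rule P.emeasure_PiM) auto
    finally show "emeasure (distr ?P (PiM UNIV (\<lambda>_. borel)) (\<lambda>x j. f j (x j))) (Pi\<^sub>E UNIV A)
      = (\<Prod>j\<in>UNIV. emeasure (distr (\<Omega> j) borel (f j)) (A j))"
      by (simp add: emeasure_distr)
  qed simp
  show ?thesis
    unfolding converges_in_distribution_def
  proof (intro conjI allI impI)
    show "\<forall>\<^sub>F n in sequentially. (\<lambda>\<omega>. \<chi> j. Z n j \<omega>) \<in> borel_measurable (M n)"
      using vec by (auto simp: eventually_sequentially)
  next
    fix g :: "real^'p \<Rightarrow> real" assume g: "continuous_on UNIV g \<and> bounded (range g)"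
    then have [measurable]: "g \<in> borel_measurable borel" by (auto intro: borel_measurable_continuous_onI)
    obtain C where C: "\<And>x. norm (g x) \<le> C" using g by (auto simp: bounded_iff)
    let ?v = "\<lambda>y :: 'p \<Rightarrow> real. (\<chi> j. y j) :: real^'p"
    have "(\<integral>\<omega>. g (\<chi> j. Z (n + n0) j \<omega>) \<partial>M (n + n0)) = (\<integral>x. g (?v (\<lambda>j. Ys j n (x j))) \<partial>?P)" for n
    proof -
      interpret Mn: prob_space "M (n + n0)" by (rule n0) simp
      have "(\<integral>\<omega>. g (\<chi> j. Z (n + n0) j \<omega>) \<partial>M (n + n0))
        = (\<integral>y. g (?v y) \<partial>distr (M (n + n0)) (PiM UNIV (\<lambda>_. borel)) (\<lambda>\<omega>. \<lambda>j\<in>UNIV. Z (n + n0) j \<omega>))"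
        using rv[of "n + n0"] by (subst integral_distr) (auto simp: restrict_UNIV intro!: measurable_PiM_single')
      also have "distr (M (n + n0)) (PiM UNIV (\<lambda>_. borel)) (\<lambda>\<omega>. \<lambda>j\<in>UNIV. Z (n + n0) j \<omega>) = PiM UNIV (\<lambda>j. L j n)"
        using n0(2)[of "n + n0"] rv[of "n + n0"] unfolding L_def
        by (subst Mn.indep_vars_iff_distr_eq_PiM[symmetric]) auto
      also have "\<dots> = distr ?P (PiM UNIV (\<lambda>_. borel)) (\<lambda>x j. Ys j n (x j))"
        by (subst prod) (auto simp: Ys)
      also have "(\<integral>y. g (?v y) \<partial>\<dots>) = (\<integral>x. g (?v (\<lambda>j. Ys j n (x j))) \<partial>?P)"
        by (subst integral_distr) (auto intro!: measurable_PiM_single' simp: space_PiM)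
      finally show ?thesis .
    qed
    moreover have "(\<integral>z. g z \<partial>distr (PiM UNIV \<mu>) borel ?v) = (\<integral>x. g (?v (\<lambda>j. Y j (x j))) \<partial>?P)"
    proof -
      have *: "PiM UNIV \<mu> = distr ?P (PiM UNIV (\<lambda>_. borel)) (\<lambda>x j. Y j (x j))"
        by (subst prod) (auto simp: Y)
      show ?thesis unfolding *
        by (simp add: distr_distr integral_distr) (subst integral_distr; auto intro!: measurable_compose[OF _ vec_of_fun_measurable] measurable_PiM_single' simp: space_PiM comp_def)
    qed
    moreover have "(\<lambda>n. \<integral>x. g (?v (\<lambda>j. Ys j n (x j))) \<partial>?P) \<longlonglongrightarrow> (\<integral>x. g (?v (\<lambda>j. Y j (x j))) \<partial>?P)"
    proof (rule integral_dominated_convergence[where w="\<lambda>_. C"])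
      show "(\<lambda>x. g (?v (\<lambda>j. Y j (x j)))) \<in> borel_measurable ?P"
        by (intro measurable_compose[OF _ \<open>g \<in> borel_measurable borel\<close>] measurable_compose[OF _ vec_of_fun_measurable] measurable_PiM_single') (auto simp: space_PiM)
      show "(\<lambda>x. g (?v (\<lambda>j. Ys j n (x j)))) \<in> borel_measurable ?P" for n
        by (intro measurable_compose[OF _ \<open>g \<in> borel_measurable borel\<close>] measurable_compose[OF _ vec_of_fun_measurable] measurable_PiM_single') (auto simp: space_PiM)
      show "AE x in ?P. (\<lambda>n. g (?v (\<lambda>j. Ys j n (x j)))) \<longlonglongrightarrow> g (?v (\<lambda>j. Y j (x j)))"
      proof (rule AE_I2)
        fix x assume "x \<in> space ?P"
        then have "(\<lambda>n. ?v (\<lambda>j. Ys j n (x j))) \<longlonglongrightarrow> ?v (\<lambda>j. Y j (x j))"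
          by (intro vec_tendstoI) (auto simp: space_PiM intro!: lim)
        then show "(\<lambda>n. g (?v (\<lambda>j. Ys j n (x j)))) \<longlonglongrightarrow> g (?v (\<lambda>j. Y j (x j)))"
          using g by (intro isCont_tendsto_compose[of _ g]) (auto simp: continuous_on_eq_continuous_at)
      qed
      show "integrable ?P (\<lambda>_. C)"
        by (intro finite_measure.integrable_const prob_space.finite_measure prob_space_PiM \<Omega>)
    qed (use C in auto)
    ultimately show "(\<lambda>n. \<integral>\<omega>. g (\<chi> j. Z n j \<omega>) \<partial>M n) \<longlonglongrightarrow> (\<integral>z. g z \<partial>distr (PiM UNIV \<mu>) borel ?v)"
      using LIMSEQ_offset[of "\<lambda>n. \<integral>\<omega>. g (\<chi> j. Z n j \<omega>) \<partial>M n" n0] by presburger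
  qed
qed

section \<open>Counts and heights of a Poisson process\<close>

abbreviation below :: "('a \<times> real) set \<Rightarrow> real \<Rightarrow> ('a \<times> real) set" where
  "below D y \<equiv> {z \<in> D. snd z \<le> y}"

abbreviation above :: "('a \<times> real) set \<Rightarrow> real \<Rightarrow> ('a \<times> real) set" where
  "above D y \<equiv> {z \<in> D. y < snd z}"

lemma num_points_Un_disjoint:
  "A \<inter> B = {} \<Longrightarrow> num_points Z (A \<union> B) = num_points Z A + num_points Z B"
  unfolding num_points_def by (induction Z) auto

lemma num_points_eq_0_iff: "num_points Z B = 0 \<longleftrightarrow> (\<forall>z\<in>#Z. z \<notin> B)"
  by (auto simp: num_points_def filter_mset_eq_conv)

lemma num_points_split_height:
  fixes y :: real
  shows "num_points Z D = num_points Z (below D y) + num_points Z (above D y)"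
proof -
  have "D = (below D y) \<union> (above D y)" by auto
  then show ?thesis by (subst num_points_Un_disjoint[symmetric]) auto
qed

text \<open>
  This translates heights into counts, about which alone the definition of a Poisson process speaks.
  For negative \<open>y\<close> it would fail in an empty cell, where \<open>Y_star\<close> is \<open>0\<close>.
\<close>

lemma Y_star_le_iff:
  assumes "0 \<le> y"
  shows "Y_star Z D \<le> y \<longleftrightarrow> num_points Z (above D y) = 0"
proof (cases "num_points Z D = 0")
  case True
  then show ?thesis
    using assms num_points_split_height[of Z D y] by (simp add: Y_star_def)
next
  case False
  then have "{z \<in> set_mset Z. z \<in> D} \<noteq> {}" by (auto simp: num_points_eq_0_iff)
  then show ?thesis
    using False by (subst Y_star_def) (auto simp: num_points_eq_0_iff not_less)
qed

lemma Y_star_nonneg: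
  assumes "\<And>z. z \<in> D \<Longrightarrow> 0 \<le> snd z"
  shows "0 \<le> Y_star Z D"
proof (cases "num_points Z D = 0")
  case False
  then obtain z where "z \<in># Z" "z \<in> D" by (auto simp: num_points_eq_0_iff)
  then have "snd z \<le> Y_star Z D"
    using False unfolding Y_star_def by (auto intro!: Max_ge)
  then show ?thesis using assms[OF \<open>z \<in> D\<close>] by simp
qed (simp add: Y_star_def)

lemma Y_star_le_bound:
  assumes "\<And>z. z \<in> D \<Longrightarrow> snd z \<le> b" "0 \<le> b"
  shows "Y_star Z D \<le> b"
  using assms by (subst Y_star_le_iff) (force simp: num_points_eq_0_iff)+

lemma poisson_processD:
  assumes "poisson_process M \<mu> N"
  shows "prob_space M" "finite_measure \<mu>"
    and "B \<in> sets \<mu> \<Longrightarrow> (\<lambda>\<omega>. num_points (N \<omega>) B) \<in> measurable M (count_space UNIV)"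
    and "B \<in> sets \<mu> \<Longrightarrow> measure M {\<omega>\<in>space M. num_points (N \<omega>) B = j}
               = exp (- measure \<mu> B) * measure \<mu> B ^ j / fact j"
    and "\<lbrakk>\<And>i. i < m \<Longrightarrow> C i \<in> sets \<mu>; disjoint_family_on C {..<m}\<rbrakk>
      \<Longrightarrow> prob_space.indep_vars M (\<lambda>_. count_space UNIV) (\<lambda>i \<omega>. num_points (N \<omega>) (C i)) {..<m :: nat}"
proof -
  note pp = assms[unfolded poisson_process_def]
  show "prob_space M" by (rule pp[THEN conjunct1])
  show "finite_measure \<mu>" by (rule pp[THEN conjunct2, THEN conjunct1])
  note counts = pp[THEN conjunct2, THEN conjunct2, THEN conjunct2]
  note law = counts[THEN conjunct1, rule_format] and indep = counts[THEN conjunct2, rule_format]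
  show "B \<in> sets \<mu> \<Longrightarrow> (\<lambda>\<omega>. num_points (N \<omega>) B) \<in> measurable M (count_space UNIV)"
    by (rule law[THEN conjunct1])
  show "B \<in> sets \<mu> \<Longrightarrow> measure M {\<omega>\<in>space M. num_points (N \<omega>) B = j}
      = exp (- measure \<mu> B) * measure \<mu> B ^ j / fact j"
    by (rule law[THEN conjunct2, rule_format])
  show "\<lbrakk>\<And>i. i < m \<Longrightarrow> C i \<in> sets \<mu>; disjoint_family_on C {..<m}\<rbrakk>
      \<Longrightarrow> prob_space.indep_vars M (\<lambda>_. count_space UNIV) (\<lambda>i \<omega>. num_points (N \<omega>) (C i)) {..<m}"
    by (rule indep) auto
qed

lemma poisson_process_indep_counts:
  assumes pp: "poisson_process M \<mu> N" and "finite A"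
    and sets: "\<And>i. i \<in> A \<Longrightarrow> B i \<in> sets \<mu>" and disj: "disjoint_family_on B A"
  shows "prob_space.indep_vars M (\<lambda>_. count_space UNIV) (\<lambda>i \<omega>. num_points (N \<omega>) (B i)) A"
proof -
  interpret prob_space M by (rule poisson_processD(1)[OF pp])
  obtain e where e: "bij_betw e {0..<card A} A" using ex_bij_betw_nat_finite[OF \<open>finite A\<close>] by blast
  have inj: "inj_on e {..<card A}" and img: "e ` {..<card A} = A"
    using e by (auto simp: bij_betw_def lessThan_atLeast0)
  have indep: "indep_vars (\<lambda>_. count_space UNIV) (\<lambda>i \<omega>. num_points (N \<omega>) (B (e i))) {..<card A}"
  proof -
    have "B (e i) \<in> sets \<mu>" if "i < card A" for i using sets img that by blast
    moreover have "disjoint_family_on (\<lambda>i. B (e i)) {..<card A}"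
      unfolding disjoint_family_on_def
    proof (intro ballI impI)
      fix m n assume mn: "m \<in> {..<card A}" "n \<in> {..<card A}" "m \<noteq> n"
      then have "e m \<in> A" "e n \<in> A" "e m \<noteq> e n" using inj img by (auto dest: inj_onD)
      then show "B (e m) \<inter> B (e n) = {}" using disj by (simp add: disjoint_family_on_def)
    qed
    ultimately show ?thesis by (rule poisson_processD(5)[OF pp])
  qed
  define r where "r = the_inv_into {..<card A} e"
  have r: "r i \<in> {..<card A}" "e (r i) = i" if "i \<in> A" for i
    using the_inv_into_into[OF inj, of i "{..<card A}"] f_the_inv_into_f[OF inj, of i] that img
    by (auto simp: r_def)
  \<comment> \<open>independence is transported along the enumeration by restriction to singletons\<close>
  have "indep_vars (\<lambda>i. PiM {r i} (\<lambda>_. count_space UNIV))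
      (\<lambda>i \<omega>. restrict (\<lambda>j. num_points (N \<omega>) (B (e j))) {r i}) A"
  proof (rule indep_vars_restrict[OF indep])
    show "disjoint_family_on (\<lambda>i. {r i}) A"
      unfolding disjoint_family_on_def
    proof (intro ballI impI)
      fix m n assume "m \<in> A" "n \<in> A" "m \<noteq> n"
      then have "r m \<noteq> r n" using r(2)[of m] r(2)[of n] by metis
      then show "{r m} \<inter> {r n} = {}" by simp
    qed
  qed (use r in auto)
  then have "indep_vars (\<lambda>_. count_space UNIV)
      (\<lambda>i \<omega>. (\<lambda>g. g (r i)) (restrict (\<lambda>j. num_points (N \<omega>) (B (e j))) {r i})) A"
    by (rule indep_vars_compose2) simp
  then show ?thesis
    by (rule indep_vars_cong[THEN iffD1, rotated -1]) (auto simp: r)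
qed

context
  fixes M :: "'w measure" and \<mu> :: "('a \<times> real) measure" and N
  assumes pp: "poisson_process M \<mu> N" and snd_measurable [measurable]: "snd \<in> borel_measurable \<mu>"
begin

interpretation prob_space M by (rule poisson_processD(1)[OF pp])
interpretation \<mu>: finite_measure \<mu> by (rule poisson_processD(2)[OF pp])

lemma num_points_measurable [measurable]:
  "B \<in> sets \<mu> \<Longrightarrow> (\<lambda>\<omega>. num_points (N \<omega>) B) \<in> measurable M (count_space UNIV)"
  by (rule poisson_processD(3)[OF pp])

lemma sets_height [measurable]:
  assumes [measurable]: "D \<in> sets \<mu>"
  shows "below D y \<in> sets \<mu>" "above D y \<in> sets \<mu>"
proof -
  have "{z \<in> space \<mu>. z \<in> D \<and> snd z \<le> y} \<in> sets \<mu>" "{z \<in> space \<mu>. z \<in> D \<and> y < snd z} \<in> sets \<mu>" by measurable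
  moreover have "{z \<in> space \<mu>. z \<in> D \<and> P z} = {z \<in> D. P z}" for P
    using sets.sets_into_space[OF assms] by auto
  ultimately show "below D y \<in> sets \<mu>" "above D y \<in> sets \<mu>" by auto
qed

text \<open>
  Cutting each cell at a height of its own produces twice as many sets, which are still disjoint.
\<close>

lemma counts_below_above_indep:
  assumes fin: "finite A" and D: "\<And>i. i \<in> A \<Longrightarrow> D i \<in> sets \<mu>" and disj: "disjoint_family_on D A"
  shows "prob (space M \<inter> (\<Inter>i\<in>A. {\<omega>. num_points (N \<omega>) (below (D i) (y i)) \<in> P i \<and> num_points (N \<omega>) (above (D i) (y i)) \<in> Q i}))
    = (\<Prod>i\<in>A. prob {\<omega>\<in>space M. num_points (N \<omega>) (below (D i) (y i)) \<in> P i} * prob {\<omega>\<in>space M. num_points (N \<omega>) (above (D i) (y i)) \<in> Q i})"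
proof (cases "A = {}")
  case True then show ?thesis by (simp add: prob_space)
next
  case False
  define C where "C = (\<lambda>(i, b). if b then (below (D i) (y i)) else (above (D i) (y i)))"
  define R where "R = (\<lambda>(i, b). if b then P i else Q i)"
  have "indep_vars (\<lambda>_. count_space UNIV) (\<lambda>i \<omega>. num_points (N \<omega>) (C i)) (A \<times> UNIV)"
  proof (rule poisson_process_indep_counts[OF pp])
    show "disjoint_family_on C (A \<times> UNIV)"
      unfolding disjoint_family_on_def
    proof (intro ballI impI)
      fix p q assume pq: "p \<in> A \<times> (UNIV :: bool set)" "q \<in> A \<times> (UNIV :: bool set)" "p \<noteq> q"
      show "C p \<inter> C q = {}"
      proof (cases "fst p = fst q")
        case True
        then show ?thesis using pq by (auto simp: C_def split: if_splits)
      next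
        case False
        then have "D (fst p) \<inter> D (fst q) = {}"
          using disj[unfolded disjoint_family_on_def, rule_format, of "fst p" "fst q"] pq by (auto simp: mem_Times_iff)
        moreover have "C r \<subseteq> D (fst r)" for r by (auto simp: C_def split: prod.splits)
        ultimately show ?thesis by blast
      qed
    qed
  qed (use fin D in \<open>auto simp: C_def\<close>)
  then have "prob (\<Inter>i\<in>A \<times> UNIV. (\<lambda>\<omega>. num_points (N \<omega>) (C i)) -` R i \<inter> space M)
    = (\<Prod>i\<in>A \<times> UNIV. prob ((\<lambda>\<omega>. num_points (N \<omega>) (C i)) -` R i \<inter> space M))"
    using fin False by (intro indep_varsD_finite) auto
  also have "(\<Inter>i\<in>A \<times> UNIV. (\<lambda>\<omega>. num_points (N \<omega>) (C i)) -` R i \<inter> space M)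
    = {\<omega>\<in>space M. \<forall>i\<in>A. \<forall>b. num_points (N \<omega>) (C (i, b)) \<in> R (i, b)}"
    using False by auto
  also have "\<dots> = space M \<inter> (\<Inter>i\<in>A. {\<omega>. num_points (N \<omega>) (below (D i) (y i)) \<in> P i \<and> num_points (N \<omega>) (above (D i) (y i)) \<in> Q i})"
    by (auto simp: C_def R_def all_bool_eq)
  also have "(\<Prod>i\<in>A \<times> UNIV. prob ((\<lambda>\<omega>. num_points (N \<omega>) (C i)) -` R i \<inter> space M))
    = (\<Prod>i\<in>A. \<Prod>b\<in>UNIV. prob ((\<lambda>\<omega>. num_points (N \<omega>) (C (i, b))) -` R (i, b) \<inter> space M))"
    by (simp add: prod.cartesian_product)
  also have "\<dots> = (\<Prod>i\<in>A. prob {\<omega>\<in>space M. num_points (N \<omega>) (below (D i) (y i)) \<in> P i} * prob {\<omega>\<in>space M. num_points (N \<omega>) (above (D i) (y i)) \<in> Q i})"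
  proof (rule prod.cong[OF refl])
    fix i
    have "(\<lambda>\<omega>. num_points (N \<omega>) (C (i, True))) -` R (i, True) \<inter> space M = {\<omega>\<in>space M. num_points (N \<omega>) (below (D i) (y i)) \<in> P i}"
      "(\<lambda>\<omega>. num_points (N \<omega>) (C (i, False))) -` R (i, False) \<inter> space M = {\<omega>\<in>space M. num_points (N \<omega>) (above (D i) (y i)) \<in> Q i}"
      by (auto simp: C_def R_def)
    then show "(\<Prod>b\<in>UNIV. prob ((\<lambda>\<omega>. num_points (N \<omega>) (C (i, b))) -` R (i, b) \<inter> space M))
      = prob {\<omega>\<in>space M. num_points (N \<omega>) (below (D i) (y i)) \<in> P i} * prob {\<omega>\<in>space M. num_points (N \<omega>) (above (D i) (y i)) \<in> Q i}"
      by (simp add: UNIV_bool mult.commute)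
  qed
  finally show ?thesis .
qed

text \<open>
  The event says that the part of the cell below \<open>y\<close> has \<open>j\<close> points and the part above has none.
\<close>

lemma count_height_law:
  assumes D: "D \<in> sets \<mu>" and y: "0 \<le> y"
  shows "prob {\<omega>\<in>space M. num_points (N \<omega>) D = j \<and> Y_star (N \<omega>) D \<le> y}
    = exp (- measure \<mu> D) * measure \<mu> (below D y) ^ j / fact j"
proof -
  have law: "prob {\<omega>\<in>space M. num_points (N \<omega>) B = i} = exp (- measure \<mu> B) * measure \<mu> B ^ i / fact i"
    if "B \<in> sets \<mu>" for B i by (rule poisson_processD(4)[OF pp that])
  let ?L = "(below D y)" and ?H = "(above D y)"
  have "measure \<mu> D = measure \<mu> (?L \<union> ?H)" by (rule arg_cong[where f="measure \<mu>"]) auto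
  also have "\<dots> = measure \<mu> ?L + measure \<mu> ?H"
    by (rule \<mu>.finite_measure_Union) (auto intro: sets_height[OF D])
  finally have m: "measure \<mu> D = measure \<mu> ?L + measure \<mu> ?H" .
  have "{\<omega>\<in>space M. num_points (N \<omega>) D = j \<and> Y_star (N \<omega>) D \<le> y}
    = space M \<inter> {\<omega>. num_points (N \<omega>) ?L \<in> {j} \<and> num_points (N \<omega>) ?H \<in> {0}}"
    using num_points_split_height[of _ D y] by (auto simp: Y_star_le_iff[OF y])
  also have "prob \<dots> = prob {\<omega>\<in>space M. num_points (N \<omega>) ?L \<in> {j}} * prob {\<omega>\<in>space M. num_points (N \<omega>) ?H \<in> {0}}"
    using counts_below_above_indep[of "{()}" "\<lambda>_. D" "\<lambda>_. y" "\<lambda>_. {j}" "\<lambda>_. {0}"] D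
    by (simp add: disjoint_family_on_def)
  also have "\<dots> = exp (- measure \<mu> D) * measure \<mu> ?L ^ j / fact j"
    using law[OF sets_height(1)[OF D]] law[OF sets_height(2)[OF D]]
    by (simp add: m exp_add[symmetric] mult_exp_exp)
  finally show ?thesis .
qed

text \<open>
  The highest point depends on the counts in infinitely many sets, so independence cannot be read off
  from finitely many counts. But the events that the count is at most \<open>m\<close> and the height at most
  \<open>y\<close> are stable under intersection and generate the joint sigma-algebra, and each of them is decided
  by the counts below and above \<open>y\<close>.
\<close>

lemma cells_indep:
  assumes fin: "finite A" and D: "\<And>i. i \<in> A \<Longrightarrow> D i \<in> sets \<mu>" and disj: "disjoint_family_on D A"
    and pos: "\<And>i z. i \<in> A \<Longrightarrow> z \<in> D i \<Longrightarrow> 0 \<le> snd z"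
  shows "indep_vars (\<lambda>_. count_space UNIV \<Otimes>\<^sub>M borel) (\<lambda>i \<omega>. (num_points (N \<omega>) (D i), Y_star (N \<omega>) (D i))) A"
proof (cases "A = {}")
  case True then show ?thesis by (simp add: indep_vars_def indep_sets_def)
next
  case False
  define E where "E i m y = {\<omega>\<in>space M. num_points (N \<omega>) (below (D i) y) \<le> m \<and> num_points (N \<omega>) (above (D i) y) = 0}" for i m and y :: real
  have E_eq: "E i m y = {\<omega>\<in>space M. num_points (N \<omega>) (D i) \<le> m \<and> Y_star (N \<omega>) (D i) \<le> y}" if "0 \<le> y" for i m y
    using num_points_split_height[of _ "D i" y] by (auto simp: E_def Y_star_le_iff[OF that])
  \<comment> \<open>independence of finitely many families containing the whole space only concerns full intersections\<close>
  define G where "G i = insert (space M) {E i m y | m y. 0 \<le> y}" for i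
  have E_sets: "E i m y \<in> events" if "i \<in> A" for i m y
    using sets_height[OF D[OF that], of y] unfolding E_def by measurable
  have "indep_sets G A"
  proof (subst indep_sets_finite[OF False fin])
    show "G i \<subseteq> events" if "i \<in> A" for i using E_sets[OF that] by (auto simp: G_def)
    show "space M \<in> G i" for i by (simp add: G_def)
    show "\<forall>C\<in>Pi A G. prob (\<Inter> (C ` A)) = (\<Prod>j\<in>A. prob (C j))"
    proof
      fix C assume C: "C \<in> Pi A G"
      show "prob (\<Inter> (C ` A)) = (\<Prod>j\<in>A. prob (C j))"
      proof -
        define S where "S i t = {\<omega>\<in>space M. num_points (N \<omega>) (below (D i) (fst t)) \<in> fst (snd t) \<and> num_points (N \<omega>) (above (D i) (fst t)) \<in> snd (snd t)}" for i t
        have "\<exists>t. C i = S i t" if "i \<in> A" for i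
        proof -
          have "C i \<in> G i" using C that by auto
          then consider "C i = space M" | m y where "C i = E i m y"
            unfolding G_def by blast
          then show ?thesis
          proof cases
            case 1
            then show ?thesis by (intro exI[of _ "(0, UNIV, UNIV)"]) (simp add: S_def)
          next
            case 2
            then show ?thesis by (intro exI[of _ "(y, {..m}, {0})"]) (simp add: S_def E_def)
          qed
        qed
        then obtain t where t: "\<forall>i\<in>A. C i = S i (t i)"
          using bchoice[of A "\<lambda>i t. C i = S i t"] by blast
        define y P Q where "y i = fst (t i)" and "P i = fst (snd (t i))" and "Q i = snd (snd (t i))" for i
        have CC: "C i = {\<omega>\<in>space M. num_points (N \<omega>) (below (D i) (y i)) \<in> P i \<and> num_points (N \<omega>) (above (D i) (y i)) \<in> Q i}" if "i \<in> A" for i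
          using t that by (simp add: S_def y_def P_def Q_def)
        have "\<Inter> (C ` A) = space M \<inter> (\<Inter>i\<in>A. {\<omega>. num_points (N \<omega>) (below (D i) (y i)) \<in> P i \<and> num_points (N \<omega>) (above (D i) (y i)) \<in> Q i})"
          using CC False by auto
        moreover have "prob (C i) = prob {\<omega>\<in>space M. num_points (N \<omega>) (below (D i) (y i)) \<in> P i} * prob {\<omega>\<in>space M. num_points (N \<omega>) (above (D i) (y i)) \<in> Q i}" if "i \<in> A" for i
        proof -
          have "C i = space M \<inter> (\<Inter>i\<in>{i}. {\<omega>. num_points (N \<omega>) (below (D i) (y i)) \<in> P i \<and> num_points (N \<omega>) (above (D i) (y i)) \<in> Q i})"
            unfolding CC[OF that] by auto
          then show ?thesis
            using counts_below_above_indep[of "{i}" D y P Q] D[OF that] by (simp add: disjoint_family_on_def)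
        qed
        ultimately show ?thesis
          using counts_below_above_indep[OF fin D disj, of y P Q] by simp
      qed
    qed
  qed
  moreover have "Int_stable (G i)" for i
  proof -
    have E_Int: "E i m y \<inter> E i m' y' = E i (min m m') (min y y')" if "0 \<le> y" "0 \<le> y'" for m m' y y'
      using that by (auto simp: E_eq)
    have sub: "X \<subseteq> space M" if "X \<in> G i" for X using that by (auto simp: G_def E_def)
    have "X \<inter> X' \<in> G i" if X: "X \<in> G i" and X': "X' \<in> G i" for X X'
    proof -
      consider "X = space M" | "X' = space M"
        | m y m' y' where "0 \<le> y" "0 \<le> y'" "X = E i m y" "X' = E i m' y'"
        using X X' unfolding G_def by blast
      then show ?thesis
      proof cases
        case 1 then have "X \<inter> X' = X'" using sub[OF X'] by blast
        then show ?thesis using X' by simp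
      next
        case 2 then have "X \<inter> X' = X" using sub[OF X] by blast
        then show ?thesis using X by simp
      next
        case 3
        then have "X \<inter> X' = E i (min m m') (min y y')" "0 \<le> min y y'" by (simp_all add: E_Int)
        then show ?thesis unfolding G_def by blast
      qed
    qed
    then show ?thesis by (rule Int_stableI)
  qed
  ultimately have "indep_sets (\<lambda>i. sigma_sets (space M) (G i)) A"
    by (intro indep_sets_sigma) auto
  moreover have meas: "(\<lambda>\<omega>. (num_points (N \<omega>) (D i), Y_star (N \<omega>) (D i))) \<in> measurable (sigma (space M) (G i)) (count_space UNIV \<Otimes>\<^sub>M borel)"
    (is "_ \<in> measurable ?S _") if "i \<in> A" for i
  proof (rule measurable_Pair)
    have Gs: "G i \<subseteq> Pow (space M)" by (auto simp: G_def E_def)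
    have sp: "space ?S = space M" by (rule space_measure_of[OF Gs])
    have E_in: "E i m y \<in> sets ?S" if "0 \<le> y" for m y
      using that unfolding sets_measure_of[OF Gs] by (intro sigma_sets.Basic) (auto simp: G_def)
    have le: "{\<omega>\<in>space M. num_points (N \<omega>) (D i) \<le> m} \<in> sets ?S" for m
    proof -
      have "{\<omega>\<in>space M. num_points (N \<omega>) (D i) \<le> m} = (\<Union>l::nat. E i m (real l))"
        using real_arch_simple by (auto simp: E_eq)
      then show ?thesis using E_in by auto
    qed
    show "(\<lambda>\<omega>. num_points (N \<omega>) (D i)) \<in> measurable ?S (count_space UNIV)"
    proof (subst measurable_count_space_eq2_countable, safe)
      fix m :: nat
      have "(\<lambda>\<omega>. num_points (N \<omega>) (D i)) -` {m} \<inter> space ?S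
        = {\<omega>\<in>space M. num_points (N \<omega>) (D i) \<le> m} - (if m = 0 then {} else {\<omega>\<in>space M. num_points (N \<omega>) (D i) \<le> m - 1})"
        by (auto simp: sp)
      also have "\<dots> \<in> sets ?S" using le by (intro sets.Diff) auto
      finally show "(\<lambda>\<omega>. num_points (N \<omega>) (D i)) -` {m} \<inter> space ?S \<in> sets ?S" .
    qed auto
    show "(\<lambda>\<omega>. Y_star (N \<omega>) (D i)) \<in> borel_measurable ?S"
    proof (subst borel_measurable_iff_le, rule allI)
      fix y :: real
      show "{\<omega> \<in> space ?S. Y_star (N \<omega>) (D i) \<le> y} \<in> sets ?S"
      proof (cases "0 \<le> y")
        case True
        have "{\<omega> \<in> space M. Y_star (N \<omega>) (D i) \<le> y} = (\<Union>m. E i m y)"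
          using True by (auto simp: E_eq)
        then show ?thesis using E_in[OF True] by (auto simp: sp)
      next
        case False
        then have "{\<omega> \<in> space ?S. Y_star (N \<omega>) (D i) \<le> y} = {}"
        proof -
          have "0 \<le> Y_star Z (D i)" for Z by (rule Y_star_nonneg) (rule pos[OF that])
          then have "\<not> Y_star Z (D i) \<le> y" for Z using False order_trans by blast
          then show ?thesis by blast
        qed
        then show ?thesis by (simp only: sets.empty_sets)
      qed
    qed
  qed
  have sub: "sigma_sets (space M) (G i) \<subseteq> events" if "i \<in> A" for i
    using E_sets[OF that] by (intro sets.sigma_sets_subset) (auto simp: G_def)
  show ?thesis
    unfolding indep_vars_def2
  proof (intro conjI ballI)
    fix i assume i: "i \<in> A"
    have Gs: "G i \<subseteq> Pow (space M)" by (auto simp: G_def E_def)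
    show "(\<lambda>\<omega>. (num_points (N \<omega>) (D i), Y_star (N \<omega>) (D i))) \<in> measurable M (count_space UNIV \<Otimes>\<^sub>M borel)"
    proof (rule measurableI)
      fix S :: "(nat \<times> real) set" assume S: "S \<in> sets (count_space UNIV \<Otimes>\<^sub>M borel)"
      show "(\<lambda>\<omega>. (num_points (N \<omega>) (D i), Y_star (N \<omega>) (D i))) -` S \<inter> space M \<in> events"
        using measurable_sets[OF meas[OF i] S] sub[OF i] by (auto simp: sets_measure_of[OF Gs] space_measure_of[OF Gs])
    qed (simp add: space_pair_measure)
  next
    show "indep_sets (\<lambda>i. {(\<lambda>\<omega>. (num_points (N \<omega>) (D i), Y_star (N \<omega>) (D i))) -` S \<inter> space M | S. S \<in> sets (count_space UNIV \<Otimes>\<^sub>M borel)}) A"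
    proof (rule indep_sets_mono_sets[OF \<open>indep_sets (\<lambda>i. sigma_sets (space M) (G i)) A\<close>])
      fix i assume i: "i \<in> A"
      have Gs: "G i \<subseteq> Pow (space M)" by (auto simp: G_def E_def)
      show "{(\<lambda>\<omega>. (num_points (N \<omega>) (D i), Y_star (N \<omega>) (D i))) -` S \<inter> space M | S. S \<in> sets (count_space UNIV \<Otimes>\<^sub>M borel)} \<subseteq> sigma_sets (space M) (G i)"
        using measurable_sets[OF meas[OF i]] by (auto simp: sets_measure_of[OF Gs] space_measure_of[OF Gs])
    qed
  qed
qed

text \<open>
  The probability integral transform, for the intensity \<open>F(y)\<close> of the part below height \<open>y\<close>: \<open>F\<close> attains the value \<open>s * F(\<infinity>)\<close> by continuity, and if \<open>y\<close> is the
  last point where it does, then \<open>F(Y*) \<le> s * F(\<infinity>)\<close> means \<open>Y* \<le> y\<close>. The choice of the last point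
  matters because \<open>F\<close> may be constant on intervals.
\<close>

lemma count_quantile_law:
  assumes D: "D \<in> sets \<mu>" and pos: "\<And>z. z \<in> D \<Longrightarrow> 0 \<le> snd z" and m: "0 < measure \<mu> D"
    and cont: "continuous_on {0..} (\<lambda>y. measure \<mu> (below D y))"
    and F0: "measure \<mu> (below D 0) = 0"
    and b: "0 \<le> b" "\<And>z. z \<in> D \<Longrightarrow> snd z \<le> b"
    and s: "0 \<le> s" "s \<le> 1"
  shows "prob {\<omega>\<in>space M. num_points (N \<omega>) D = j \<and> measure \<mu> (below D (Y_star (N \<omega>) D)) / measure \<mu> D \<le> s}
    = exp (- measure \<mu> D) * measure \<mu> D ^ j / fact j * s ^ j"
proof -
  define F where "F y = measure \<mu> (below D y)" for y
  have mono: "F y \<le> F y'" if "y \<le> y'" for y y'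
    unfolding F_def using that sets_height(1)[OF D] by (intro \<mu>.finite_measure_mono) auto
  have Fb: "F b = measure \<mu> D"
    unfolding F_def using b(2) by (intro arg_cong[where f="measure \<mu>"]) auto
  have Fle: "F y \<le> measure \<mu> D" for y
    unfolding F_def using D by (intro \<mu>.finite_measure_mono) auto
  have Y: "0 \<le> Y_star Z D" "Y_star Z D \<le> b" for Z
    using Y_star_nonneg[OF pos] Y_star_le_bound[OF b(2) b(1)] by auto
  obtain y where y: "0 \<le> y" "y \<le> b" "F y = s * measure \<mu> D"
    and y_max: "\<And>y'. 0 \<le> y' \<Longrightarrow> y' \<le> b \<Longrightarrow> F y' = s * measure \<mu> D \<Longrightarrow> y' \<le> y"
  proof -
    let ?T = "{y \<in> {0..b}. F y = s * measure \<mu> D}"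
    have c: "continuous_on {0..b} F" unfolding F_def by (rule continuous_on_subset[OF cont]) auto
    have "\<exists>y\<ge>0. y \<le> b \<and> F y = s * measure \<mu> D"
    proof (rule IVT')
      show "F 0 \<le> s * measure \<mu> D" using F0 s by (simp add: F_def)
      show "s * measure \<mu> D \<le> F b" using Fb s m by (simp add: mult_le_cancel_right1)
    qed (use b c in auto)
    then have "?T \<noteq> {}" by auto
    moreover have "compact ?T"
    proof -
      have "closed ?T"
        using continuous_closed_preimage[OF c, of "{s * measure \<mu> D}"] by (simp add: vimage_def Int_def)
      then show ?thesis using compact_Int_closed[of "{0..b}" ?T] by (simp add: Int_def cong: conj_cong)
    qed
    ultimately show ?thesis using compact_attains_sup[of ?T] that by fastforce
  qed
  have iff: "F (Y_star Z D) \<le> s * measure \<mu> D \<longleftrightarrow> Y_star Z D \<le> y" for Z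
  proof
    assume "Y_star Z D \<le> y" then show "F (Y_star Z D) \<le> s * measure \<mu> D" using mono y(3) by metis
  next
    assume *: "F (Y_star Z D) \<le> s * measure \<mu> D"
    show "Y_star Z D \<le> y"
    proof (rule ccontr)
      assume n: "\<not> Y_star Z D \<le> y"
      then have "F (Y_star Z D) = s * measure \<mu> D" using mono[of y "Y_star Z D"] y(3) * by simp
      then show False using y_max[OF Y] n by blast
    qed
  qed
  have "{\<omega>\<in>space M. num_points (N \<omega>) D = j \<and> measure \<mu> (below D (Y_star (N \<omega>) D)) / measure \<mu> D \<le> s}
    = {\<omega>\<in>space M. num_points (N \<omega>) D = j \<and> Y_star (N \<omega>) D \<le> y}"
    using iff m by (simp add: F_def pos_divide_le_eq)
  then show ?thesis
    using count_height_law[OF D y(1), of j] y(3) by (simp add: F_def power_mult_distrib)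
qed

end

section \<open>Poisson mixtures of power laws\<close>

text \<open>
  On \<open>E\<close> the variable has density \<open>p * j * s ^ (j - 1)\<close> on the unit interval, since distribution
  functions determine finite measures on the line.
\<close>

lemma (in prob_space) expectation_power_of_power_law:
  fixes X :: "'a \<Rightarrow> real"
  assumes [measurable]: "random_variable borel X" "E \<in> events"
    and X: "\<And>\<omega>. \<omega> \<in> space M \<Longrightarrow> 0 \<le> X \<omega> \<and> X \<omega> \<le> 1" and "0 < j" and p: "0 \<le> p"
    and law: "\<And>s. 0 \<le> s \<Longrightarrow> s \<le> 1 \<Longrightarrow> prob {\<omega>\<in>E. X \<omega> \<le> s} = p * s ^ j"
  shows "expectation (\<lambda>\<omega>. indicator E \<omega> * X \<omega> ^ i) = p * real j / real (j + i)"
proof -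
  have Esub: "E \<subseteq> space M" using assms(2) by (rule sets.sets_into_space)
  define \<nu> where "\<nu> = distr (density M (indicator E)) borel X"
  define g where "g s = p * real j * (s ^ (j - 1) * indicator {0..1} s)" for s :: real
  define \<rho> where "\<rho> = density lborel (\<lambda>s. ennreal (g s))"
  have g0: "0 \<le> g s" for s using p by (auto simp: g_def indicator_def)
  have [measurable]: "g \<in> borel_measurable borel" unfolding g_def[abs_def] by measurable
  have \<nu>: "measure \<nu> {..x} = prob {\<omega>\<in>E. X \<omega> \<le> x}" for x
  proof -
    have "emeasure \<nu> {..x} = emeasure (density M (indicator E)) (X -` {..x} \<inter> space M)"
      unfolding \<nu>_def by (subst emeasure_distr) auto
    also have "\<dots> = emeasure M (E \<inter> (X -` {..x} \<inter> space M))"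
      by (rule emeasure_restricted) auto
    also have "E \<inter> (X -` {..x} \<inter> space M) = {\<omega>\<in>E. X \<omega> \<le> x}" using Esub by auto
    finally show ?thesis by (simp add: measure_def)
  qed
  have \<rho>: "emeasure \<rho> {..x} = ennreal (p * max 0 (min x 1) ^ j)" for x
  proof -
    have "emeasure \<rho> {..x} = (\<integral>\<^sup>+s. ennreal (p * real j * s ^ (j - 1)) * indicator {0..max 0 (min x 1)} s \<partial>lborel)"
      unfolding \<rho>_def
    proof (subst emeasure_density, simp, simp, rule nn_integral_cong_AE)
      show "AE s in lborel. ennreal (g s) * indicator {..x} s = ennreal (p * real j * s ^ (j - 1)) * indicator {0..max 0 (min x 1)} s"
        using AE_lborel_singleton[of 0] by eventually_elim (auto simp: g_def indicator_def)
    qed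
    also have "\<dots> = ennreal (p * max 0 (min x 1) ^ j - p * 0 ^ j)"
    proof (rule nn_integral_FTC_Icc)
      show "((\<lambda>s. p * s ^ j) has_real_derivative p * real j * s ^ (j - 1)) (at s)" for s
        by (auto intro!: derivative_eq_intros)
    qed (use p in auto)
    finally show ?thesis using \<open>0 < j\<close> by (simp add: power_0_left)
  qed
  have fin1: "finite_borel_measure \<nu>"
  proof -
    have "finite_measure (density M (indicator E))"
      by (rule finite_measureI) (simp add: emeasure_restricted emeasure_eq_measure)
    then show ?thesis
      unfolding finite_borel_measure_def finite_borel_measure_axioms_def \<nu>_def
      by (auto intro: finite_measure.finite_measure_distr)
  qed
  have fin2: "finite_borel_measure \<rho>"
  proof -
    have "UNIV = (\<Union>n::nat. {..real n})" using real_arch_simple by auto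
    then have "emeasure \<rho> UNIV = emeasure \<rho> (\<Union>n::nat. {..real n})" by (rule arg_cong)
    also have "\<dots> = (SUP n::nat. emeasure \<rho> {..real n})"
      by (subst SUP_emeasure_incseq) (auto simp: \<rho>_def incseq_def)
    also have "\<dots> \<le> ennreal p"
      unfolding \<rho> by (rule SUP_least) (use p in \<open>auto intro!: ennreal_leI mult_left_le power_le_one\<close>)
    finally have "emeasure \<rho> UNIV < \<infinity>" by (simp add: le_less_trans)
    then have "finite_measure \<rho>" by (intro finite_measureI) (simp add: \<rho>_def)
    then show ?thesis
      unfolding finite_borel_measure_def finite_borel_measure_axioms_def by (simp add: \<rho>_def)
  qed
  have "\<nu> = \<rho>"
  proof (rule cdf_unique'[OF fin1 fin2], rule ext)
    fix x
    have "prob {\<omega>\<in>E. X \<omega> \<le> x} = p * max 0 (min x 1) ^ j"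
    proof -
      consider "x < 0" | "0 \<le> x" "x \<le> 1" | "1 < x" by linarith
      then show ?thesis
      proof cases
        case 1
        then have "{\<omega>\<in>E. X \<omega> \<le> x} = {}" using X Esub by force
        then show ?thesis using 1 \<open>0 < j\<close> by (simp only: measure_empty) simp
      next
        case 2
        then show ?thesis using law by simp
      next
        case 3
        then have "{\<omega>\<in>E. X \<omega> \<le> x} = {\<omega>\<in>E. X \<omega> \<le> 1}" using X Esub by force
        then show ?thesis using 3 law[of 1] by simp
      qed
    qed
    then show "cdf \<nu> x = cdf \<rho> x"
      using p by (simp add: cdf_def \<nu> measure_def[of \<rho>] \<rho>)
  qed
  have "expectation (\<lambda>\<omega>. indicator E \<omega> * X \<omega> ^ i) = (\<integral>\<omega>. X \<omega> ^ i \<partial>density M (\<lambda>\<omega>. ennreal (indicator E \<omega>)))"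
    by (subst integral_density) auto
  also have "\<dots> = (\<integral>s. s ^ i \<partial>\<nu>)"
    unfolding \<nu>_def by (subst integral_distr) (auto simp: ennreal_indicator)
  also have "\<dots> = (\<integral>s. g s * s ^ i \<partial>lborel)"
    unfolding \<open>\<nu> = \<rho>\<close> \<rho>_def by (subst integral_density) (auto simp: g0)
  also have "(\<lambda>s. g s * s ^ i) = (\<lambda>s. p * real j * (s ^ (j - 1 + i) * indicator {0..1} s))"
    by (auto simp: g_def power_add)
  also have "(\<integral>s. p * real j * (s ^ (j - 1 + i) * indicator {0..1} s) \<partial>lborel) = p * real j * (1 / Suc (j - 1 + i))"
    by (subst integral_mult_right_zero, subst integral_power) auto
  also have "Suc (j - 1 + i) = j + i" using \<open>0 < j\<close> by simp
  finally show ?thesis by simp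
qed

lemma (in prob_space) expectation_sums_over_count:
  fixes X :: "'a \<Rightarrow> real" and K :: "'a \<Rightarrow> nat"
  assumes [measurable]: "random_variable borel X" "random_variable (count_space UNIV) K"
    and bdd: "\<And>\<omega>. \<omega> \<in> space M \<Longrightarrow> \<bar>X \<omega>\<bar> \<le> C"
  shows "(\<lambda>j. expectation (\<lambda>\<omega>. indicator {\<omega>\<in>space M. K \<omega> = j} \<omega> * X \<omega>)) sums expectation X"
  unfolding sums_def
proof -
  have int: "integrable M (\<lambda>\<omega>. indicator {\<omega>\<in>space M. K \<omega> = j} \<omega> * X \<omega>)" for j
    by (rule integrable_const_bound[of _ "\<bar>C\<bar>"]) (auto intro!: AE_I2 simp: indicator_def dest!: bdd)
  have "(\<lambda>n. expectation (\<lambda>\<omega>. \<Sum>j<n. indicator {\<omega>\<in>space M. K \<omega> = j} \<omega> * X \<omega>)) \<longlonglongrightarrow> expectation X"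
  proof (rule integral_dominated_convergence[where w="\<lambda>_. \<bar>C\<bar>"])
    have *: "(\<Sum>j<n. indicator {\<omega>\<in>space M. K \<omega> = j} \<omega> * X \<omega>) = (if K \<omega> < n then X \<omega> else 0)" if "\<omega> \<in> space M" for \<omega> n
    proof -
      have "(\<Sum>j<n. indicator {\<omega>\<in>space M. K \<omega> = j} \<omega> * X \<omega>) = (\<Sum>j<n. if j = K \<omega> then X \<omega> else 0)"
        using that by (intro sum.cong) (auto simp: indicator_def)
      then show ?thesis by simp
    qed
    show "AE \<omega> in M. norm (\<Sum>j<n. indicator {\<omega>\<in>space M. K \<omega> = j} \<omega> * X \<omega>) \<le> \<bar>C\<bar>" for n
    proof (rule AE_I2)
      fix \<omega> assume \<omega>: "\<omega> \<in> space M"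
      show "norm (\<Sum>j<n. indicator {\<omega>\<in>space M. K \<omega> = j} \<omega> * X \<omega>) \<le> \<bar>C\<bar>"
        unfolding *[OF \<omega>] using bdd[OF \<omega>] by auto
    qed
    show "AE \<omega> in M. (\<lambda>n. \<Sum>j<n. indicator {\<omega>\<in>space M. K \<omega> = j} \<omega> * X \<omega>) \<longlonglongrightarrow> X \<omega>"
    proof (rule AE_I2)
      fix \<omega> assume \<omega>: "\<omega> \<in> space M"
      show "(\<lambda>n. \<Sum>j<n. indicator {\<omega>\<in>space M. K \<omega> = j} \<omega> * X \<omega>) \<longlonglongrightarrow> X \<omega>"
        unfolding *[OF \<omega>]
        by (rule tendsto_eventually, rule eventually_mono[OF eventually_gt_at_top[of "K \<omega>"]]) simp
    qed
  qed auto
  then show "(\<lambda>n. \<Sum>j<n. expectation (\<lambda>\<omega>. indicator {\<omega>\<in>space M. K \<omega> = j} \<omega> * X \<omega>)) \<longlonglongrightarrow> expectation X"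
    by (simp only: Bochner_Integration.integral_sum[OF int])
qed

definition poisson_weight :: "real \<Rightarrow> nat \<Rightarrow> real" where
  "poisson_weight m j = exp (- m) * m ^ j / fact j"

lemma poisson_weight_nonneg: "0 \<le> m \<Longrightarrow> 0 \<le> poisson_weight m j"
  by (simp add: poisson_weight_def)

lemma poisson_weight_sums: "poisson_weight m sums 1"
proof -
  have "(\<lambda>j. exp (- m) * (m ^ j / fact j)) sums (exp (- m) * exp m)"
    using exp_converges[of m] by (intro sums_mult) (simp add: field_simps scaleR_conv_of_real)
  then show ?thesis by (simp add: poisson_weight_def[abs_def] exp_minus)
qed

lemma poisson_weight_Suc: "real (Suc j) * poisson_weight m (Suc j) = m * poisson_weight m j"
  unfolding poisson_weight_def fact_Suc by (simp del: of_nat_Suc)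

text \<open>
  Dividing Poisson weights by rising factorials amounts to shifting them. So the Poisson average of
  \<open>1 / ((j + 1) \<cdots> (j + l))\<close> is \<open>m ^ (- l)\<close> times a tail probability, which is why all moments below are
  bounded by such products.
\<close>

lemma poisson_weight_pochhammer:
  "m ^ l * poisson_weight m j = pochhammer (real j + 1) l * poisson_weight m (j + l)"
proof (induction l)
  case (Suc l)
  have "m ^ Suc l * poisson_weight m j = pochhammer (real j + 1) l * (m * poisson_weight m (j + l))"
    using Suc by simp
  also have "m * poisson_weight m (j + l) = real (j + l + 1) * poisson_weight m (j + Suc l)"
    using poisson_weight_Suc[of "j + l" m] by simp
  finally show ?case by (simp add: pochhammer_Suc algebra_simps)
qed simp

lemma poisson_weight_shift_sums:
  "(\<lambda>j. poisson_weight m (j + l)) sums (1 - (\<Sum>j<l. poisson_weight m j))"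
  using sums_split_initial_segment[OF poisson_weight_sums[of m], of l] by simp

text \<open>
  Multiplication of the weights by \<open>m\<close> shifts them up by one, with factors of at most \<open>3\<close>.
\<close>

lemma poisson_tail_small:
  assumes "0 < m"
  shows "1 - 3 / m \<le> 1 - (\<Sum>j<3. poisson_weight m j)"
proof -
  let ?q = "poisson_weight m"
  have "m * (\<Sum>j<3. ?q j) = ?q 1 + 2 * ?q 2 + 3 * ?q 3"
    using poisson_weight_Suc[of 0 m] poisson_weight_Suc[of 1 m] poisson_weight_Suc[of 2 m]
    by (simp add: eval_nat_numeral algebra_simps)
  also have "\<dots> \<le> 3 * (\<Sum>j<4. ?q j)"
    using poisson_weight_nonneg[of m] assms by (simp add: eval_nat_numeral)
  also have "(\<Sum>j<4. ?q j) \<le> 1"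
    using sum_le_suminf[of ?q "{..<4}"] poisson_weight_sums[of m] poisson_weight_nonneg[of m] assms
    by (auto simp: sums_iff)
  finally show ?thesis using assms by (simp add: field_simps)
qed

text \<open>
  The left-hand side is \<open>E ((1 + 1/j) B - 1)^2\<close> for the maximum \<open>B\<close> of \<open>j\<close> uniform variables, whose
  moments are \<open>E B^i = j / (j + i)\<close>.
\<close>

lemma conditional_second_moment:
  fixes j :: real
  assumes "0 < j"
  shows "(1 + 1 / j)\<^sup>2 * (j / (j + 2)) - 2 * (1 + 1 / j) * (j / (j + 1)) + 1 = 1 / (j * (j + 2))"
proof -
  have b: "1 + 1 / j = (j + 1) / j" using assms by (simp add: field_simps)
  have A: "(1 + 1 / j)\<^sup>2 * (j / (j + 2)) = (j + 1)\<^sup>2 / (j * (j + 2))" "(1 + 1 / j) * (j / (j + 1)) = 1"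
    unfolding b using assms by (simp_all add: power_divide power2_eq_square)
  have B: "(j + 1)\<^sup>2 / (j * (j + 2)) - 1 = 1 / (j * (j + 2))"
  proof -
    have "(j + 1)\<^sup>2 = j * (j + 2) + 1" by algebra
    then show ?thesis using assms by (simp add: add_divide_distrib)
  qed
  show ?thesis unfolding mult.assoc A B[symmetric] by simp
qed

text \<open>
  The corresponding fourth moment. The leading terms cancel and leave
  \<open>(9 j^2 - 3 j + 6) / (j^3 (j + 2) (j + 3) (j + 4))\<close>.
\<close>

lemma conditional_fourth_moment:
  fixes j :: real
  assumes "1 \<le> j"
  shows "(1 + 1 / j) ^ 4 * (j / (j + 4)) - 4 * (1 + 1 / j) ^ 3 * (j / (j + 3)) + 6 * (1 + 1 / j)\<^sup>2 * (j / (j + 2))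
      - 4 * (1 + 1 / j) * (j / (j + 1)) + 1 \<le> 24 / ((j + 1) * (j + 2) * (j + 3) * (j + 4))"
proof -
  define R where "R = (j + 2) * (j + 3) * (j + 4)"
  have R: "0 < R" using assms by (simp add: R_def)
  have b: "1 + 1 / j = (j + 1) / j" using assms by (simp add: field_simps)
  have D: "j ^ 3 * R \<noteq> 0" using assms R by simp
  have t4: "(1 + 1 / j) ^ 4 * (j / (j + 4)) = (j + 1) ^ 4 * (j + 2) * (j + 3) / (j ^ 3 * R)"
    unfolding b power_divide times_divide_times_eq
    by (rule frac_eq_eq[THEN iffD2], use assms in simp, use D in simp, unfold R_def, algebra)
  have t3: "(1 + 1 / j) ^ 3 * (j / (j + 3)) = (j + 1) ^ 3 * j * (j + 2) * (j + 4) / (j ^ 3 * R)"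
    unfolding b power_divide times_divide_times_eq
    by (rule frac_eq_eq[THEN iffD2], use assms in simp, use D in simp, unfold R_def, algebra)
  have t2: "(1 + 1 / j)\<^sup>2 * (j / (j + 2)) = (j + 1)\<^sup>2 * j\<^sup>2 * (j + 3) * (j + 4) / (j ^ 3 * R)"
    unfolding b power_divide times_divide_times_eq
    by (rule frac_eq_eq[THEN iffD2], use assms in simp, use D in simp, unfold R_def, algebra)
  have t1: "(1 + 1 / j) * (j / (j + 1)) = 1"
    unfolding b using assms by simp
  have one: "3 = 3 * (j ^ 3 * R) / (j ^ 3 * R)" using D by simp
  have "(1 + 1 / j) ^ 4 * (j / (j + 4)) - 4 * (1 + 1 / j) ^ 3 * (j / (j + 3)) + 6 * (1 + 1 / j)\<^sup>2 * (j / (j + 2))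
      - 4 * (1 + 1 / j) * (j / (j + 1)) + 1
    = (1 + 1 / j) ^ 4 * (j / (j + 4)) - 4 * ((1 + 1 / j) ^ 3 * (j / (j + 3))) + 6 * ((1 + 1 / j)\<^sup>2 * (j / (j + 2))) - 3"
    using t1 by (simp only: mult.assoc)
  also have "\<dots> = ((j + 1) ^ 4 * (j + 2) * (j + 3) - 4 * ((j + 1) ^ 3 * j * (j + 2) * (j + 4))
      + 6 * ((j + 1)\<^sup>2 * j\<^sup>2 * (j + 3) * (j + 4)) - 3 * (j ^ 3 * R)) / (j ^ 3 * R)"
    unfolding t4 t3 t2 by (subst one) (simp only: add_divide_distrib diff_divide_distrib times_divide_eq_right)
  also have "(j + 1) ^ 4 * (j + 2) * (j + 3) - 4 * ((j + 1) ^ 3 * j * (j + 2) * (j + 4))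
      + 6 * ((j + 1)\<^sup>2 * j\<^sup>2 * (j + 3) * (j + 4)) - 3 * (j ^ 3 * R) = 9 * j\<^sup>2 - 3 * j + 6"
    unfolding R_def by algebra
  also have "(9 * j\<^sup>2 - 3 * j + 6) / (j ^ 3 * R) = (9 * j\<^sup>2 - 3 * j + 6) * (j + 1) / (j ^ 3 * ((j + 1) * R))"
    by (rule frac_eq_eq[THEN iffD2], use D in simp, use assms R in simp, algebra)
  also have "\<dots> \<le> 24 * j ^ 3 / (j ^ 3 * ((j + 1) * R))"
  proof (rule divide_right_mono)
    have "(9 * j\<^sup>2 - 3 * j + 6) * (j + 1) = 9 * j ^ 3 + 6 * j\<^sup>2 + 3 * j + 6" by algebra
    moreover have "j\<^sup>2 \<le> j ^ 3" "j \<le> j ^ 3" "1 \<le> j ^ 3"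
      using assms power_increasing[of 2 3 j] power_increasing[of 1 3 j] power_increasing[of 0 3 j] by auto
    ultimately show "(9 * j\<^sup>2 - 3 * j + 6) * (j + 1) \<le> 24 * j ^ 3" by linarith
  qed (use assms R in auto)
  also have "\<dots> = 24 / ((j + 1) * R)" using assms by simp
  finally show ?thesis by (simp add: R_def mult.assoc)
qed

section \<open>The normalized height of the highest point\<close>

text \<open>
  The ratio of measures is the distribution function of the heights at the highest point, as in the
  probability integral transform. The value in the empty case makes the mean exactly \<open>1\<close>.
\<close>

definition height_ratio :: "('a \<times> real) measure \<Rightarrow> ('a \<times> real) set \<Rightarrow> ('a \<times> real) multiset \<Rightarrow> real" where
  "height_ratio \<mu> D Z = (if num_points Z D = 0 then 1 else
     (1 + 1 / real (num_points Z D)) * (measure \<mu> (below D (Y_star Z D)) / measure \<mu> D))"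

locale poisson_cell =
  fixes M :: "'w measure" and \<mu> :: "('a \<times> real) measure" and N and D and b :: real
  assumes pp: "poisson_process M \<mu> N" and snd_measurable [measurable]: "snd \<in> borel_measurable \<mu>"
    and D: "D \<in> sets \<mu>" and pos: "\<And>z. z \<in> D \<Longrightarrow> 0 \<le> snd z" and D_pos: "0 < measure \<mu> D"
    and cont: "continuous_on {0..} (\<lambda>y. measure \<mu> (below D y))"
    and F0: "measure \<mu> (below D 0) = 0"
    and b: "0 \<le> b" "\<And>z. z \<in> D \<Longrightarrow> snd z \<le> b"
begin

sublocale prob_space M by (rule poisson_processD(1)[OF pp])
sublocale \<mu>: finite_measure \<mu> by (rule poisson_processD(2)[OF pp])

abbreviation "m \<equiv> measure \<mu> D"
abbreviation "q \<equiv> poisson_weight m"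
definition "B \<omega> = measure \<mu> (below D (Y_star (N \<omega>) D)) / m"
abbreviation "K \<omega> \<equiv> num_points (N \<omega>) D"
abbreviation "U \<omega> \<equiv> height_ratio \<mu> D (N \<omega>)"
abbreviation "Ev j \<equiv> {\<omega>\<in>space M. K \<omega> = j}"

lemma height_cdf_measurable [measurable]: "(\<lambda>y. measure \<mu> (below D y)) \<in> borel_measurable borel"
proof (rule borel_measurable_mono, rule monoI)
  fix y y' :: real assume "y \<le> y'"
  then show "measure \<mu> (below D y) \<le> measure \<mu> (below D y')"
    using sets_height(1)[OF pp snd_measurable D] by (intro \<mu>.finite_measure_mono) auto
qed

lemma count_height_measurable:
  "(\<lambda>\<omega>. (K \<omega>, Y_star (N \<omega>) D)) \<in> measurable M (count_space UNIV \<Otimes>\<^sub>M borel)"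
  using cells_indep[OF pp snd_measurable, of "{()}" "\<lambda>_. D"] D pos
  by (simp add: indep_vars_def disjoint_family_on_def)

lemma K_measurable [measurable]: "K \<in> measurable M (count_space UNIV)"
  using measurable_compose[OF count_height_measurable measurable_fst] by simp

lemma B_measurable [measurable]: "random_variable borel B"
  unfolding B_def[abs_def]
  using measurable_compose[OF measurable_compose[OF count_height_measurable measurable_snd] height_cdf_measurable] by simp

lemma U_eq: "U \<omega> = (if K \<omega> = 0 then 1 else (1 + 1 / real (K \<omega>)) * B \<omega>)"
  by (simp add: height_ratio_def B_def)

lemma U_measurable [measurable]: "random_variable borel U"
  unfolding U_eq by measurable

lemma B_bounds: "0 \<le> B \<omega>" "B \<omega> \<le> 1"
proof -
  have "measure \<mu> (below D (Y_star (N \<omega>) D)) \<le> m"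
    using D by (intro \<mu>.finite_measure_mono) auto
  then show "0 \<le> B \<omega>" "B \<omega> \<le> 1" using D_pos by (auto simp: B_def)
qed

lemma U_bounds: "\<bar>U \<omega> - 1\<bar> \<le> 1"
proof (cases "K \<omega> = 0")
  case False
  then have "0 \<le> 1 / real (K \<omega>)" "1 / real (K \<omega>) \<le> 1" by auto
  then have "0 \<le> (1 + 1 / real (K \<omega>)) * B \<omega>" "(1 + 1 / real (K \<omega>)) * B \<omega> \<le> 2 * 1"
    using B_bounds[of \<omega>] by (auto intro!: mult_nonneg_nonneg mult_mono simp del: mult_1_right)
  then show ?thesis using False by (auto simp: U_eq abs_le_iff)
qed (simp add: U_eq)

lemma U_power_bound: "\<bar>(U \<omega> - 1) ^ i\<bar> \<le> 1"
  using power_le_one[OF abs_ge_zero U_bounds] by (simp add: power_abs)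

lemma U_power_integrable: "integrable M (\<lambda>\<omega>. (U \<omega> - 1) ^ i)"
  by (rule integrable_const_bound[of _ 1]) (auto simp: U_power_bound)

lemma B_power_integrable: "integrable M (\<lambda>\<omega>. indicator (Ev j) \<omega> * B \<omega> ^ i)"
  by (rule integrable_const_bound[of _ 1])
    (auto simp: indicator_def abs_mult power_abs B_bounds intro!: AE_I2 power_le_one)

lemma prob_count: "prob (Ev j) = q j"
  using poisson_processD(4)[OF pp D, of j] by (simp add: poisson_weight_def)

lemma B_power_expectation:
  assumes "0 < j"
  shows "expectation (\<lambda>\<omega>. indicator (Ev j) \<omega> * B \<omega> ^ i) = q j * (real j / (real j + real i))"
proof -
  have "expectation (\<lambda>\<omega>. indicator (Ev j) \<omega> * B \<omega> ^ i) = q j * real j / real (j + i)"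
  proof (rule expectation_power_of_power_law)
    show "prob {\<omega>\<in>Ev j. B \<omega> \<le> s} = q j * s ^ j" if "0 \<le> s" "s \<le> 1" for s
    proof -
      have "{\<omega>\<in>Ev j. B \<omega> \<le> s} = {\<omega>\<in>space M. K \<omega> = j \<and> measure \<mu> (below D (Y_star (N \<omega>) D)) / m \<le> s}"
        by (auto simp: B_def)
      then show ?thesis
        using count_quantile_law[OF pp snd_measurable D pos D_pos cont F0 b that, of j]
        by (simp add: poisson_weight_def)
    qed
  qed (use assms B_bounds poisson_weight_nonneg in auto)
  then show ?thesis by simp
qed

lemma U_power_sums: "(\<lambda>j. expectation (\<lambda>\<omega>. indicator (Ev j) \<omega> * (U \<omega> - 1) ^ i)) sums expectation (\<lambda>\<omega>. (U \<omega> - 1) ^ i)"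
  by (rule expectation_sums_over_count[of _ _ 1]) (auto simp: U_power_bound)

lemma U_power_zero: "0 < i \<Longrightarrow> expectation (\<lambda>\<omega>. indicator (Ev 0) \<omega> * (U \<omega> - 1) ^ i) = 0"
proof -
  assume "0 < i"
  then have "(\<lambda>\<omega>. indicator (Ev 0) \<omega> * (U \<omega> - 1) ^ i) = (\<lambda>\<omega>. 0)"
    by (auto simp: U_eq indicator_def power_0_left)
  then show ?thesis by simp
qed

lemma U_power_expand:
  assumes "0 < j"
  shows "indicator (Ev j) \<omega> * (U \<omega> - 1) ^ i = indicator (Ev j) \<omega> * ((1 + 1 / real j) * B \<omega> - 1) ^ i"
  using assms by (auto simp: U_eq indicator_def)

lemma U_first_on_count: "expectation (\<lambda>\<omega>. indicator (Ev j) \<omega> * (U \<omega> - 1) ^ 1) = 0"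
proof (cases "j = 0")
  case False
  define c where "c = 1 + 1 / real j"
  have "expectation (\<lambda>\<omega>. indicator (Ev j) \<omega> * (U \<omega> - 1) ^ 1)
    = expectation (\<lambda>\<omega>. c * (indicator (Ev j) \<omega> * B \<omega> ^ 1) - indicator (Ev j) \<omega> * B \<omega> ^ 0)"
    using False by (subst U_power_expand) (auto simp: c_def algebra_simps intro!: Bochner_Integration.integral_cong)
  also have "\<dots> = c * (q j * (real j / (real j + 1))) - q j"
    using False B_power_expectation[of j 1] B_power_expectation[of j 0] B_power_integrable[of j 1] B_power_integrable[of j 0]
    by simp
  also have "c * (q j * (real j / (real j + 1))) = q j"
  proof -
    have "c = (real j + 1) / real j" using False by (simp add: c_def field_simps)
    then show ?thesis using False by simp
  qed
  finally show ?thesis by simp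
qed (use U_power_zero[of 1] in simp)

lemma U_second_on_count:
  assumes "0 < j"
  shows "expectation (\<lambda>\<omega>. indicator (Ev j) \<omega> * (U \<omega> - 1) ^ 2) = q j * (1 / (real j * (real j + 2)))"
proof -
  define c where "c = 1 + 1 / real j"
  have "expectation (\<lambda>\<omega>. indicator (Ev j) \<omega> * (U \<omega> - 1) ^ 2)
    = expectation (\<lambda>\<omega>. c\<^sup>2 * (indicator (Ev j) \<omega> * B \<omega> ^ 2) - 2 * c * (indicator (Ev j) \<omega> * B \<omega> ^ 1) + indicator (Ev j) \<omega> * B \<omega> ^ 0)"
  proof (rule Bochner_Integration.integral_cong[OF refl])
    fix \<omega> show "indicator (Ev j) \<omega> * (U \<omega> - 1) ^ 2
      = c\<^sup>2 * (indicator (Ev j) \<omega> * B \<omega> ^ 2) - 2 * c * (indicator (Ev j) \<omega> * B \<omega> ^ 1) + indicator (Ev j) \<omega> * B \<omega> ^ 0"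
      unfolding U_power_expand[OF assms] c_def[symmetric] power_one_right power_0 by algebra
  qed
  also have "\<dots> = c\<^sup>2 * (q j * (real j / (real j + 2))) - 2 * c * (q j * (real j / (real j + 1))) + q j"
    using assms B_power_expectation[of j 2] B_power_expectation[of j 1] B_power_expectation[of j 0]
      B_power_integrable[of j 2] B_power_integrable[of j 1] B_power_integrable[of j 0]
    by simp
  also have "\<dots> = q j * (c\<^sup>2 * (real j / (real j + 2)) - 2 * c * (real j / (real j + 1)) + 1)" by algebra
  also have "c\<^sup>2 * (real j / (real j + 2)) - 2 * c * (real j / (real j + 1)) + 1 = 1 / (real j * (real j + 2))"
    unfolding c_def using assms by (intro conditional_second_moment) simp
  finally show ?thesis .
qed

lemma U_fourth_on_count:
  assumes "0 < j"
  shows "expectation (\<lambda>\<omega>. indicator (Ev j) \<omega> * (U \<omega> - 1) ^ 4)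
    \<le> q j * (24 / ((real j + 1) * (real j + 2) * (real j + 3) * (real j + 4)))"
proof -
  define c where "c = 1 + 1 / real j"
  have "expectation (\<lambda>\<omega>. indicator (Ev j) \<omega> * (U \<omega> - 1) ^ 4)
    = expectation (\<lambda>\<omega>. c ^ 4 * (indicator (Ev j) \<omega> * B \<omega> ^ 4) - 4 * c ^ 3 * (indicator (Ev j) \<omega> * B \<omega> ^ 3)
        + 6 * c\<^sup>2 * (indicator (Ev j) \<omega> * B \<omega> ^ 2) - 4 * c * (indicator (Ev j) \<omega> * B \<omega> ^ 1) + indicator (Ev j) \<omega> * B \<omega> ^ 0)"
  proof (rule Bochner_Integration.integral_cong[OF refl])
    fix \<omega> show "indicator (Ev j) \<omega> * (U \<omega> - 1) ^ 4
      = c ^ 4 * (indicator (Ev j) \<omega> * B \<omega> ^ 4) - 4 * c ^ 3 * (indicator (Ev j) \<omega> * B \<omega> ^ 3)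
        + 6 * c\<^sup>2 * (indicator (Ev j) \<omega> * B \<omega> ^ 2) - 4 * c * (indicator (Ev j) \<omega> * B \<omega> ^ 1) + indicator (Ev j) \<omega> * B \<omega> ^ 0"
      unfolding U_power_expand[OF assms] c_def[symmetric] power_one_right power_0 by algebra
  qed
  also have "\<dots> = c ^ 4 * (q j * (real j / (real j + 4))) - 4 * c ^ 3 * (q j * (real j / (real j + 3)))
      + 6 * c\<^sup>2 * (q j * (real j / (real j + 2))) - 4 * c * (q j * (real j / (real j + 1))) + q j"
    using assms B_power_expectation[of j 4] B_power_expectation[of j 3] B_power_expectation[of j 2]
      B_power_expectation[of j 1] B_power_expectation[of j 0]
      B_power_integrable[of j 4] B_power_integrable[of j 3] B_power_integrable[of j 2]
      B_power_integrable[of j 1] B_power_integrable[of j 0]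
    by simp
  also have "\<dots> = q j * (c ^ 4 * (real j / (real j + 4)) - 4 * c ^ 3 * (real j / (real j + 3))
      + 6 * c\<^sup>2 * (real j / (real j + 2)) - 4 * c * (real j / (real j + 1)) + 1)" by algebra
  also have "\<dots> \<le> q j * (24 / ((real j + 1) * (real j + 2) * (real j + 3) * (real j + 4)))"
    unfolding c_def using assms by (intro mult_left_mono conditional_fourth_moment poisson_weight_nonneg) auto
  finally show ?thesis .
qed

lemma weight_shift:
  "q j / ((real j + 1) * (real j + 2)) = q (j + 2) / m\<^sup>2"
  "q j / ((real j + 1) * (real j + 2) * (real j + 3)) = q (j + 3) / m ^ 3"
  "q j / ((real j + 1) * (real j + 2) * (real j + 3) * (real j + 4)) = q (j + 4) / m ^ 4"
proof -
  have p: "pochhammer (real j + 1) 2 = (real j + 1) * (real j + 2)"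
    "pochhammer (real j + 1) 3 = (real j + 1) * (real j + 2) * (real j + 3)"
    "pochhammer (real j + 1) 4 = (real j + 1) * (real j + 2) * (real j + 3) * (real j + 4)"
    by (simp_all add: eval_nat_numeral pochhammer_Suc ac_simps)
  have "pochhammer (real j + 1) l > 0" for l by (rule pochhammer_pos) simp
  then have "q j / pochhammer (real j + 1) l = q (j + l) / m ^ l" for l
    using poisson_weight_pochhammer[of m l j] D_pos
    by (subst frac_eq_eq) (auto simp: mult.commute less_imp_neq[THEN not_sym])
  note this[of 2] this[of 3] this[of 4]
  then show "q j / ((real j + 1) * (real j + 2)) = q (j + 2) / m\<^sup>2"
    "q j / ((real j + 1) * (real j + 2) * (real j + 3)) = q (j + 3) / m ^ 3"
    "q j / ((real j + 1) * (real j + 2) * (real j + 3) * (real j + 4)) = q (j + 4) / m ^ 4"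
    unfolding p by simp_all
qed

lemma U_mean: "expectation (\<lambda>\<omega>. U \<omega> - 1) = 0"
  using U_power_sums[of 1] unfolding U_first_on_count by (simp add: sums_iff)

text \<open>
  The conditional variance \<open>1/(j (j + 2))\<close> lies between \<open>1/((j + 1) (j + 2))\<close> and the same quantity plus
  \<open>4/((j + 1) (j + 2) (j + 3))\<close>, whose Poisson averages are given by shifted weights.
\<close>

lemma U_second_moment: "\<bar>m\<^sup>2 * expectation (\<lambda>\<omega>. (U \<omega> - 1)\<^sup>2) - 1\<bar> \<le> 4 / m"
proof -
  let ?e = "\<lambda>j. expectation (\<lambda>\<omega>. indicator (Ev j) \<omega> * (U \<omega> - 1)\<^sup>2)"
  let ?V = "expectation (\<lambda>\<omega>. (U \<omega> - 1)\<^sup>2)"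
  have q0: "0 \<le> q j" for j by (simp add: poisson_weight_nonneg)
  have sums2: "(\<lambda>j. q (j + 2) / m\<^sup>2) sums ((1 - (\<Sum>j<2. q j)) / m\<^sup>2)"
    by (intro sums_divide poisson_weight_shift_sums)
  have sums3: "(\<lambda>j. q (j + 3) / m ^ 3) sums ((1 - (\<Sum>j<3. q j)) / m ^ 3)"
    by (intro sums_divide poisson_weight_shift_sums)
  have up: "?e j \<le> q (j + 2) / m\<^sup>2 + 4 * (q (j + 3) / m ^ 3)" for j
  proof (cases "j = 0")
    case True
    have "0 \<le> q (j + 2) / m\<^sup>2 + 4 * (q (j + 3) / m ^ 3)" using q0 D_pos by (intro add_nonneg_nonneg) auto
    then show ?thesis using U_power_zero[of 2] True by (simp only:)
  next
    case False
    then have j: "1 \<le> real j" by simp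
    have "1 / (real j * (real j + 2)) = 1 / ((real j + 1) * (real j + 2)) + 1 / (real j * (real j + 1) * (real j + 2))"
    proof -
      let ?y = "real j * (real j + 1) * (real j + 2)"
      have "1 / (real j * (real j + 2)) = (real j + 1) / ?y" "1 / ((real j + 1) * (real j + 2)) = real j / ?y"
        using j by simp_all
      then show ?thesis by (simp add: add_divide_distrib)
    qed
    also have "1 / (real j * (real j + 1) * (real j + 2)) \<le> 4 / ((real j + 1) * (real j + 2) * (real j + 3))"
    proof -
      have "1 / real j \<le> 4 / (real j + 3)" using j by (simp add: field_simps)
      then have "1 / real j * (1 / ((real j + 1) * (real j + 2))) \<le> 4 / (real j + 3) * (1 / ((real j + 1) * (real j + 2)))"
        by (rule mult_right_mono) simp
      then show ?thesis by (simp add: ac_simps)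
    qed
    finally have "q j * (1 / (real j * (real j + 2)))
      \<le> q j * (1 / ((real j + 1) * (real j + 2)) + 4 / ((real j + 1) * (real j + 2) * (real j + 3)))"
      by (intro mult_left_mono q0) simp
    also have "\<dots> = q j / ((real j + 1) * (real j + 2)) + 4 * (q j / ((real j + 1) * (real j + 2) * (real j + 3)))"
      by (simp add: distrib_left)
    finally show ?thesis using False by (simp only: U_second_on_count[OF False[unfolded neq0_conv]] weight_shift)
  qed
  have "?V \<le> (1 - (\<Sum>j<2. q j)) / m\<^sup>2 + 4 * ((1 - (\<Sum>j<3. q j)) / m ^ 3)"
    by (rule sums_le[OF up U_power_sums sums_add[OF sums2 sums_mult[OF sums3]]])
  also have "\<dots> \<le> 1 / m\<^sup>2 + 4 * (1 / m ^ 3)"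
    using D_pos q0 by (intro add_mono mult_left_mono divide_right_mono) (auto intro: sum_nonneg)
  finally have "m\<^sup>2 * ?V \<le> m\<^sup>2 * (1 / m\<^sup>2 + 4 * (1 / m ^ 3))"
    by (rule mult_left_mono) simp
  also have "\<dots> = 1 + 4 / m" using D_pos by (simp add: field_simps power2_eq_square power3_eq_cube)
  finally have 1: "m\<^sup>2 * ?V \<le> 1 + 4 / m" .
  \<comment> \<open>the comparison fails only at \<open>j = 0\<close>, where the second moment vanishes\<close>
  have low: "q (j + 2) / m\<^sup>2 - (if j = 0 then q 2 / m\<^sup>2 else 0) \<le> ?e j" for j
  proof (cases "j = 0")
    case True then show ?thesis using U_power_zero[of 2] by (simp add: numeral_2_eq_2)
  next
    case False
    then have j: "1 \<le> real j" by simp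
    have "q (j + 2) / m\<^sup>2 = q j * (1 / ((real j + 1) * (real j + 2)))"
      by (simp only: weight_shift(1)[symmetric] times_divide_eq_right mult_1_right)
    also have "\<dots> \<le> q j * (1 / (real j * (real j + 2)))"
      using j by (intro mult_left_mono q0 divide_left_mono mult_right_mono) auto
    finally show ?thesis using False by (simp only: U_second_on_count[OF False[unfolded neq0_conv]]) simp
  qed
  have "(\<lambda>j. if j = 0 then q 2 / m\<^sup>2 else 0) sums (q 2 / m\<^sup>2)"
    using sums_single[of 0 "\<lambda>_. q 2 / m\<^sup>2"] by simp
  then have "(1 - (\<Sum>j<2. q j)) / m\<^sup>2 - q 2 / m\<^sup>2 \<le> ?V"
    by (intro sums_le[OF low sums_diff[OF sums2] U_power_sums])
  also have "(1 - (\<Sum>j<2. q j)) / m\<^sup>2 - q 2 / m\<^sup>2 = (1 - (\<Sum>j<3. q j)) / m\<^sup>2"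
    by (simp add: eval_nat_numeral diff_divide_distrib add_divide_distrib)
  finally have "m\<^sup>2 * ((1 - (\<Sum>j<3. q j)) / m\<^sup>2) \<le> m\<^sup>2 * ?V" by (rule mult_left_mono) simp
  then have "1 - (\<Sum>j<3. q j) \<le> m\<^sup>2 * ?V" using D_pos by simp
  then have 2: "1 - 3 / m \<le> m\<^sup>2 * ?V" using poisson_tail_small[OF D_pos] by linarith
  have "3 / m \<le> 4 / m" using D_pos by (simp add: field_simps)
  then show ?thesis using 1 2 by (simp add: abs_le_iff)
qed

lemma U_fourth_moment: "m ^ 4 * expectation (\<lambda>\<omega>. (U \<omega> - 1) ^ 4) \<le> 24"
proof -
  let ?V = "expectation (\<lambda>\<omega>. (U \<omega> - 1) ^ 4)"
  have q0: "0 \<le> q j" for j by (simp add: poisson_weight_nonneg)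
  have "expectation (\<lambda>\<omega>. indicator (Ev j) \<omega> * (U \<omega> - 1) ^ 4) \<le> 24 * (q (j + 4) / m ^ 4)" for j
  proof (cases "j = 0")
    case True
    have "0 \<le> 24 * (q (j + 4) / m ^ 4)" using q0 D_pos by simp
    then show ?thesis using U_power_zero[of 4] True by (simp only:)
  next
    case False
    have "24 * (q (j + 4) / m ^ 4) = q j * (24 / ((real j + 1) * (real j + 2) * (real j + 3) * (real j + 4)))"
      by (simp add: weight_shift(3)[symmetric])
    then show ?thesis using U_fourth_on_count[OF False[unfolded neq0_conv]] by simp
  qed
  then have "?V \<le> 24 * ((1 - (\<Sum>j<4. q j)) / m ^ 4)"
    by (rule sums_le[OF _ U_power_sums sums_mult[OF sums_divide[OF poisson_weight_shift_sums]]])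
  also have "\<dots> \<le> 24 * (1 / m ^ 4)"
    using D_pos q0 by (intro mult_left_mono divide_right_mono) (auto intro: sum_nonneg)
  finally have "m ^ 4 * ?V \<le> m ^ 4 * (24 * (1 / m ^ 4))" by (rule mult_left_mono) simp
  then show ?thesis using D_pos by simp
qed

end

section \<open>A cell below a function\<close>

context
  fixes f :: "real^'d \<Rightarrow> real"
  assumes cont_f: "continuous_on (cbox 0 1) f"
begin

abbreviation strip :: "((real^'d) \<times> real) measure" where
  "strip \<equiv> restrict_space lborel (cbox 0 1) \<Otimes>\<^sub>M restrict_space lborel {0..}"

lemma sets_intensity [simp]: "sets (intensity f a) = sets strip"
  by (simp add: intensity_def)

lemma fst_strip: "fst \<in> borel_measurable strip"
  using measurable_fst[of "restrict_space lborel (cbox 0 1)" "restrict_space lborel {0..}"]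
  by (rule measurable_compose[where g="\<lambda>x. x"]) (auto intro!: measurable_restrict_space1)

lemma snd_strip: "snd \<in> borel_measurable strip"
  using measurable_snd[of "restrict_space lborel (cbox 0 1)" "restrict_space lborel {0..}"]
  by (rule measurable_compose[where g="\<lambda>x. x"]) (auto intro!: measurable_restrict_space1)

lemma snd_intensity: "snd \<in> borel_measurable (intensity f a)"
  using snd_strip by (simp cong: measurable_cong_sets)

lemma region_below_strip:
  assumes A: "A \<in> sets borel" "A \<subseteq> cbox 0 1"
  shows "region_below f A \<in> sets strip"
proof -
  have "f \<in> borel_measurable (restrict_space lborel (cbox 0 1))"
    using borel_measurable_continuous_on_restrict[OF cont_f]
    by (subst measurable_cong_sets[of _ "restrict_space borel (cbox 0 1)"]) (auto simp: sets_restrict_space)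
  then have [measurable]: "(\<lambda>z. f (fst z)) \<in> borel_measurable strip"
    by (rule measurable_compose[OF measurable_fst])
  note [measurable] = fst_strip snd_strip A(1)
  have "region_below f A = {z \<in> space strip. fst z \<in> A \<and> snd z \<le> f (fst z)}"
    using A(2) by (auto simp: region_below_def space_pair_measure)
  also have "\<dots> \<in> sets strip" by measurable
  finally show ?thesis .
qed

lemma emeasure_strip_Times:
  assumes A: "A \<in> sets borel" "A \<subseteq> cbox 0 1" and T: "T \<in> sets borel" "T \<subseteq> {0..}"
  shows "emeasure strip (A \<times> T) = emeasure lborel A * emeasure lborel T" "A \<times> T \<in> sets strip"
proof -
  interpret sigma_finite_measure "restrict_space lborel {0::real..}"
    by (rule sigma_finite_measure_restrict_space) (auto simp: sigma_finite_lborel)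
  have AA: "A \<in> sets (restrict_space lborel (cbox 0 1))" and TT: "T \<in> sets (restrict_space lborel {0..})"
    using A T by (auto simp: sets_restrict_space_iff)
  show "A \<times> T \<in> sets strip" using AA TT by simp
  show "emeasure strip (A \<times> T) = emeasure lborel A * emeasure lborel T"
    using A T by (simp add: emeasure_pair_measure_Times[OF AA TT] emeasure_restrict_space)
qed

lemma emeasure_intensity:
  assumes "X \<in> sets strip"
  shows "emeasure (intensity f a) X = ennreal a * emeasure strip (region_below f (cbox 0 1) \<inter> X)"
proof -
  have [measurable]: "region_below f (cbox 0 1) \<in> sets strip" by (rule region_below_strip) auto
  have "emeasure (intensity f a) X
    = (\<integral>\<^sup>+z. ennreal a * indicator (region_below f (cbox 0 1) \<inter> X) z \<partial>strip)"
    unfolding intensity_def using assms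
    by (subst emeasure_density) (auto intro!: nn_integral_cong simp: indicator_def)
  also have "\<dots> = ennreal a * emeasure strip (region_below f (cbox 0 1) \<inter> X)"
    using assms by (subst nn_integral_cmult_indicator) auto
  finally show ?thesis .
qed

lemma measure_intensity_Times_le:
  assumes A: "A \<in> sets borel" "A \<subseteq> cbox 0 1" and T: "T \<in> sets borel" "T \<subseteq> {0..}"
    and fin: "emeasure lborel T < \<infinity>" and a: "0 \<le> a"
    and X: "X \<in> sets strip" "X \<subseteq> A \<times> T"
  shows "measure (intensity f a) X \<le> a * measure lborel A * measure lborel T"
    and "X = A \<times> T \<Longrightarrow> X \<subseteq> region_below f (cbox 0 1) \<Longrightarrow> measure (intensity f a) X = a * measure lborel A * measure lborel T"
proof -
  have "emeasure lborel A \<le> emeasure lborel (cbox (0::real^'d) 1)" by (rule emeasure_mono) (use A in auto)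
  also have "\<dots> < \<infinity>" by (rule emeasure_bounded_finite) simp
  finally have Afin: "emeasure lborel A < \<infinity>" .
  have eq: "ennreal a * emeasure strip (A \<times> T) = ennreal (a * measure lborel A * measure lborel T)"
    using Afin fin a unfolding emeasure_strip_Times[OF A T]
    by (simp add: emeasure_eq_ennreal_measure ennreal_mult mult.assoc less_top)
  have "emeasure (intensity f a) X \<le> ennreal a * emeasure strip (A \<times> T)"
    unfolding emeasure_intensity[OF X(1)] using X emeasure_strip_Times[OF A T]
    by (intro mult_left_mono emeasure_mono) auto
  then show "measure (intensity f a) X \<le> a * measure lborel A * measure lborel T"
    unfolding eq using a by (simp add: measure_def enn2real_leI)
  show "measure (intensity f a) X = a * measure lborel A * measure lborel T"
    if "X = A \<times> T" "X \<subseteq> region_below f (cbox 0 1)"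
  proof -
    have "emeasure (intensity f a) X = ennreal (a * measure lborel A * measure lborel T)"
      unfolding emeasure_intensity[OF X(1)] eq[symmetric] using that by (simp add: Int_absorb1)
    then show ?thesis using a by (simp add: measure_def)
  qed
qed

end

text \<open>
  The part of the region below \<open>f\<close> over a base \<open>A\<close> on which \<open>f\<close> takes values between \<open>lo\<close> and \<open>hi\<close>, with
  \<open>a\<close> the intensity per unit of volume. Up to height \<open>lo\<close> it is a full cylinder, so the intensity
  below a height deviates from that of a cylinder only between \<open>lo\<close> and \<open>hi\<close>.
\<close>

locale cell_below =
  fixes f :: "real^'d \<Rightarrow> real" and a :: real and A :: "(real^'d) set" and lo hi :: real
    and M :: "'w measure" and N :: "'w \<Rightarrow> ((real^'d) \<times> real) multiset"
  assumes cont_f: "continuous_on (cbox 0 1) f"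
    and A: "A \<in> sets borel" "A \<subseteq> cbox 0 1" and A_pos: "0 < measure lborel A"
    and a: "0 < a" and lo: "0 < lo" and f_between: "\<And>t. t \<in> A \<Longrightarrow> lo \<le> f t \<and> f t \<le> hi"
    and process: "poisson_process M (intensity f a) N"
begin

abbreviation "D \<equiv> region_below f A"
abbreviation "\<mu> \<equiv> intensity f a"
abbreviation "v \<equiv> measure lborel A"
abbreviation "F y \<equiv> measure \<mu> (below D y)"

sublocale \<mu>: finite_measure \<mu> by (rule poisson_processD(2)[OF process])

lemma D_sets: "D \<in> sets \<mu>"
  using region_below_strip[OF cont_f A] by (simp add: sets_intensity[OF cont_f])

lemma below_sets: "below D y \<in> sets \<mu>"
  by (rule sets_height(1)[OF process snd_intensity[OF cont_f] D_sets])

lemma F_mono: "y \<le> y' \<Longrightarrow> F y \<le> F y'"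
  using below_sets by (intro \<mu>.finite_measure_mono) auto

lemma F_increment:
  assumes "0 \<le> y" "y \<le> y'"
  shows "F y' - F y \<le> a * v * (y' - y)"
proof -
  have "F y' - F y = measure \<mu> ((below D y') - (below D y))"
    using assms below_sets by (intro \<mu>.finite_measure_Diff[symmetric]) auto
  also have "\<dots> \<le> a * v * measure lborel {y<..y'}"
  proof (rule measure_intensity_Times_le(1)[OF cont_f A])
    show "(below D y') - (below D y) \<in> sets strip"
      using below_sets by (auto simp: sets_intensity[OF cont_f])
  qed (use assms a in \<open>auto simp: region_below_def\<close>)
  finally show ?thesis using assms by simp
qed

lemma F_linear:
  assumes "0 \<le> y" "y \<le> lo"
  shows "F y = a * v * y"
proof -
  have eq: "below D y = A \<times> {0..y}"
    using assms f_between by (force simp: region_below_def)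
  have "F y = a * v * measure lborel {0..y}"
  proof (rule measure_intensity_Times_le(2)[OF cont_f A _ _ _ _ _ _ eq])
    show "below D y \<in> sets strip"
      using below_sets by (simp add: sets_intensity[OF cont_f])
    show "below D y \<subseteq> region_below f (cbox 0 1)"
      using A(2) by (auto simp: region_below_def)
  qed (use assms a eq in auto)
  then show ?thesis using assms by simp
qed

lemma F_zero: "F 0 = 0"
  using F_linear[of 0] lo by simp

lemma lo_le_hi: "lo \<le> hi"
proof -
  have "A \<noteq> {}" using A_pos by auto
  then show ?thesis using f_between by fastforce
qed

lemma F_hi: "measure \<mu> D = F hi"
  using f_between by (intro arg_cong[where f="measure \<mu>"]) (force simp: region_below_def)

lemma mass_bounds: "a * v * lo \<le> measure \<mu> D" "measure \<mu> D \<le> a * v * hi"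
  using F_linear[of lo] F_mono[OF lo_le_hi] F_increment[of 0 hi] F_zero F_hi lo lo_le_hi by auto

text \<open>
  The quotient grows with slope \<open>1\<close> up to \<open>lo\<close> and with slope at most \<open>1\<close> afterwards. Hence the
  probability integral transform moves heights by at most \<open>hi - lo\<close>.
\<close>

lemma F_near_linear:
  assumes "0 \<le> y" "y \<le> hi"
  shows "\<bar>F y / (a * v) - y\<bar> \<le> hi - lo"
proof -
  have av: "0 < a * v" using a A_pos by simp
  have "F y / (a * v) \<le> y"
    using F_increment[OF order_refl assms(1)] F_zero av by (simp add: pos_divide_le_eq mult.commute)
  moreover have "y - (hi - lo) \<le> F y / (a * v)"
  proof (cases "y \<le> lo")
    case True
    have "F y / (a * v) = y"
      unfolding F_linear[OF assms(1) True] by (rule nonzero_mult_div_cancel_left) (use av in linarith)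
    then show ?thesis using lo_le_hi by simp
  next
    case False
    then have "a * v * lo \<le> F y" using F_mono[of lo y] F_linear[of lo] lo by simp
    then have "lo \<le> F y / (a * v)" using av by (simp add: pos_le_divide_eq mult.commute)
    then show ?thesis using assms by simp
  qed
  ultimately show ?thesis using lo_le_hi by (simp add: abs_le_iff)
qed

sublocale poisson_cell M \<mu> N D hi
proof
  show "poisson_process M \<mu> N" by (rule process)
  show "snd \<in> borel_measurable \<mu>" by (rule snd_intensity[OF cont_f])
  show "D \<in> sets \<mu>" by (rule D_sets)
  show "0 \<le> snd z" if "z \<in> D" for z using that by (auto simp: region_below_def)
  show "0 < measure \<mu> D"
    using mass_bounds(1) a A_pos lo by (intro less_le_trans[OF _ mass_bounds(1)]) simp
  show "continuous_on {0..} F"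
  proof (rule continuous_onI)
    fix y \<epsilon> :: real assume "0 < \<epsilon>" "y \<in> {0..}"
    have av: "0 < a * v" using a A_pos by simp
    show "\<exists>\<delta>>0. \<forall>y'\<in>{0..}. dist y' y < \<delta> \<longrightarrow> dist (F y') (F y) \<le> \<epsilon>"
    proof (intro exI[of _ "\<epsilon> / (a * v)"] conjI ballI impI)
      fix y' :: real assume y': "y' \<in> {0..}" "dist y' y < \<epsilon> / (a * v)"
      have "dist (F y') (F y) \<le> a * v * dist y' y"
        using F_increment[of y y'] F_increment[of y' y] F_mono[of y y'] F_mono[of y' y] y' \<open>y \<in> {0..}\<close>
        by (cases "y \<le> y'") (auto simp: dist_real_def)
      also have "\<dots> \<le> \<epsilon>" using y'(2) av by (simp add: pos_less_divide_eq mult.commute)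
      finally show "dist (F y') (F y) \<le> \<epsilon>" .
    qed (use av \<open>0 < \<epsilon>\<close> in simp)
  qed
  show "F 0 = 0" by (rule F_zero)
  show "0 \<le> hi" using lo lo_le_hi by simp
  show "snd z \<le> hi" if "z \<in> D" for z using that f_between by (force simp: region_below_def)
qed

lemma is_poisson_cell: "poisson_cell M \<mu> N D hi"
  by unfold_locales

definition mean_height :: real where "mean_height = measure \<mu> D / (a * v)"

definition estimate :: "'w \<Rightarrow> real" where
  "estimate \<omega> = (1 + 1 / real (num_points (N \<omega>) D)) * Y_star (N \<omega>) D"

lemma mean_height_bounds: "lo \<le> mean_height" "mean_height \<le> hi"
  using mass_bounds a A_pos unfolding mean_height_def
  by (simp_all add: pos_le_divide_eq pos_divide_le_eq ac_simps)

text \<open>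
  If there are points, then \<open>1 + 1/N \<le> 2\<close>. In an empty cell the estimate is \<open>0\<close> but the ratio is \<open>1\<close>.
\<close>

lemma estimate_near_ratio:
  "\<bar>estimate \<omega> - mean_height * height_ratio \<mu> D (N \<omega>)\<bar> \<le> 2 * (hi - lo) + hi * indicator {\<omega>. num_points (N \<omega>) D = 0} \<omega>"
proof (cases "num_points (N \<omega>) D = 0")
  case True
  then show ?thesis
    using mean_height_bounds lo lo_le_hi by (simp add: estimate_def height_ratio_def Y_star_def)
next
  case False
  have Y: "0 \<le> Y_star (N \<omega>) D" "Y_star (N \<omega>) D \<le> hi"
    using Y_star_nonneg[OF pos] Y_star_le_bound[OF b(2) b(1)] by auto
  have "mean_height * height_ratio \<mu> D (N \<omega>) = (1 + 1 / real (num_points (N \<omega>) D)) * (F (Y_star (N \<omega>) D) / (a * v))"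
    using False D_pos by (simp add: height_ratio_def mean_height_def)
  then have "estimate \<omega> - mean_height * height_ratio \<mu> D (N \<omega>)
    = (1 + 1 / real (num_points (N \<omega>) D)) * (Y_star (N \<omega>) D - F (Y_star (N \<omega>) D) / (a * v))"
    by (simp only: estimate_def right_diff_distrib)
  then have "\<bar>estimate \<omega> - mean_height * height_ratio \<mu> D (N \<omega>)\<bar>
    = (1 + 1 / real (num_points (N \<omega>) D)) * \<bar>F (Y_star (N \<omega>) D) / (a * v) - Y_star (N \<omega>) D\<bar>"
    by (simp only: abs_mult abs_minus_commute[of "Y_star (N \<omega>) D"]) simp
  also have "\<dots> \<le> 2 * (hi - lo)"
    using False F_near_linear[OF Y] by (intro mult_mono) auto
  finally show ?thesis using False by simp
qed

lemma estimate_near_ratio_expectation: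
  "integrable M (\<lambda>\<omega>. \<bar>estimate \<omega> - mean_height * height_ratio \<mu> D (N \<omega>)\<bar>)"
  "expectation (\<lambda>\<omega>. \<bar>estimate \<omega> - mean_height * height_ratio \<mu> D (N \<omega>)\<bar>) \<le> 2 * (hi - lo) + hi * exp (- (a * v * lo))"
proof -
  let ?Z = "\<lambda>\<omega>. \<bar>estimate \<omega> - mean_height * height_ratio \<mu> D (N \<omega>)\<bar>"
  have [measurable]: "random_variable borel (\<lambda>\<omega>. Y_star (N \<omega>) D)"
    using measurable_compose[OF count_height_measurable measurable_snd] by simp
  have [measurable]: "random_variable borel estimate" unfolding estimate_def[abs_def] by measurable
  have le: "?Z \<omega> \<le> 2 * (hi - lo) + hi * indicator {\<omega>\<in>space M. num_points (N \<omega>) D = 0} \<omega>" if "\<omega> \<in> space M" for \<omega>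
    using estimate_near_ratio[of \<omega>] that by (simp add: indicator_def)
  have hi0: "0 \<le> hi" using lo lo_le_hi by simp
  show int: "integrable M ?Z"
    by (rule integrable_const_bound[of _ "2 * (hi - lo) + hi"])
      (auto intro!: AE_I2 order_trans[OF estimate_near_ratio] simp: hi0 indicator_def)
  have [simp]: "integrable M (indicat_real {\<omega>\<in>space M. num_points (N \<omega>) D = 0})"
    by (rule integrable_const_bound[of _ 1]) (auto simp: indicator_def)
  have "expectation ?Z \<le> expectation (\<lambda>\<omega>. 2 * (hi - lo) + hi * indicator {\<omega>\<in>space M. num_points (N \<omega>) D = 0} \<omega>)"
    by (rule integral_mono[OF int _ le]) (auto intro!: Bochner_Integration.integrable_add)
  also have "\<dots> = 2 * (hi - lo) + hi * prob {\<omega>\<in>space M. num_points (N \<omega>) D = 0}"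
    by (subst Bochner_Integration.integral_add) (auto simp: prob_space)
  also have "prob {\<omega>\<in>space M. num_points (N \<omega>) D = 0} = exp (- measure \<mu> D)"
    using prob_count[of 0] by (simp add: poisson_weight_def)
  also have "\<dots> \<le> exp (- (a * v * lo))" using mass_bounds(1) by simp
  finally show "expectation ?Z \<le> 2 * (hi - lo) + hi * exp (- (a * v * lo))"
    using hi0 by (simp add: mult_left_mono)
qed

end

section \<open>Cells of an equidistant partition\<close>

text \<open>
  An interval of Lebesgue measure \<open>l\<close> contains no two points at a distance greater than \<open>l\<close>, so the
  bound on the diameter follows by comparing the norm with the sum of the coordinates.
\<close>

lemma partition_cell:
  fixes I :: "nat \<Rightarrow> (real^'d) set"
  assumes part: "equidistant_partition k I" and r: "r \<in> {1..k}"
  shows "I r \<in> sets borel" "I r \<subseteq> cbox 0 1" "measure lborel (I r) = 1 / real k"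
    and "\<And>s t. s \<in> I r \<Longrightarrow> t \<in> I r \<Longrightarrow> norm (s - t) \<le> real CARD('d) * real k powr (- 1 / real CARD('d))"
proof -
  define l where "l = real k powr (- 1 / real CARD('d))"
  have k: "0 < real k" using r by simp
  have "\<exists>J :: 'd \<Rightarrow> real set. (\<forall>j. is_interval (J j) \<and> J j \<subseteq> {0..1} \<and> measure lborel (J j) = l) \<and> I r = {x. \<forall>j. x $ j \<in> J j}"
    using part r unfolding equidistant_partition_def l_def by blast
  then obtain J :: "'d \<Rightarrow> real set" where J: "\<And>j. is_interval (J j)" "\<And>j. J j \<subseteq> {0..1}" "\<And>j. measure lborel (J j) = l"
    and I: "I r = {x. \<forall>j. x $ j \<in> J j}" by blast
  have [measurable]: "J j \<in> sets borel" for j by (rule real_interval_borel_measurable[OF J(1)])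
  have Jfin: "emeasure lborel (J j) = ennreal l" for j
  proof -
    have "emeasure lborel (J j) \<le> emeasure lborel {0..1::real}" using J(2) by (intro emeasure_mono) auto
    then have "emeasure lborel (J j) \<noteq> \<top>" by (auto simp: top_unique)
    then show ?thesis using emeasure_eq_ennreal_measure[of lborel "J j"] J(3) by simp
  qed
  have I_eq: "I r = (\<Inter>j. (\<lambda>x. x $ j) -` J j \<inter> space borel)" unfolding I by auto
  show borel: "I r \<in> sets borel"
    unfolding I_eq by (intro sets.countable_INT'' measurable_sets[of _ borel borel]) (auto intro!: borel_measurable_continuous_onI continuous_intros)
  show "I r \<subseteq> cbox 0 1" unfolding I using J(2) by (force simp: mem_box_cart)
  have "emeasure lborel (I r) = (\<integral>\<^sup>+x. (\<Prod>b\<in>(Basis :: (real^'d) set). indicator (J (axis_index b)) (x \<bullet> b)) \<partial>lborel)"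
  proof -
    have "(indicator (I r) x :: ennreal) = (\<Prod>b\<in>(Basis :: (real^'d) set). indicator (J (axis_index b)) (x \<bullet> b))" for x
    proof -
      have "(x \<in> I r) = (\<forall>b\<in>(Basis :: (real^'d) set). x \<bullet> b \<in> J (axis_index b))"
        unfolding I Basis_vec_def by (auto simp: inner_axis axis_index_axis)
      then show ?thesis by (auto simp: indicator_def)
    qed
    then have "(\<lambda>x. \<Prod>b\<in>(Basis :: (real^'d) set). indicator (J (axis_index b)) (x \<bullet> b)) = (indicator (I r) :: _ \<Rightarrow> ennreal)"
      by (auto simp: fun_eq_iff)
    then show ?thesis using borel by simp
  qed
  also have "\<dots> = (\<Prod>b\<in>(Basis :: (real^'d) set). \<integral>\<^sup>+s. indicator (J (axis_index b)) s \<partial>lborel)"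
    by (rule nn_integral_lborel_prod) auto
  also have "\<dots> = (\<Prod>b\<in>(Basis :: (real^'d) set). ennreal l)"
    by (simp add: Jfin)
  also have "\<dots> = ennreal (l ^ CARD('d))" by (simp add: ennreal_power l_def)
  finally have "measure lborel (I r) = l ^ CARD('d)" by (simp add: measure_def l_def)
  also have "\<dots> = 1 / real k"
  proof -
    have "l ^ CARD('d) = l powr real CARD('d)"
      using k by (intro powr_realpow[symmetric]) (simp add: l_def)
    also have "\<dots> = real k powr (- 1)" unfolding l_def powr_powr by simp
    also have "\<dots> = 1 / real k" using k by (simp add: powr_minus_divide)
    finally show ?thesis .
  qed
  finally show "measure lborel (I r) = 1 / real k" .
  have diam: "\<bar>s $ j - t $ j\<bar> \<le> l" if st: "s \<in> I r" "t \<in> I r" for s t j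
  proof -
    have *: "b - a \<le> l" if ab: "a \<in> J j" "b \<in> J j" "a \<le> b" for a b
    proof -
      have "{a..b} \<subseteq> J j"
        using J(1)[of j] ab(1,2) mem_is_interval_1_I[of "J j" a b] by auto
      then have "emeasure lborel {a..b} \<le> emeasure lborel (J j)" by (intro emeasure_mono) auto
      then show ?thesis using ab(3) by (simp add: Jfin l_def)
    qed
    show ?thesis using *[of "s $ j" "t $ j"] *[of "t $ j" "s $ j"] st unfolding I by (cases "s $ j \<le> t $ j") auto
  qed
  show "norm (s - t) \<le> real CARD('d) * real k powr (- 1 / real CARD('d))" if "s \<in> I r" "t \<in> I r" for s t
  proof -
    have "norm (s - t) \<le> (\<Sum>j\<in>UNIV. \<bar>(s - t) $ j\<bar>)" by (rule norm_le_l1_cart)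
    also have "\<dots> \<le> (\<Sum>j\<in>(UNIV :: 'd set). l)" using diam[OF that] by (intro sum_mono) simp
    finally show ?thesis by (simp add: l_def)
  qed
qed

text \<open>
  For the last bound, \<open>k * a r\<close> is the mean of \<open>g\<close> over the cell and therefore within \<open>w\<close> of \<open>g\<close> there. So
  the integral of \<open>g^2\<close> over the cell differs from \<open>k * (a r)^2\<close>, the integral of \<open>g * (k * a r)\<close>, by at
  most \<open>w * a r\<close>. These bounds add up to \<open>w\<close> times the integral of \<open>g\<close>.
\<close>

lemma partition_weights:
  fixes g :: "real^'d \<Rightarrow> real" and k :: nat
  assumes part: "equidistant_partition k I" and "0 < k"
    and g: "continuous_on UNIV g" "\<And>t. 0 \<le> g t" "\<And>t. g t \<le> G" "integrable lborel g"
    and supp: "\<And>t. t \<notin> cbox 0 1 \<Longrightarrow> g t = 0"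
    and osc: "\<And>r s t. r \<in> {1..k} \<Longrightarrow> s \<in> I r \<Longrightarrow> t \<in> I r \<Longrightarrow> \<bar>g s - g t\<bar> \<le> w"
  defines "a \<equiv> \<lambda>r. set_lebesgue_integral lborel (I r) g"
  shows "(\<Sum>r=1..k. a r) = integral\<^sup>L lborel g"
    and "r \<in> {1..k} \<Longrightarrow> 0 \<le> a r" "r \<in> {1..k} \<Longrightarrow> a r \<le> G / real k"
    and "\<bar>real k * (\<Sum>r=1..k. (a r)\<^sup>2) - (\<integral>t. (g t)\<^sup>2 \<partial>lborel)\<bar> \<le> w * integral\<^sup>L lborel g"
proof -
  note cell = partition_cell[OF part]
  have [measurable]: "g \<in> borel_measurable borel" using g(1) by (rule borel_measurable_continuous_onI)
  have [measurable]: "r \<in> {1..k} \<Longrightarrow> I r \<in> sets borel" for r by (rule cell(1))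
  have split: "integral\<^sup>L lborel \<phi> = (\<Sum>r=1..k. set_lebesgue_integral lborel (I r) \<phi>)"
    if \<phi>: "integrable lborel \<phi>" and "\<And>t. t \<notin> cbox 0 1 \<Longrightarrow> \<phi> t = 0" for \<phi> :: "real^'d \<Rightarrow> real"
  proof -
    have "integral\<^sup>L lborel \<phi> = set_lebesgue_integral lborel (\<Union>r\<in>{1..k}. I r) \<phi>"
      using part that(2) unfolding equidistant_partition_def set_lebesgue_integral_def
      by (intro Bochner_Integration.integral_cong) (auto simp: indicator_def)
    also have "\<dots> = (\<Sum>r=1..k. set_lebesgue_integral lborel (I r) \<phi>)"
    proof (rule set_integral_finite_Union)
      show "disjoint_family_on I {1..k}" using part by (simp add: equidistant_partition_def)
      show "set_integrable lborel (I r) \<phi>" if "r \<in> {1..k}" for r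
        unfolding set_integrable_def using \<phi> cell(1)[OF that] by (intro integrable_mult_indicator) auto
    qed auto
    finally show ?thesis .
  qed
  show sum_a: "(\<Sum>r=1..k. a r) = integral\<^sup>L lborel g"
    unfolding a_def using split[OF g(4) supp] by simp
  have Ifin: "emeasure lborel (I r) < \<infinity>" if "r \<in> {1..k}" for r
    using cell(2)[OF that] by (intro emeasure_bounded_finite bounded_subset[OF bounded_cbox])
  have Iint: "integrable lborel (\<lambda>t. indicator (I r) t * (c::real))" if "r \<in> {1..k}" for r c
    using Ifin[OF that] cell(1)[OF that] by simp
  have gint: "integrable lborel (\<lambda>t. indicator (I r) t * g t)" if "r \<in> {1..k}" for r
    using integrable_mult_indicator[OF _ g(4), of "I r"] cell(1)[OF that] by simp
  show a0: "0 \<le> a r" if "r \<in> {1..k}" for r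
    unfolding a_def set_lebesgue_integral_def using g(2) by (intro Bochner_Integration.integral_nonneg) auto
  show "a r \<le> G / real k" if "r \<in> {1..k}" for r
  proof -
    have "a r \<le> (\<integral>t. indicator (I r) t * G \<partial>lborel)"
      unfolding a_def set_lebesgue_integral_def real_scaleR_def
      using gint[OF that] Iint[OF that] g(3) by (intro integral_mono) (auto simp: indicator_def)
    also have "\<dots> = G / real k" using cell(1,3)[OF that] by simp
    finally show ?thesis .
  qed
  have g2: "integrable lborel (\<lambda>t. (g t)\<^sup>2)"
  proof (rule Bochner_Integration.integrable_bound[of lborel "\<lambda>t. G * g t"])
    show "AE t in lborel. norm ((g t)\<^sup>2) \<le> norm (G * g t)"
      using g(2,3) by (intro AE_I2) (auto simp: power2_eq_square intro!: mult_right_mono order_trans[OF _ abs_ge_self])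
  qed (use g(4) in auto)
  have near: "\<bar>g t - real k * a r\<bar> \<le> w" if r: "r \<in> {1..k}" and t: "t \<in> I r" for r t
  proof -
    have "g t - real k * a r = real k * (\<integral>s. indicator (I r) s * (g t - g s) \<partial>lborel)"
    proof -
      have "(\<integral>s. indicator (I r) s * (g t - g s) \<partial>lborel) = (\<integral>s. indicator (I r) s * g t - indicator (I r) s * g s \<partial>lborel)"
        by (simp add: right_diff_distrib)
      also have "\<dots> = g t / real k - a r"
        using Iint[OF r] gint[OF r] cell(1,3)[OF r] by (simp add: a_def set_lebesgue_integral_def)
      finally show ?thesis using \<open>0 < k\<close> by (simp add: right_diff_distrib)
    qed
    also have "\<bar>\<dots>\<bar> = real k * \<bar>\<integral>s. indicator (I r) s * (g t - g s) \<partial>lborel\<bar>" by (simp add: abs_mult)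
    also have "\<bar>\<integral>s. indicator (I r) s * (g t - g s) \<partial>lborel\<bar> \<le> (\<integral>s. \<bar>indicator (I r) s * (g t - g s)\<bar> \<partial>lborel)"
      by (rule integral_abs_bound)
    also have "\<dots> \<le> (\<integral>s. indicator (I r) s * w \<partial>lborel)"
    proof (rule integral_mono)
      show "integrable lborel (\<lambda>s. \<bar>indicator (I r) s * (g t - g s)\<bar>)"
        using Iint[OF r] gint[OF r] by (auto simp: right_diff_distrib)
      show "\<bar>indicator (I r) s * (g t - g s)\<bar> \<le> indicator (I r) s * w" for s
        using osc[OF r t] by (auto simp: indicator_def)
    qed (rule Iint[OF r])
    also have "\<dots> = w / real k" using cell(1,3)[OF r] by simp
    finally show ?thesis using \<open>0 < k\<close> by (simp add: mult_left_mono)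
  qed
  have "\<bar>real k * (\<Sum>r=1..k. (a r)\<^sup>2) - (\<integral>t. (g t)\<^sup>2 \<partial>lborel)\<bar>
    = \<bar>\<Sum>r=1..k. real k * (a r)\<^sup>2 - (\<integral>t. indicator (I r) t * (g t)\<^sup>2 \<partial>lborel)\<bar>"
    using split[OF g2] supp by (simp add: sum_distrib_left sum_subtractf set_lebesgue_integral_def)
  also have "\<dots> \<le> (\<Sum>r=1..k. \<bar>real k * (a r)\<^sup>2 - (\<integral>t. indicator (I r) t * (g t)\<^sup>2 \<partial>lborel)\<bar>)"
    by (rule sum_abs)
  also have "\<dots> \<le> (\<Sum>r=1..k. w * a r)"
  proof (rule sum_mono)
    fix r assume r: "r \<in> {1..k}"
    have g2r: "integrable lborel (\<lambda>t. indicator (I r) t * (g t)\<^sup>2)"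
      using integrable_mult_indicator[OF _ g2, of "I r"] cell(1)[OF r] by simp
    have i: "integrable lborel (\<lambda>t. (indicator (I r) t * g t) * (real k * a r - g t))"
    proof -
      have "(\<lambda>t. (indicator (I r) t * g t) * (real k * a r - g t)) = (\<lambda>t. (real k * a r) * (indicator (I r) t * g t) - indicator (I r) t * (g t)\<^sup>2)"
        by (auto simp: power2_eq_square algebra_simps)
      then show ?thesis using gint[OF r] g2r by simp
    qed
    have "real k * (a r)\<^sup>2 - (\<integral>t. indicator (I r) t * (g t)\<^sup>2 \<partial>lborel)
      = (\<integral>t. (real k * a r) * (indicator (I r) t * g t) - indicator (I r) t * (g t)\<^sup>2 \<partial>lborel)"
      using gint[OF r] g2r by (simp add: a_def set_lebesgue_integral_def power2_eq_square)
    also have "\<dots> = (\<integral>t. (indicator (I r) t * g t) * (real k * a r - g t) \<partial>lborel)"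
      by (rule Bochner_Integration.integral_cong) (auto simp: power2_eq_square algebra_simps)
    also have "\<bar>\<dots>\<bar> \<le> (\<integral>t. \<bar>(indicator (I r) t * g t) * (real k * a r - g t)\<bar> \<partial>lborel)"
      by (rule integral_abs_bound)
    also have "\<dots> \<le> (\<integral>t. w * (indicator (I r) t * g t) \<partial>lborel)"
    proof (rule integral_mono)
      show "\<bar>(indicator (I r) t * g t) * (real k * a r - g t)\<bar> \<le> w * (indicator (I r) t * g t)" for t
        using near[OF r, of t] g(2)[of t] mult_left_mono[of "\<bar>real k * a r - g t\<bar>" w "g t"]
        by (auto simp: indicator_def abs_mult abs_minus_commute mult.commute)
    qed (use i gint[OF r] in auto)
    also have "\<dots> = w * a r" by (simp add: a_def set_lebesgue_integral_def)
    finally show "\<bar>real k * (a r)\<^sup>2 - (\<integral>t. indicator (I r) t * (g t)\<^sup>2 \<partial>lborel)\<bar> \<le> w * a r" .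
  qed
  also have "\<dots> = w * integral\<^sup>L lborel g" using sum_a by (simp add: sum_distrib_left[symmetric])
  finally show "\<bar>real k * (\<Sum>r=1..k. (a r)\<^sup>2) - (\<integral>t. (g t)\<^sup>2 \<partial>lborel)\<bar> \<le> w * integral\<^sup>L lborel g" .
qed

lemma integral_scaled_reflected:
  fixes \<phi> :: "real^'d \<Rightarrow> real"
  assumes [measurable]: "\<phi> \<in> borel_measurable borel" and h: "0 < h"
  shows "(\<integral>t. \<phi> ((1 / h) *\<^sub>R (x - t)) \<partial>lborel) = h ^ CARD('d) * integral\<^sup>L lborel \<phi>"
    and "integrable lborel \<phi> \<Longrightarrow> integrable lborel (\<lambda>t. \<phi> ((1 / h) *\<^sub>R (x - t)))"
proof -
  have l: "(lborel :: (real^'d) measure) = density (distr lborel borel (\<lambda>u. x + (- h) *\<^sub>R u)) (\<lambda>_. \<bar>- h\<bar> ^ DIM(real^'d))"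
    using h by (intro lborel_affine) simp
  have cancel: "(1 / h) *\<^sub>R (x - (x + (- h) *\<^sub>R u)) = u" for u :: "real^'d" using h by simp
  have [measurable]: "(\<lambda>t. \<phi> ((1 / h) *\<^sub>R (x - t))) \<in> borel_measurable borel" by measurable
  let ?T = "\<lambda>u :: real^'d. x + (- h) *\<^sub>R u" and ?\<psi> = "\<lambda>t. \<phi> ((1 / h) *\<^sub>R (x - t))"
  have l': "(lborel :: (real^'d) measure) = density (distr lborel borel ?T) (\<lambda>_. ennreal (h ^ CARD('d)))"
    using l h by simp
  have "integral\<^sup>L lborel ?\<psi> = integral\<^sup>L (density (distr lborel borel ?T) (\<lambda>_. ennreal (h ^ CARD('d)))) ?\<psi>"
    using l' by (rule arg_cong)
  also have "\<dots> = (\<integral>t. h ^ CARD('d) * ?\<psi> t \<partial>distr lborel borel ?T)"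
    using h by (subst integral_density) auto
  also have "\<dots> = (\<integral>u. h ^ CARD('d) * ?\<psi> (?T u) \<partial>lborel)"
    by (rule integral_distr) auto
  also have "\<dots> = h ^ CARD('d) * integral\<^sup>L lborel \<phi>"
    unfolding cancel by simp
  finally show "integral\<^sup>L lborel ?\<psi> = h ^ CARD('d) * integral\<^sup>L lborel \<phi>" .
  assume int: "integrable lborel \<phi>"
  have "integrable (density (distr lborel borel ?T) (\<lambda>_. ennreal (h ^ CARD('d)))) ?\<psi>"
  proof (subst integrable_density)
    show "integrable (distr lborel borel ?T) (\<lambda>t. h ^ CARD('d) *\<^sub>R ?\<psi> t)"
    proof (subst integrable_distr_eq)
      show "integrable lborel (\<lambda>u. h ^ CARD('d) *\<^sub>R ?\<psi> (?T u))"
        unfolding cancel using int by simp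
    qed auto
  qed (use h in auto)
  then show "integrable lborel ?\<psi>" using l' by metis
qed

section \<open>The estimator at a fixed sample size\<close>

lemma convex_combination_near:
  fixes a \<phi> :: "'i \<Rightarrow> real"
  assumes "\<And>r. r \<in> A \<Longrightarrow> 0 \<le> a r" "(\<Sum>r\<in>A. a r) = 1"
    and near: "\<And>r. r \<in> A \<Longrightarrow> a r \<noteq> 0 \<Longrightarrow> \<bar>\<phi> r - y\<bar> \<le> \<eta>"
  shows "\<bar>(\<Sum>r\<in>A. a r * \<phi> r) - y\<bar> \<le> \<eta>"
proof -
  have "(\<Sum>r\<in>A. a r * \<phi> r) - y = (\<Sum>r\<in>A. a r * (\<phi> r - y))"
    using assms(2) by (simp add: right_diff_distrib sum_subtractf sum_distrib_right[symmetric])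
  also have "\<bar>\<dots>\<bar> \<le> (\<Sum>r\<in>A. \<bar>a r * (\<phi> r - y)\<bar>)" by (rule sum_abs)
  also have "\<dots> \<le> (\<Sum>r\<in>A. a r * \<eta>)"
  proof (rule sum_mono)
    fix r assume r: "r \<in> A"
    show "\<bar>a r * (\<phi> r - y)\<bar> \<le> a r * \<eta>"
      using assms(1)[OF r] near[OF r] by (cases "a r = 0") (auto simp: abs_mult intro!: mult_left_mono)
  qed
  also have "\<dots> = \<eta>" using assms(2) by (simp add: sum_distrib_right[symmetric])
  finally show ?thesis .
qed

text \<open>
  The setting at one sample size: \<open>a\<close> is the intensity per unit of volume, \<open>f0\<close> and \<open>f1\<close> bound \<open>f\<close>, and
  \<open>\<Delta>\<close> bounds its oscillation over a cell. The bracket \<open>lo r\<close>, \<open>hi r\<close> of \<open>f\<close> over a cell is taken around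
  the value at an arbitrary point of the cell and is kept above \<open>f0\<close>, so that the mean count of a cell
  is bounded below.
\<close>

locale estimator_row =
  fixes f :: "real^'d \<Rightarrow> real" and a :: real and k :: nat and I :: "nat \<Rightarrow> (real^'d) set"
    and M :: "'w measure" and N :: "'w \<Rightarrow> ((real^'d) \<times> real) multiset" and f0 f1 \<Delta> :: real
  assumes cont_f: "continuous_on (cbox 0 1) f" and a: "0 < a" and k: "0 < k"
    and process: "poisson_process M (intensity f a) N" and part: "equidistant_partition k I"
    and f0: "0 < f0" and f_bounds: "\<And>t. t \<in> cbox 0 1 \<Longrightarrow> f0 \<le> f t \<and> f t \<le> f1"
    and osc: "\<And>r s t. r \<in> {1..k} \<Longrightarrow> s \<in> I r \<Longrightarrow> t \<in> I r \<Longrightarrow> \<bar>f s - f t\<bar> \<le> \<Delta>"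
begin

sublocale prob_space M by (rule poisson_processD(1)[OF process])

abbreviation "\<mu> \<equiv> intensity f a"
abbreviation "D r \<equiv> region_below f (I r)"
abbreviation "mass r \<equiv> measure \<mu> (D r)"
abbreviation "U r \<omega> \<equiv> height_ratio \<mu> (D r) (N \<omega>)"
abbreviation "est r \<omega> \<equiv> (1 + 1 / real (num_points (N \<omega>) (D r))) * Y_star (N \<omega>) (D r)"

definition "base r = (SOME t. t \<in> I r)"
definition "lo r = max f0 (f (base r) - \<Delta>)"
definition "hi r = f (base r) + \<Delta>"

lemma cell_facts:
  assumes "r \<in> {1..k}"
  shows "I r \<in> sets borel" "I r \<subseteq> cbox 0 1" "measure lborel (I r) = 1 / real k" "base r \<in> I r"
proof -
  note c = partition_cell[OF part assms]
  show "I r \<in> sets borel" "I r \<subseteq> cbox 0 1" "measure lborel (I r) = 1 / real k" by (rule c)+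
  then have "I r \<noteq> {}" using k by auto
  then show "base r \<in> I r" unfolding base_def by (rule some_in_eq[THEN iffD2])
qed

lemma cell:
  assumes r: "r \<in> {1..k}"
  shows "cell_below f a (I r) (lo r) (hi r) M N"
proof
  show "lo r \<le> f t \<and> f t \<le> hi r" if "t \<in> I r" for t
    using osc[OF r that cell_facts(4)[OF r]] f_bounds[of t] cell_facts(2)[OF r] that
    by (auto simp: lo_def hi_def abs_le_iff)
  show "0 < measure lborel (I r)" using cell_facts(3)[OF r] k by simp
  show "0 < lo r" using f0 by (simp add: lo_def)
qed (use cont_f cell_facts[OF r] a process in auto)

lemma osc_nonneg: "0 \<le> \<Delta>"
  using osc[of 1 "base 1" "base 1"] cell_facts(4)[of 1] k by auto

lemma cell_spread:
  assumes r: "r \<in> {1..k}"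
  shows "hi r - lo r \<le> 2 * \<Delta>" "hi r \<le> f1 + \<Delta>" "0 \<le> hi r" "f0 \<le> lo r"
proof -
  have "f0 \<le> f (base r)" "f (base r) \<le> f1" using f_bounds[of "base r"] cell_facts(2,4)[OF r] by auto
  then show "hi r - lo r \<le> 2 * \<Delta>" "hi r \<le> f1 + \<Delta>" "0 \<le> hi r" "f0 \<le> lo r"
    using f0 osc_nonneg by (auto simp: lo_def hi_def max_def)
qed

lemma mean_height:
  assumes r: "r \<in> {1..k}"
  shows "cell_below.mean_height f a (I r) = mass r * real k / a"
proof -
  note C = cell[OF r]
  show ?thesis unfolding cell_below.mean_height_def[OF C] cell_facts(3)[OF r] by simp
qed

lemma mean_height_near:
  assumes r: "r \<in> {1..k}" and t: "t \<in> I r"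
  shows "\<bar>mass r * real k / a - f t\<bar> \<le> 2 * \<Delta>"
proof -
  note C = cell[OF r]
  have "\<bar>mass r * real k / a - f (base r)\<bar> \<le> \<Delta>"
    using cell_below.mean_height_bounds[OF C] unfolding mean_height[OF r] by (auto simp: lo_def hi_def abs_le_iff max_def split: if_splits)
  then show ?thesis using osc[OF r t cell_facts(4)[OF r]] by linarith
qed

lemma mass_lower:
  assumes r: "r \<in> {1..k}"
  shows "a * f0 / real k \<le> mass r"
proof -
  note C = cell[OF r]
  have "a * f0 / real k \<le> a * lo r / real k"
    using cell_spread(4)[OF r] a by (intro divide_right_mono mult_left_mono) auto
  also have "\<dots> \<le> mass r" using cell_below.mass_bounds(1)[OF C] unfolding cell_facts(3)[OF r] by simp
  finally show ?thesis .
qed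

lemma pairs_indep:
  "indep_vars (\<lambda>_. count_space UNIV \<Otimes>\<^sub>M borel) (\<lambda>r \<omega>. (num_points (N \<omega>) (D r), Y_star (N \<omega>) (D r))) {1..k}"
proof (rule cells_indep[OF process snd_intensity[OF cont_f]])
  show "D r \<in> sets \<mu>" if "r \<in> {1..k}" for r
  proof -
    note C = cell[OF that]
    show ?thesis by (rule cell_below.D_sets[OF C])
  qed
  show "disjoint_family_on D {1..k}"
    using part unfolding equidistant_partition_def disjoint_family_on_def region_below_def by blast
qed (auto simp: region_below_def)

lemma estimates_indep: "indep_vars (\<lambda>_. borel) est {1..k}"
proof -
  have "indep_vars (\<lambda>_. borel) (\<lambda>r \<omega>. (\<lambda>p. (1 + 1 / real (fst p)) * snd p) (num_points (N \<omega>) (D r), Y_star (N \<omega>) (D r))) {1..k}"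
    by (rule indep_vars_compose2[OF pairs_indep]) measurable
  then show ?thesis by simp
qed

lemma ratios_indep: "indep_vars (\<lambda>_. borel) (\<lambda>r \<omega>. w r * (U r \<omega> - 1)) {1..k}"
proof -
  define G where "G r p = w r * ((if fst p = 0 then 1 else
      (1 + 1 / real (fst p)) * (measure \<mu> (below (D r) (snd p)) / mass r)) - 1)" for r and p :: "nat \<times> real"
  have "G r \<in> borel_measurable (count_space UNIV \<Otimes>\<^sub>M borel)" if "r \<in> {1..k}" for r
  proof -
    note C = cell[OF that]
    have [measurable]: "(\<lambda>p :: nat \<times> real. measure \<mu> (below (D r) (snd p))) \<in> borel_measurable (count_space UNIV \<Otimes>\<^sub>M borel)"
      by (rule measurable_compose[OF measurable_snd poisson_cell.height_cdf_measurable[OF cell_below.is_poisson_cell[OF C]]])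
    show ?thesis unfolding G_def[abs_def] by measurable
  qed
  then have "indep_vars (\<lambda>_. borel) (\<lambda>r \<omega>. G r (num_points (N \<omega>) (D r), Y_star (N \<omega>) (D r))) {1..k}"
    by (rule indep_vars_compose2[OF pairs_indep])
  then show ?thesis by (simp add: G_def height_ratio_def cong: if_cong)
qed

lemma estimate_measurable: "r \<in> {1..k} \<Longrightarrow> random_variable borel (est r)"
  using estimates_indep by (auto simp: indep_vars_def)

lemma estimate_near_ratio:
  assumes r: "r \<in> {1..k}"
  shows "integrable M (\<lambda>\<omega>. \<bar>est r \<omega> - mass r * real k / a * U r \<omega>\<bar>)"
    "expectation (\<lambda>\<omega>. \<bar>est r \<omega> - mass r * real k / a * U r \<omega>\<bar>) \<le> 4 * \<Delta> + (f1 + \<Delta>) * exp (- (a * f0 / real k))"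
proof -
  note C = cell[OF r]
  note e = cell_below.estimate_near_ratio_expectation[OF C, unfolded mean_height[OF r] cell_below.estimate_def[OF C] cell_facts(3)[OF r]]
  show "integrable M (\<lambda>\<omega>. \<bar>est r \<omega> - mass r * real k / a * U r \<omega>\<bar>)" by (rule e(1))
  have "expectation (\<lambda>\<omega>. \<bar>est r \<omega> - mass r * real k / a * U r \<omega>\<bar>)
      \<le> 2 * (hi r - lo r) + hi r * exp (- (a * (1 / real k) * lo r))" by (rule e(2))
  also have "\<dots> \<le> 2 * (2 * \<Delta>) + (f1 + \<Delta>) * exp (- (a * f0 / real k))"
  proof (intro add_mono mult_mono)
    have "a * f0 / real k \<le> a * lo r / real k"
      using cell_spread(4)[OF r] a by (intro divide_right_mono mult_left_mono) auto
    then show "exp (- (a * (1 / real k) * lo r)) \<le> exp (- (a * f0 / real k))" by simp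
  qed (use cell_spread[OF r] cell_below.lo_le_hi[OF C] in auto)
  finally show "expectation (\<lambda>\<omega>. \<bar>est r \<omega> - mass r * real k / a * U r \<omega>\<bar>) \<le> 4 * \<Delta> + (f1 + \<Delta>) * exp (- (a * f0 / real k))"
    by simp
qed

text \<open>
  Per cell, \<open>4 * \<Delta>\<close> comes from the transform of the height and the exponential from an empty cell;
  the mean of \<open>f\<close> over a cell near \<open>x\<close> differs from \<open>f x\<close> by at most \<open>2 * \<Delta> + \<eta>\<close>.
\<close>

lemma weighted_sum_near_ratios:
  assumes w: "\<And>r. r \<in> {1..k} \<Longrightarrow> 0 \<le> w r" "(\<Sum>r=1..k. w r) = 1"
    and local: "\<And>r. r \<in> {1..k} \<Longrightarrow> w r \<noteq> 0 \<Longrightarrow> \<exists>t\<in>I r. \<bar>f t - y\<bar> \<le> \<eta>" and "0 \<le> C"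
  defines "Z \<equiv> \<lambda>\<omega>. C * ((\<Sum>r=1..k. w r * est r \<omega>) - y)"
    and "S \<equiv> \<lambda>\<omega>. \<Sum>r=1..k. (C * w r * (mass r * real k / a)) * (U r \<omega> - 1)"
  shows "random_variable borel Z"
    "cmod (char (distr M borel Z) t - char (distr M borel S) t)
      \<le> \<bar>t\<bar> * (C * (6 * \<Delta> + \<eta> + (f1 + \<Delta>) * exp (- (a * f0 / real k))))"
proof -
  let ?\<phi> = "\<lambda>r. mass r * real k / a"
  let ?e = "4 * \<Delta> + (f1 + \<Delta>) * exp (- (a * f0 / real k))"
  note [measurable] = estimate_measurable
  show Z: "random_variable borel Z" unfolding Z_def by measurable
  have U: "random_variable borel (U r)" if "r \<in> {1..k}" for r
  proof -
    note C = cell[OF that]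
    show ?thesis by (rule poisson_cell.U_measurable[OF cell_below.is_poisson_cell[OF C]])
  qed
  note [measurable] = U
  have S: "random_variable borel S" unfolding S_def by measurable
  have "\<bar>(\<Sum>r=1..k. w r * ?\<phi> r) - y\<bar> \<le> 2 * \<Delta> + \<eta>"
  proof (rule convex_combination_near[OF w])
    fix r assume r: "r \<in> {1..k}" "w r \<noteq> 0"
    then obtain t where "t \<in> I r" "\<bar>f t - y\<bar> \<le> \<eta>" using local by blast
    then show "\<bar>?\<phi> r - y\<bar> \<le> 2 * \<Delta> + \<eta>" using mean_height_near[OF r(1), of t] by linarith
  qed
  note bias = this
  define R where "R \<omega> = (\<Sum>r=1..k. w r * \<bar>est r \<omega> - ?\<phi> r * U r \<omega>\<bar>)" for \<omega>
  have R_int: "integrable M R"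
    unfolding R_def[abs_def] using estimate_near_ratio(1) by (intro Bochner_Integration.integrable_sum integrable_mult_right) auto
  have R_exp: "expectation R \<le> ?e"
  proof -
    have "expectation R = (\<Sum>r=1..k. w r * expectation (\<lambda>\<omega>. \<bar>est r \<omega> - ?\<phi> r * U r \<omega>\<bar>))"
      unfolding R_def[abs_def] using estimate_near_ratio(1)
      by (subst Bochner_Integration.integral_sum) (auto intro!: sum.cong)
    also have "\<dots> \<le> (\<Sum>r=1..k. w r * ?e)"
      by (intro sum_mono mult_left_mono estimate_near_ratio(2) w(1)) auto
    also have "\<dots> = ?e" using w(2) by (simp only: sum_distrib_right[symmetric] mult_1)
    finally show ?thesis .
  qed
  have diff: "\<bar>Z \<omega> - S \<omega>\<bar> \<le> C * (R \<omega> + (2 * \<Delta> + \<eta>))" for \<omega>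
  proof -
    have eq: "Z \<omega> - S \<omega> = C * ((\<Sum>r=1..k. w r * (est r \<omega> - ?\<phi> r * U r \<omega>)) + ((\<Sum>r=1..k. w r * ?\<phi> r) - y))"
    proof -
      have "S \<omega> = (\<Sum>r=1..k. C * (w r * (?\<phi> r * U r \<omega>)) - C * (w r * ?\<phi> r))"
        unfolding S_def by (simp only: right_diff_distrib mult.assoc mult_1_right)
      also have "\<dots> = C * (\<Sum>r=1..k. w r * (?\<phi> r * U r \<omega>)) - C * (\<Sum>r=1..k. w r * ?\<phi> r)"
        by (simp only: sum_subtractf sum_distrib_left)
      finally have "S \<omega> = C * (\<Sum>r=1..k. w r * (?\<phi> r * U r \<omega>)) - C * (\<Sum>r=1..k. w r * ?\<phi> r)" .
      moreover have "(\<Sum>r=1..k. w r * (est r \<omega> - ?\<phi> r * U r \<omega>)) = (\<Sum>r=1..k. w r * est r \<omega>) - (\<Sum>r=1..k. w r * (?\<phi> r * U r \<omega>))"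
        by (simp only: right_diff_distrib sum_subtractf)
      moreover have "C * (x - y) - (C * p - C * q) = C * (x - p + (q - y))" for x p q
        by algebra
      ultimately show ?thesis unfolding Z_def by (simp only:)
    qed
    have "\<bar>Z \<omega> - S \<omega>\<bar> = C * \<bar>(\<Sum>r=1..k. w r * (est r \<omega> - ?\<phi> r * U r \<omega>)) + ((\<Sum>r=1..k. w r * ?\<phi> r) - y)\<bar>"
      unfolding eq abs_mult using \<open>0 \<le> C\<close> by (simp only: abs_of_nonneg)
    also have "\<dots> \<le> C * (R \<omega> + (2 * \<Delta> + \<eta>))"
    proof (rule mult_left_mono[OF _ \<open>0 \<le> C\<close>])
      have "\<bar>\<Sum>r=1..k. w r * (est r \<omega> - ?\<phi> r * U r \<omega>)\<bar> \<le> (\<Sum>r=1..k. \<bar>w r * (est r \<omega> - ?\<phi> r * U r \<omega>)\<bar>)"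
        by (rule sum_abs)
      also have "\<dots> = R \<omega>" unfolding R_def using w(1) by (intro sum.cong) (auto simp: abs_mult)
      finally show "\<bar>(\<Sum>r=1..k. w r * (est r \<omega> - ?\<phi> r * U r \<omega>)) + ((\<Sum>r=1..k. w r * ?\<phi> r) - y)\<bar> \<le> R \<omega> + (2 * \<Delta> + \<eta>)"
        using bias by linarith
    qed
    finally show ?thesis .
  qed
  have int: "integrable M (\<lambda>\<omega>. \<bar>Z \<omega> - S \<omega>\<bar>)"
  proof (rule Bochner_Integration.integrable_bound)
    show "integrable M (\<lambda>\<omega>. C * (R \<omega> + (2 * \<Delta> + \<eta>)))" using R_int by simp
    show "AE \<omega> in M. norm \<bar>Z \<omega> - S \<omega>\<bar> \<le> norm (C * (R \<omega> + (2 * \<Delta> + \<eta>)))"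
      using diff by (intro AE_I2) (auto intro: order_trans[OF _ abs_ge_self])
    show "(\<lambda>\<omega>. \<bar>Z \<omega> - S \<omega>\<bar>) \<in> borel_measurable M"
      by (intro borel_measurable_abs borel_measurable_diff Z S)
  qed
  have "expectation (\<lambda>\<omega>. \<bar>Z \<omega> - S \<omega>\<bar>) \<le> expectation (\<lambda>\<omega>. C * (R \<omega> + (2 * \<Delta> + \<eta>)))"
    by (rule integral_mono[OF int _ diff]) (use R_int in simp)
  also have "\<dots> = C * (expectation R + (2 * \<Delta> + \<eta>))" using R_int by (simp add: prob_space)
  also have "\<dots> \<le> C * (?e + (2 * \<Delta> + \<eta>))"
    using R_exp \<open>0 \<le> C\<close> by (intro mult_left_mono) auto
  also have "?e + (2 * \<Delta> + \<eta>) = 6 * \<Delta> + \<eta> + (f1 + \<Delta>) * exp (- (a * f0 / real k))" by simp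
  finally have E: "expectation (\<lambda>\<omega>. \<bar>Z \<omega> - S \<omega>\<bar>) \<le> C * (6 * \<Delta> + \<eta> + (f1 + \<Delta>) * exp (- (a * f0 / real k)))" .
  show "cmod (char (distr M borel Z) t - char (distr M borel S) t)
      \<le> \<bar>t\<bar> * (C * (6 * \<Delta> + \<eta> + (f1 + \<Delta>) * exp (- (a * f0 / real k))))"
    by (rule order_trans[OF char_distr_diff_le[OF Z S int] mult_left_mono[OF E]]) simp
qed

text \<open>
  Multiplying \<open>U r - 1\<close> by the mean count standardizes it up to an error of order \<open>k / a\<close> in the
  variance, so that the variance \<open>s\<close> of the sum is close to the sum of the squared coefficients.
\<close>

lemma ratio_sum_char:
  assumes b: "\<And>r. r \<in> {1..k} \<Longrightarrow> \<bar>b r\<bar> \<le> \<beta>" and \<epsilon>: "0 < \<epsilon>"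
  defines "S \<equiv> \<lambda>\<omega>. \<Sum>r=1..k. (b r * mass r) * (U r \<omega> - 1)" and "B2 \<equiv> \<Sum>r=1..k. (b r)\<^sup>2"
  obtains s where "\<bar>s - B2\<bar> \<le> 4 * real k / (a * f0) * B2"
    "cmod (char (distr M borel S) t - exp (- (t\<^sup>2 * s) / 2))
      \<le> \<bar>t\<bar>^3 / 6 * (\<epsilon> * s + 24 * \<beta>\<^sup>2 * B2 / \<epsilon>) + t ^ 4 * (24 * \<beta>\<^sup>2 * B2) / 8"
proof
  let ?X = "\<lambda>r \<omega>. (b r * mass r) * (U r \<omega> - 1)"
  define s where "s = (\<Sum>r=1..k. expectation (\<lambda>\<omega>. (?X r \<omega>)\<^sup>2))"
  define L where "L = (\<Sum>r=1..k. expectation (\<lambda>\<omega>. ?X r \<omega> ^ 4))"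
  have second: "expectation (\<lambda>\<omega>. (?X r \<omega>)\<^sup>2) = (b r)\<^sup>2 * ((mass r)\<^sup>2 * expectation (\<lambda>\<omega>. (U r \<omega> - 1)\<^sup>2))" for r
    by (simp add: power_mult_distrib mult.assoc)
  have fourth: "expectation (\<lambda>\<omega>. ?X r \<omega> ^ 4) = (b r) ^ 4 * ((mass r) ^ 4 * expectation (\<lambda>\<omega>. (U r \<omega> - 1) ^ 4))" for r
    by (simp add: power_mult_distrib mult.assoc)
  have moments: "\<bar>(mass r)\<^sup>2 * expectation (\<lambda>\<omega>. (U r \<omega> - 1)\<^sup>2) - 1\<bar> \<le> 4 * real k / (a * f0)"
    "(mass r) ^ 4 * expectation (\<lambda>\<omega>. (U r \<omega> - 1) ^ 4) \<le> 24"
    "expectation (\<lambda>\<omega>. U r \<omega> - 1) = 0" "integrable M (\<lambda>\<omega>. (U r \<omega> - 1) ^ 4)" if r: "r \<in> {1..k}" for r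
  proof -
    note C = cell[OF r]
    have "4 / mass r \<le> 4 / (a * f0 / real k)"
      using mass_lower[OF r] a f0 k by (intro divide_left_mono mult_pos_pos) (auto intro: less_le_trans[OF _ mass_lower[OF r]])
    then show "\<bar>(mass r)\<^sup>2 * expectation (\<lambda>\<omega>. (U r \<omega> - 1)\<^sup>2) - 1\<bar> \<le> 4 * real k / (a * f0)"
      using poisson_cell.U_second_moment[OF cell_below.is_poisson_cell[OF C]] by simp
    show "(mass r) ^ 4 * expectation (\<lambda>\<omega>. (U r \<omega> - 1) ^ 4) \<le> 24" by (rule poisson_cell.U_fourth_moment[OF cell_below.is_poisson_cell[OF C]])
    show "expectation (\<lambda>\<omega>. U r \<omega> - 1) = 0" by (rule poisson_cell.U_mean[OF cell_below.is_poisson_cell[OF C]])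
    show "integrable M (\<lambda>\<omega>. (U r \<omega> - 1) ^ 4)" by (rule poisson_cell.U_power_integrable[OF cell_below.is_poisson_cell[OF C]])
  qed
  have eq: "s - B2 = (\<Sum>r=1..k. (b r)\<^sup>2 * ((mass r)\<^sup>2 * expectation (\<lambda>\<omega>. (U r \<omega> - 1)\<^sup>2) - 1))"
    unfolding s_def second B2_def by (simp add: right_diff_distrib sum_subtractf)
  have "\<bar>s - B2\<bar> \<le> (\<Sum>r=1..k. \<bar>(b r)\<^sup>2 * ((mass r)\<^sup>2 * expectation (\<lambda>\<omega>. (U r \<omega> - 1)\<^sup>2) - 1)\<bar>)"
    unfolding eq by (rule sum_abs)
  also have "\<dots> \<le> (\<Sum>r=1..k. (b r)\<^sup>2 * (4 * real k / (a * f0)))"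
  proof (rule sum_mono)
    fix r assume r: "r \<in> {1..k}"
    show "\<bar>(b r)\<^sup>2 * ((mass r)\<^sup>2 * expectation (\<lambda>\<omega>. (U r \<omega> - 1)\<^sup>2) - 1)\<bar> \<le> (b r)\<^sup>2 * (4 * real k / (a * f0))"
      using mult_left_mono[OF moments(1)[OF r], of "(b r)\<^sup>2"] by (simp only: abs_mult abs_power2 zero_le_power2)
  qed
  also have "\<dots> = 4 * real k / (a * f0) * B2" by (simp only: B2_def sum_distrib_right[symmetric] mult.commute)
  finally show "\<bar>s - B2\<bar> \<le> 4 * real k / (a * f0) * B2" .
  have "L \<le> (\<Sum>r=1..k. (b r) ^ 4 * 24)"
    unfolding L_def fourth by (intro sum_mono mult_left_mono moments(2)) auto
  also have "\<dots> \<le> (\<Sum>r=1..k. 24 * \<beta>\<^sup>2 * (b r)\<^sup>2)"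
  proof (rule sum_mono)
    fix r assume r: "r \<in> {1..k}"
    have "(b r)\<^sup>2 \<le> \<beta>\<^sup>2" using b[OF r] by (simp add: power2_le_iff_abs_le)
    then have "(b r)\<^sup>2 * (b r)\<^sup>2 \<le> \<beta>\<^sup>2 * (b r)\<^sup>2" by (rule mult_right_mono) simp
    then show "(b r) ^ 4 * 24 \<le> 24 * \<beta>\<^sup>2 * (b r)\<^sup>2" by (simp add: power2_eq_square power4_eq_xxxx mult.assoc)
  qed
  also have "\<dots> = 24 * \<beta>\<^sup>2 * B2" by (simp add: B2_def sum_distrib_left)
  finally have L: "L \<le> 24 * \<beta>\<^sup>2 * B2" .
  have "cmod (char (distr M borel S) t - exp (- (t\<^sup>2 * s) / 2))
      \<le> \<bar>t\<bar>^3 / 6 * (\<epsilon> * s + L / \<epsilon>) + t ^ 4 * L / 8"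
    unfolding S_def s_def L_def
  proof (rule char_sum_gaussian_approx[OF _ ratios_indep _ _ \<epsilon>])
    fix r assume r: "r \<in> {1..k}"
    show "integrable M (\<lambda>\<omega>. ?X r \<omega> ^ 4)" using moments(4)[OF r] by (simp add: power_mult_distrib)
    show "expectation (?X r) = 0" using moments(3)[OF r] by simp
  qed simp
  also have "\<dots> \<le> \<bar>t\<bar>^3 / 6 * (\<epsilon> * s + 24 * \<beta>\<^sup>2 * B2 / \<epsilon>) + t ^ 4 * (24 * \<beta>\<^sup>2 * B2) / 8"
    using L \<epsilon> by (intro add_mono mult_left_mono divide_right_mono order_refl) auto
  finally show "cmod (char (distr M borel S) t - exp (- (t\<^sup>2 * s) / 2))
      \<le> \<bar>t\<bar>^3 / 6 * (\<epsilon> * s + 24 * \<beta>\<^sup>2 * B2 / \<epsilon>) + t ^ 4 * (24 * \<beta>\<^sup>2 * B2) / 8" .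
qed

text \<open>
  Weights with disjoint supports use disjoint groups of cells.
\<close>

lemma weighted_sums_indep:
  fixes w :: "'p::finite \<Rightarrow> nat \<Rightarrow> real"
  assumes disj: "\<And>i j r. r \<in> {1..k} \<Longrightarrow> w i r \<noteq> 0 \<Longrightarrow> w j r \<noteq> 0 \<Longrightarrow> i = j"
  shows "indep_vars (\<lambda>_. borel) (\<lambda>j \<omega>. C * ((\<Sum>r=1..k. w j r * est r \<omega>) - y j)) UNIV"
proof -
  define A where "A j = {r \<in> {1..k}. w j r \<noteq> 0}" for j
  have "indep_vars (\<lambda>j. PiM (A j) (\<lambda>_. borel)) (\<lambda>j \<omega>. restrict (\<lambda>r. est r \<omega>) (A j)) UNIV"
    using disj by (intro indep_vars_restrict[OF estimates_indep]) (auto simp: A_def disjoint_family_on_def)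
  then have "indep_vars (\<lambda>_. borel) (\<lambda>j \<omega>. (\<lambda>g. C * ((\<Sum>r\<in>A j. w j r * g r) - y j)) (restrict (\<lambda>r. est r \<omega>) (A j))) UNIV"
    by (rule indep_vars_compose2) measurable
  moreover have "(\<Sum>r\<in>A j. w j r * restrict (\<lambda>r. est r \<omega>) (A j) r) = (\<Sum>r=1..k. w j r * est r \<omega>)" for j \<omega>
    by (rule sum.mono_neutral_cong_left) (auto simp: A_def)
  ultimately show ?thesis by simp
qed

end

section \<open>Gaussian limits and kernels\<close>

lemma char_normal_density:
  assumes "0 < \<sigma>"
  shows "real_distribution (density lborel (normal_density 0 \<sigma>))"
    and "char (density lborel (normal_density 0 \<sigma>)) t = complex_of_real (exp (- (t\<^sup>2 * \<sigma>\<^sup>2) / 2))"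
proof -
  interpret S: prob_space std_normal_distribution by (rule prob_space_normal_density) simp
  have "distributed std_normal_distribution lborel (\<lambda>x. x) std_normal_density"
    by (auto simp: distributed_def distr_id2)
  from S.normal_density_affine[OF this, of \<sigma> 0]
  have d: "distributed std_normal_distribution lborel (\<lambda>x. \<sigma> * x) (normal_density 0 \<sigma>)"
    using assms by simp
  then have eq: "density lborel (normal_density 0 \<sigma>) = distr std_normal_distribution borel (\<lambda>x. \<sigma> * x)"
    by (simp add: distributed_def cong: distr_cong)
  show "real_distribution (density lborel (normal_density 0 \<sigma>))"
    unfolding eq by (rule S.real_distribution_distr) simp
  have "char (density lborel (normal_density 0 \<sigma>)) t = char std_normal_distribution (t * \<sigma>)"
    unfolding eq char_def by (subst integral_distr) (auto simp: mult.assoc)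
  then show "char (density lborel (normal_density 0 \<sigma>)) t = complex_of_real (exp (- (t\<^sup>2 * \<sigma>\<^sup>2) / 2))"
    by (simp add: char_std_normal_distribution power_mult_distrib)
qed

lemma det_matrix_inv_scaled_identity:
  fixes s :: real
  assumes "0 < s"
  shows "det (s *\<^sub>R (mat 1 :: real^'p^'p)) = s ^ CARD('p)"
    and "matrix_inv (s *\<^sub>R (mat 1 :: real^'p^'p)) = (1 / s) *\<^sub>R mat 1"
proof -
  have "det (s *\<^sub>R (mat 1 :: real^'p^'p)) = (\<Prod>i\<in>(UNIV :: 'p set). s)"
    by (subst det_diagonal) (auto simp: mat_def)
  then show "det (s *\<^sub>R (mat 1 :: real^'p^'p)) = s ^ CARD('p)" by simp
  show "matrix_inv (s *\<^sub>R (mat 1 :: real^'p^'p)) = (1 / s) *\<^sub>R mat 1"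
    unfolding matrix_inv_def
  proof (rule some_equality)
    show "s *\<^sub>R (mat 1 :: real^'p^'p) ** ((1 / s) *\<^sub>R mat 1) = mat 1 \<and> (1 / s) *\<^sub>R mat 1 ** (s *\<^sub>R (mat 1 :: real^'p^'p)) = mat 1"
      using assms by (simp add: matrix_scalar_ac scalar_matrix_assoc[symmetric])
    fix A' :: "real^'p^'p" assume "s *\<^sub>R mat 1 ** A' = mat 1 \<and> A' ** (s *\<^sub>R mat 1) = mat 1"
    then have "s *\<^sub>R A' = mat 1" by (simp add: scalar_matrix_assoc[symmetric])
    then have "(1 / s) *\<^sub>R (s *\<^sub>R A') = (1 / s) *\<^sub>R mat 1" by simp
    then show "A' = (1 / s) *\<^sub>R mat 1" using assms by simp
  qed
qed

lemma multivariate_normal_scaled_identity: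
  fixes s :: real
  assumes "0 < s"
  shows "multivariate_normal 0 (s *\<^sub>R (mat 1 :: real^'p^'p))
    = distr (PiM UNIV (\<lambda>_::'p. density lborel (normal_density 0 (sqrt s)))) borel (\<lambda>y. \<chi> j. y j)"
proof -
  let ?g = "normal_density 0 (sqrt s)" and ?N = "multivariate_normal 0 (s *\<^sub>R (mat 1 :: real^'p^'p))"
  let ?coords = "\<lambda>z :: real^'p. \<lambda>j. z $ j"
  have s0: "0 < sqrt s" using assms by simp
  have dens: "exp (- ((z - 0) \<bullet> (matrix_inv (s *\<^sub>R mat 1) *v (z - 0))) / 2) / sqrt ((2 * pi) ^ CARD('p) * det (s *\<^sub>R (mat 1 :: real^'p^'p)))
      = (\<Prod>j\<in>UNIV. ?g (z $ j))" for z :: "real^'p"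
  proof -
    have "(\<Prod>j\<in>UNIV. ?g (z $ j)) = (\<Prod>j\<in>(UNIV :: 'p set). exp (- (z $ j)\<^sup>2 / (2 * s)) / sqrt (2 * pi * s))"
      using assms by (simp add: normal_density_def mult.commute)
    also have "\<dots> = exp (\<Sum>j\<in>(UNIV :: 'p set). - (z $ j)\<^sup>2 / (2 * s)) / sqrt (2 * pi * s) ^ CARD('p)"
      by (simp add: prod_dividef exp_sum)
    also have "(\<Sum>j\<in>(UNIV :: 'p set). - (z $ j)\<^sup>2 / (2 * s)) = - (z \<bullet> ((1 / s) *\<^sub>R z)) / 2"
      using assms by (simp add: inner_vec_def power2_eq_square sum_negf sum_divide_distrib sum_distrib_left ac_simps)
    also have "sqrt (2 * pi * s) ^ CARD('p) = sqrt ((2 * pi) ^ CARD('p) * s ^ CARD('p))"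
      by (simp add: real_sqrt_power[symmetric] power_mult_distrib)
    finally show ?thesis
      using det_matrix_inv_scaled_identity[OF assms, where 'p='p]
      by (simp add: scaleR_matrix_vector_assoc[symmetric])
  qed
  have [measurable]: "?coords \<in> measurable borel (PiM UNIV (\<lambda>_. borel))"
    by (intro measurable_PiM_single') (auto intro!: borel_measurable_continuous_onI continuous_intros)
  have "distr ?N (PiM UNIV (\<lambda>_. borel)) ?coords = PiM UNIV (\<lambda>_::'p. density lborel ?g)"
  proof (rule product_sigma_finite.PiM_eqI)
    interpret G: prob_space "density lborel ?g" by (rule prob_space_normal_density) (rule s0)
    show "product_sigma_finite (\<lambda>_::'p. density lborel ?g)" by standard
    show "sets (distr ?N (PiM UNIV (\<lambda>_. borel)) ?coords) = sets (PiM UNIV (\<lambda>_::'p. density lborel ?g))"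
      by (auto intro!: sets_PiM_cong)
    fix A :: "'p \<Rightarrow> real set" assume "\<And>j. j \<in> UNIV \<Longrightarrow> A j \<in> sets (density lborel ?g)"
    then have A[measurable]: "A j \<in> sets borel" for j by simp
    have "emeasure (distr ?N (PiM UNIV (\<lambda>_. borel)) ?coords) (Pi\<^sub>E UNIV A) = emeasure ?N (?coords -` Pi\<^sub>E UNIV A)"
      by (subst emeasure_distr) (auto intro!: sets_PiM_I_finite simp: multivariate_normal_def)
    also have "\<dots> = (\<integral>\<^sup>+z. (\<Prod>b\<in>(Basis :: (real^'p) set). ennreal (?g (z \<bullet> b)) * indicator (A (axis_index b)) (z \<bullet> b)) \<partial>lborel)"
    proof -
      have m: "?coords -` Pi\<^sub>E UNIV A \<in> sets lborel"
        using measurable_sets[of ?coords borel "PiM UNIV (\<lambda>_. borel)" "Pi\<^sub>E UNIV A"] by (auto intro!: sets_PiM_I_finite)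
      have "ennreal (\<Prod>j\<in>UNIV. ?g (z $ j)) * indicator (?coords -` Pi\<^sub>E UNIV A) z
        = (\<Prod>b\<in>(Basis :: (real^'p) set). ennreal (?g (z \<bullet> b)) * indicator (A (axis_index b)) (z \<bullet> b))" for z
      proof -
        have basis: "(\<Prod>b\<in>(Basis :: (real^'p) set). G b) = (\<Prod>j\<in>UNIV. G (axis j 1))" for G :: "real^'p \<Rightarrow> ennreal"
        proof -
          have *: "(Basis :: (real^'p) set) = range (\<lambda>j. axis j 1)" by (auto simp: Basis_vec_def)
          show ?thesis unfolding * by (subst prod.reindex) (auto simp: inj_on_def axis_eq_axis)
        qed
        have "(indicator (?coords -` Pi\<^sub>E UNIV A) z :: ennreal) = (\<Prod>j\<in>UNIV. indicator (A j) (z $ j))"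
          by (auto simp: indicator_def PiE_def Pi_def)
        then show ?thesis
          unfolding basis by (simp add: inner_axis axis_index_axis prod.distrib prod_ennreal)
      qed
      then show ?thesis
        unfolding multivariate_normal_def dens using m by (subst emeasure_density) auto
    qed
    also have "\<dots> = (\<Prod>b\<in>(Basis :: (real^'p) set). \<integral>\<^sup>+y. ennreal (?g y) * indicator (A (axis_index b)) y \<partial>lborel)"
      by (rule nn_integral_lborel_prod) auto
    also have "\<dots> = (\<Prod>b\<in>(Basis :: (real^'p) set). emeasure (density lborel ?g) (A (axis_index b)))"
      by (intro prod.cong refl) (subst emeasure_density, auto)
    also have "\<dots> = (\<Prod>j\<in>UNIV. emeasure (density lborel ?g) (A j))"
    proof -
      have *: "(Basis :: (real^'p) set) = range (\<lambda>j. axis j 1)" by (auto simp: Basis_vec_def)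
      show ?thesis unfolding * by (subst prod.reindex) (auto simp: inj_on_def axis_eq_axis axis_index_axis)
    qed
    finally show "emeasure (distr ?N (PiM UNIV (\<lambda>_. borel)) ?coords) (Pi\<^sub>E UNIV A) = (\<Prod>j\<in>UNIV. emeasure (density lborel ?g) (A j))" .
  qed simp
  then have "distr (PiM UNIV (\<lambda>_::'p. density lborel ?g)) borel (\<lambda>y. \<chi> j. y j)
    = distr (distr ?N (PiM UNIV (\<lambda>_. borel)) ?coords) borel (\<lambda>y. \<chi> j. y j)" by simp
  also have "\<dots> = distr ?N borel (\<lambda>z. z)"
    by (subst distr_distr) (auto simp: comp_def multivariate_normal_def)
  also have "\<dots> = ?N" by (rule distr_id2) (simp add: multivariate_normal_def)
  finally show ?thesis by simp
qed

lemma converges_in_distribution_cong: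
  fixes Z Z' :: "nat \<Rightarrow> 'w \<Rightarrow> 'e::euclidean_space"
  assumes "converges_in_distribution M Z \<mu>" "\<forall>\<^sub>F n in sequentially. Z n = Z' n"
  shows "converges_in_distribution M Z' \<mu>"
  unfolding converges_in_distribution_def
proof (intro conjI allI impI)
  show "\<forall>\<^sub>F n in sequentially. Z' n \<in> borel_measurable (M n)"
  proof -
    have "\<forall>\<^sub>F n in sequentially. Z n \<in> borel_measurable (M n)"
      using assms(1) by (simp add: converges_in_distribution_def)
    then show ?thesis using assms(2) by eventually_elim simp
  qed
  fix g :: "'e \<Rightarrow> real" assume "continuous_on UNIV g \<and> bounded (range g)"
  then have "(\<lambda>n. \<integral>\<omega>. g (Z n \<omega>) \<partial>M n) \<longlonglongrightarrow> (\<integral>z. g z \<partial>\<mu>)"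
    using assms(1) by (simp add: converges_in_distribution_def)
  then show "(\<lambda>n. \<integral>\<omega>. g (Z' n \<omega>) \<partial>M n) \<longlonglongrightarrow> (\<integral>z. g z \<partial>\<mu>)"
    by (rule Lim_transform_eventually) (use assms(2) in \<open>auto elim: eventually_mono\<close>)
qed

locale kernel_bounds =
  fixes K :: "real^'d \<Rightarrow> real" and B L R :: real
  assumes K_bounds: "\<And>u. 0 \<le> K u \<and> K u \<le> B" and K_int: "integrable lborel K" "integral\<^sup>L lborel K = 1"
    and L: "0 \<le> L" "\<And>u v. \<bar>K u - K v\<bar> \<le> L * norm (u - v)"
    and R: "0 < R" "\<And>u. R < norm u \<Longrightarrow> K u = 0"
begin

lemma K_continuous: "continuous_on A K"
proof (rule continuous_on_subset[OF lipschitz_on_continuous_on])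
  show "L-lipschitz_on UNIV K"
    using L by (intro lipschitz_onI) (auto simp: dist_real_def dist_norm)
qed simp

lemma K_measurable [measurable]: "K \<in> borel_measurable borel"
  by (rule borel_measurable_continuous_onI[OF K_continuous])

lemma K_square_integrable: "integrable lborel (\<lambda>u. (K u)\<^sup>2)"
proof (rule Bochner_Integration.integrable_bound[of lborel "\<lambda>u. B * K u"])
  show "AE u in lborel. norm ((K u)\<^sup>2) \<le> norm (B * K u)"
    using K_bounds by (intro AE_I2) (auto simp: power2_eq_square intro!: mult_right_mono order_trans[OF _ abs_ge_self])
qed (use K_int in auto)

lemma K_square_pos: "0 < (\<integral>u. (K u)\<^sup>2 \<partial>lborel)"
proof (rule ccontr)
  assume "\<not> 0 < (\<integral>u. (K u)\<^sup>2 \<partial>lborel)"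
  moreover have "0 \<le> (\<integral>u. (K u)\<^sup>2 \<partial>lborel)" by (rule Bochner_Integration.integral_nonneg) simp
  ultimately have "(\<integral>u. (K u)\<^sup>2 \<partial>lborel) = 0" by simp
  then have "AE u in lborel. (K u)\<^sup>2 = 0"
    using K_square_integrable by (subst (asm) integral_nonneg_eq_0_iff_AE) auto
  then have "AE u in lborel. K u = 0" by simp
  then have "integral\<^sup>L lborel K = 0" by (intro integral_eq_zero_AE)
  then show False using K_int by simp
qed

text \<open>
  The square integral of the scaled kernel is \<open>h ^ (- d)\<close> times that of \<open>K\<close>, and its oscillation over a
  cell is at most \<open>h ^ (- d)\<close> times \<open>L\<close> times the quotient of cell diameter and bandwidth.
\<close>

lemma scaled_kernel_weights:
  fixes k :: nat
  assumes part: "equidistant_partition k I" and k: "0 < k" and h: "0 < h"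
    and inside: "cball x (R * h) \<subseteq> cbox 0 1"
  defines "w \<equiv> \<lambda>r. set_lebesgue_integral lborel (I r) (scaled_kernel K h x)"
  shows "(\<Sum>r=1..k. w r) = 1"
    and "r \<in> {1..k} \<Longrightarrow> 0 \<le> w r" "r \<in> {1..k} \<Longrightarrow> w r \<le> B / (h ^ CARD('d) * real k)"
    and "\<bar>h ^ CARD('d) * real k * (\<Sum>r=1..k. (w r)\<^sup>2) - (\<integral>u. (K u)\<^sup>2 \<partial>lborel)\<bar>
      \<le> L * (real CARD('d) * real k powr (- 1 / real CARD('d)) / h)"
    and "w r \<noteq> 0 \<Longrightarrow> \<exists>t\<in>I r. norm (x - t) \<le> R * h"
proof -
  let ?g = "scaled_kernel K h x" and ?hd = "h ^ CARD('d)" and ?l = "real CARD('d) * real k powr (- 1 / real CARD('d))"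
  have hd: "0 < ?hd" using h by simp
  have gint: "integral\<^sup>L lborel ?g = 1" "integrable lborel ?g"
  proof -
    note i = integral_scaled_reflected[OF K_measurable h, of x]
    show "integral\<^sup>L lborel ?g = 1" unfolding scaled_kernel_def[abs_def] using i(1) K_int(2) h by simp
    show "integrable lborel ?g" unfolding scaled_kernel_def[abs_def] by (intro integrable_divide i(2) K_int(1))
  qed
  have g2: "(\<integral>t. (?g t)\<^sup>2 \<partial>lborel) = (\<integral>u. (K u)\<^sup>2 \<partial>lborel) / ?hd"
    using integral_scaled_reflected(1)[of "\<lambda>u. (K u)\<^sup>2" h x] h hd
    unfolding scaled_kernel_def by (simp add: power_divide power2_eq_square)
  have supp: "norm (x - t) \<le> R * h" if "?g t \<noteq> 0" for t
  proof -
    have "norm ((1 / h) *\<^sub>R (x - t)) \<le> R" using R(2)[of "(1 / h) *\<^sub>R (x - t)"] that by (force simp: scaled_kernel_def)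
    then show ?thesis using h by (simp add: divide_le_eq)
  qed
  have g_cont: "continuous_on UNIV ?g"
      unfolding scaled_kernel_def by (intro continuous_intros continuous_on_compose2[OF K_continuous[of UNIV]]) (use h in auto)
  have g_bounds: "0 \<le> ?g t" "?g t \<le> B / ?hd" for t
      using K_bounds hd by (auto simp: scaled_kernel_def divide_right_mono)
  have g_supp: "?g t = 0" if "t \<notin> cbox 0 1" for t
      using supp[of t] inside that by (force simp: mem_cball dist_norm)
  have g_osc: "\<bar>?g s - ?g t\<bar> \<le> L * (?l / h) / ?hd" if "r \<in> {1..k}" "s \<in> I r" "t \<in> I r" for r s t
    proof -
      have "\<bar>?g s - ?g t\<bar> = \<bar>K ((1 / h) *\<^sub>R (x - s)) - K ((1 / h) *\<^sub>R (x - t))\<bar> / ?hd"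
        using hd by (simp add: scaled_kernel_def diff_divide_distrib[symmetric] abs_divide)
      also have "\<dots> \<le> L * norm ((1 / h) *\<^sub>R (x - s) - (1 / h) *\<^sub>R (x - t)) / ?hd"
        using L(2) hd by (intro divide_right_mono) auto
      also have "(1 / h) *\<^sub>R (x - s) - (1 / h) *\<^sub>R (x - t) = (1 / h) *\<^sub>R (t - s)" by (simp add: algebra_simps)
      also have "norm \<dots> = norm (s - t) / h" using h by (simp add: norm_minus_commute)
      also have "L * (norm (s - t) / h) / ?hd \<le> L * (?l / h) / ?hd"
        using partition_cell(4)[OF part that] L(1) h hd by (intro divide_right_mono mult_left_mono) auto
      finally show ?thesis .
    qed
  have w_eq: "set_lebesgue_integral lborel (I r) ?g = w r" for r by (simp add: w_def)
  note pw = partition_weights[OF part k g_cont g_bounds gint(2) g_supp g_osc, unfolded w_eq]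
  show "(\<Sum>r=1..k. w r) = 1" using pw(1) gint by simp
  show "r \<in> {1..k} \<Longrightarrow> 0 \<le> w r" by (rule pw(2))
  show "r \<in> {1..k} \<Longrightarrow> w r \<le> B / (?hd * real k)" using pw(3)[where r=r] by simp
  have "?hd * \<bar>real k * (\<Sum>r=1..k. (w r)\<^sup>2) - (\<integral>t. (?g t)\<^sup>2 \<partial>lborel)\<bar> \<le> ?hd * ((L * (?l / h) / ?hd) * integral\<^sup>L lborel ?g)"
    using pw(4) hd by (intro mult_left_mono) auto
  also have "\<dots> = L * (?l / h)" using hd gint by simp
  also have "?hd * \<bar>real k * (\<Sum>r=1..k. (w r)\<^sup>2) - (\<integral>t. (?g t)\<^sup>2 \<partial>lborel)\<bar>
    = \<bar>?hd * (real k * (\<Sum>r=1..k. (w r)\<^sup>2) - (\<integral>t. (?g t)\<^sup>2 \<partial>lborel))\<bar>"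
    using hd by (simp add: abs_mult)
  also have "?hd * (real k * (\<Sum>r=1..k. (w r)\<^sup>2) - (\<integral>t. (?g t)\<^sup>2 \<partial>lborel)) = ?hd * real k * (\<Sum>r=1..k. (w r)\<^sup>2) - (\<integral>u. (K u)\<^sup>2 \<partial>lborel)"
    unfolding g2 using hd h by (simp add: right_diff_distrib mult.assoc)
  finally show "\<bar>?hd * real k * (\<Sum>r=1..k. (w r)\<^sup>2) - (\<integral>u. (K u)\<^sup>2 \<partial>lborel)\<bar> \<le> L * (?l / h)" .
  show "\<exists>t\<in>I r. norm (x - t) \<le> R * h" if "w r \<noteq> 0"
  proof (rule ccontr)
    assume "\<not> ?thesis"
    then have zero: "indicator (I r) t *\<^sub>R ?g t = 0" for t using supp[of t] by (auto simp: indicator_def)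
    then show False using that unfolding w_def set_lebesgue_integral_def zero by simp
  qed
qed

end

lemma kernel_bounds_exist:
  fixes K :: "real^'d \<Rightarrow> real"
  assumes "Parzen_Rosenblatt_kernel K" "compactly_supported K" "hoelder_on 1 UNIV K"
  obtains B L R where "kernel_bounds K B L R"
proof -
  obtain L where L: "\<And>u v. \<bar>K u - K v\<bar> \<le> L * norm (u - v) powr 1"
    using assms(3) by (auto simp: hoelder_on_def)
  let ?L = "\<bar>L\<bar>"
  have L': "\<bar>K u - K v\<bar> \<le> ?L * norm (u - v)" for u v
  proof -
    have "\<bar>K u - K v\<bar> \<le> L * norm (u - v)" using L[of u v] by simp
    also have "\<dots> \<le> ?L * norm (u - v)" by (intro mult_right_mono) auto
    finally show ?thesis .
  qed
  have cont: "continuous_on UNIV K"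
  proof (rule lipschitz_on_continuous_on)
    show "?L-lipschitz_on UNIV K" using L' by (intro lipschitz_onI) (auto simp: dist_real_def dist_norm)
  qed
  let ?S = "closure {u. K u \<noteq> 0}"
  have S: "compact ?S" using assms(2) by (simp add: compactly_supported_def)
  then obtain R where R: "0 < R" "\<And>u. u \<in> ?S \<Longrightarrow> norm u \<le> R"
    using compact_imp_bounded bounded_pos by metis
  have R': "K u = 0" if "R < norm u" for u
    using R(2)[of u] closure_subset[of "{u. K u \<noteq> 0}"] that by force
  have "bounded (K ` ?S)" using S cont continuous_on_subset compact_continuous_image compact_imp_bounded by blast
  then obtain B where B: "0 < B" "\<And>u. u \<in> ?S \<Longrightarrow> \<bar>K u\<bar> \<le> B" unfolding bounded_pos by auto
  have B': "K u \<le> B" for u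
    using B closure_subset[of "{u. K u \<noteq> 0}"] by (cases "K u = 0") (force simp: abs_le_iff)+
  show ?thesis
  proof (rule that, unfold_locales)
    show "0 \<le> K u \<and> K u \<le> B" for u using assms(1) B' by (auto simp: Parzen_Rosenblatt_kernel_def)
    show "integrable lborel K" "integral\<^sup>L lborel K = 1" using assms(1) by (auto simp: Parzen_Rosenblatt_kernel_def)
    show "0 \<le> ?L" "\<And>u v. \<bar>K u - K v\<bar> \<le> ?L * norm (u - v)" using L' by auto
    show "0 < R" "\<And>u. R < norm u \<Longrightarrow> K u = 0" using R(1) R' by auto
  qed
qed

section \<open>The central limit theorem\<close>

lemma hoelder_on_imp_continuous_on:
  fixes f :: "'a::real_normed_vector \<Rightarrow> real"
  assumes L: "\<And>s t. s \<in> A \<Longrightarrow> t \<in> A \<Longrightarrow> \<bar>f s - f t\<bar> \<le> L * norm (s - t) powr \<alpha>" and "0 \<le> L" "0 < \<alpha>"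
  shows "continuous_on A f"
proof (rule continuous_onI)
  fix s and \<epsilon> :: real assume s: "s \<in> A" and \<epsilon>: "0 < \<epsilon>"
  define \<delta> where "\<delta> = (\<epsilon> / (L + 1)) powr (1 / \<alpha>)"
  have \<delta>: "0 < \<delta>" "\<delta> powr \<alpha> = \<epsilon> / (L + 1)" using assms \<epsilon> by (simp_all add: \<delta>_def powr_powr)
  show "\<exists>\<delta>>0. \<forall>t\<in>A. dist t s < \<delta> \<longrightarrow> dist (f t) (f s) \<le> \<epsilon>"
  proof (intro exI[of _ \<delta>] conjI ballI impI \<delta>(1))
    fix t assume t: "t \<in> A" "dist t s < \<delta>"
    have "dist (f t) (f s) \<le> L * norm (t - s) powr \<alpha>" using L[OF t(1) s] by (simp add: dist_real_def)
    also have "\<dots> \<le> L * (\<epsilon> / (L + 1))"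
      unfolding \<delta>(2)[symmetric] using t(2) assms by (intro mult_left_mono powr_mono2) (auto simp: dist_norm)
    also have "\<dots> \<le> \<epsilon>" using assms(2) \<epsilon> by (simp add: field_simps)
    finally show "dist (f t) (f s) \<le> \<epsilon>" .
  qed
qed

lemma powr_tendsto_zero:
  fixes u :: "nat \<Rightarrow> real"
  assumes "u \<longlonglongrightarrow> 0" "\<And>n. 1 \<le> n \<Longrightarrow> 0 \<le> u n" "0 < \<alpha>"
  shows "(\<lambda>n. u n powr \<alpha>) \<longlonglongrightarrow> 0"
proof -
  have "\<forall>\<^sub>F n in sequentially. 0 \<le> u n" using assms(2) by (rule eventually_sequentiallyI)
  from tendsto_powr2[OF assms(1) tendsto_const this assms(3)] show ?thesis by simp
qed

text \<open>
  The norming times the mean error \<open>k / n\<close> of one cell is the square root of the order \<open>h ^ d * k\<close> of the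
  number of cells in a kernel window.
\<close>

lemma norming_cell_scale:
  assumes "0 < n" "0 < k" "0 < h"
  shows "norming d n k h * real k / real n = sqrt (h ^ d * real k)"
proof -
  have "h powr (real d / 2) = sqrt (h ^ d)"
    using assms by (simp add: powr_half_sqrt[symmetric] powr_realpow[symmetric] powr_powr)
  moreover have "real k powr (- 1 / 2) * real k = sqrt (real k)"
    using assms by (simp add: powr_minus_divide powr_half_sqrt real_div_sqrt)
  ultimately show ?thesis
    using assms by (simp add: norming_def real_sqrt_mult)
qed

lemma norming_hoelder_bias:
  assumes "0 < h"
  shows "norming d n k h * h powr \<alpha> = real n * real k powr (- 1 / 2) * h powr (\<alpha> + real d / 2)"
  using assms by (simp add: norming_def powr_add)

lemma cell_width_ratio:
  assumes "0 < h" "0 < k" "0 < d"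
  shows "real k powr (- 1 / real d) / h = (h ^ d * real k) powr (- 1 / real d)"
proof -
  have "(h ^ d) powr (- 1 / real d) = 1 / h"
    using assms by (simp add: powr_realpow[symmetric] powr_powr powr_minus_divide)
  then show ?thesis using assms by (simp add: powr_mult)
qed

text \<open>
  As \<open>k * ln n / n\<close> vanishes, \<open>n * b / k\<close> eventually exceeds \<open>ln n\<close>, so the exponential is at most
  \<open>1 / n\<close> and cancels the factor \<open>n\<close> of the norming.
\<close>

lemma norming_empty_cell_bias:
  assumes h: "\<And>n. 1 \<le> n \<Longrightarrow> 0 < h n" "h \<longlonglongrightarrow> 0" and k: "\<And>n. 1 \<le> n \<Longrightarrow> 0 < k n" and d: "0 < d" and "0 < b"
    and cond: "(\<lambda>n. real (k n) * ln (real n) / real n) \<longlonglongrightarrow> 0"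
  shows "(\<lambda>n. norming d n (k n) (h n) * exp (- (real n * b / real (k n)))) \<longlonglongrightarrow> 0"
proof (rule Lim_null_comparison)
  show "(\<lambda>n. h n powr (real d / 2)) \<longlonglongrightarrow> 0"
    using h d by (intro powr_tendsto_zero) (auto simp: less_imp_le)
  have "\<forall>\<^sub>F n in sequentially. real (k n) * ln (real n) / real n < b"
    using cond \<open>0 < b\<close> by (rule order_tendstoD(2))
  then show "\<forall>\<^sub>F n in sequentially. norm (norming d n (k n) (h n) * exp (- (real n * b / real (k n)))) \<le> h n powr (real d / 2)"
    using eventually_ge_at_top[of 1]
  proof eventually_elim
    case (elim n)
    have n: "0 < real n" "0 < real (k n)" using elim k[of n] by auto
    have "ln (real n) \<le> real n * b / real (k n)"
      using elim(1) n by (simp add: field_simps)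
    then have "exp (- (real n * b / real (k n))) \<le> exp (- ln (real n))" by simp
    also have "\<dots> = 1 / real n" using n by (simp add: exp_minus inverse_eq_divide)
    finally have "norming d n (k n) (h n) * exp (- (real n * b / real (k n))) \<le> norming d n (k n) (h n) * (1 / real n)"
      by (intro mult_left_mono) (auto simp: norming_def)
    also have "\<dots> = h n powr (real d / 2) * real (k n) powr (- 1 / 2)" using n by (simp add: norming_def)
    also have "\<dots> \<le> h n powr (real d / 2) * 1"
    proof (rule mult_left_mono)
      have "1 \<le> real (k n) powr (1 / 2)" using k[of n] elim by (intro ge_one_powr_ge_zero) auto
      then show "real (k n) powr (- 1 / 2) \<le> 1" by (simp add: powr_minus inverse_le_1_iff)
    qed simp
    finally show ?case by (simp add: norming_def)
  qed
qed

text \<open>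
  Let \<open>q = h ^ d * k\<close>, let \<open>V\<close> be the norming and let \<open>l\<close> be the bound for the cell diameter. As \<open>q\<close>
  tends to infinity, \<open>l / h\<close> vanishes, so \<open>V * h powr \<alpha>\<close> dominates all errors that stem from the variation
  of \<open>f\<close>, over a cell (\<open>\<Delta>\<close>) as well as over a kernel window (\<open>\<eta>\<close>). With \<open>\<epsilon> = 1 / sqrt q\<close> both terms of the
  third-order remainder in Lyapunov's bound are of order \<open>1 / sqrt q\<close>.
\<close>

theorem estimator_asymptotically_normal:
  fixes f K :: "real^'d \<Rightarrow> real" and x :: "'p::finite \<Rightarrow> real^'d" and M :: "nat \<Rightarrow> 'w measure"
  assumes alpha: "0 < \<alpha>"
    and f_nonneg: "\<forall>t\<in>cbox 0 1. 0 \<le> f t"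
    and f_hoelder: "hoelder_on \<alpha> (cbox 0 1) f"
    and f_inf: "0 < (INF t\<in>cbox 0 1. f t)"
    and c_pos: "0 < c"
    and poisson: "\<forall>n\<ge>1. poisson_process (M n) (intensity f (real n * c)) (N n)"
    and k_pos: "\<forall>n\<ge>1. 0 < k n"
    and partition: "\<forall>n\<ge>1. equidistant_partition (k n) (I n)"
    and kernel: "Parzen_Rosenblatt_kernel K" "compactly_supported K" "hoelder_on 1 UNIV K"
    and h_pos: "\<forall>n\<ge>1. 0 < h n"
    and h_lim: "h \<longlonglongrightarrow> 0"
    and x_distinct: "inj x"
    and x_interior: "range x \<subseteq> box 0 1"
    and bw: "bandwidth_conditions CARD('d) \<alpha> k h"
  shows "converges_in_distribution M
          (\<lambda>n \<omega>. \<chi> j. norming CARD('d) n (k n) (h n) * c *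
                       (f_hat f K (h n) (k n) (I n) (N n \<omega>) (x j) - f (x j)))
          (multivariate_normal 0 ((\<integral>u. (K u)\<^sup>2 \<partial>lborel) *\<^sub>R (mat 1 :: real^'p^'p)))"
proof -
  obtain B L R where "kernel_bounds K B L R" by (rule kernel_bounds_exist[OF kernel])
  then interpret K: kernel_bounds K B L R .
  define d where "d = CARD('d)"
  have d: "0 < d" by (simp add: d_def)
  define S2 where "S2 = (\<integral>u. (K u)\<^sup>2 \<partial>lborel)"
  have S2: "0 < S2" unfolding S2_def by (rule K.K_square_pos)
  obtain Lf where Lf: "0 \<le> Lf" "\<And>s t. s \<in> cbox 0 1 \<Longrightarrow> t \<in> cbox 0 1 \<Longrightarrow> \<bar>f s - f t\<bar> \<le> Lf * norm (s - t) powr \<alpha>"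
  proof -
    obtain l where l: "\<And>s t. s \<in> cbox 0 1 \<Longrightarrow> t \<in> cbox 0 1 \<Longrightarrow> \<bar>f s - f t\<bar> \<le> l * norm (s - t) powr \<alpha>"
      using f_hoelder by (auto simp: hoelder_on_def)
    show ?thesis
    proof (rule that[of "\<bar>l\<bar>"])
      show "\<bar>f s - f t\<bar> \<le> \<bar>l\<bar> * norm (s - t) powr \<alpha>" if "s \<in> cbox 0 1" "t \<in> cbox 0 1" for s t
        using l[OF that] by (rule order_trans) (intro mult_right_mono, auto)
    qed simp
  qed
  have cont_f: "continuous_on (cbox 0 1) f"
    by (rule hoelder_on_imp_continuous_on[OF Lf(2) Lf(1) alpha])
  define f0 where "f0 = (INF t\<in>cbox 0 1. f t)"
  have f0: "0 < f0" using f_inf by (simp add: f0_def)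
  have f0_le: "f0 \<le> f t" if "t \<in> cbox 0 1" for t
    unfolding f0_def using f_nonneg that by (intro cINF_lower bdd_belowI[of _ 0]) auto
  obtain f1 where f1: "\<And>t. t \<in> cbox 0 1 \<Longrightarrow> f t \<le> f1"
  proof -
    have "bounded (f ` cbox 0 1)" by (intro compact_imp_bounded compact_continuous_image cont_f compact_cbox)
    then show ?thesis using that unfolding bounded_iff by (auto simp: abs_le_iff)
  qed
  define l where "l n = real d * real (k n) powr (- 1 / real d)" for n
  define \<Delta> where "\<Delta> n = Lf * l n powr \<alpha>" for n
  define \<eta> where "\<eta> n = Lf * (R * h n) powr \<alpha>" for n
  define V where "V n = norming d n (k n) (h n)" for n
  define q where "q n = h n ^ d * real (k n)" for n
  define w where "w n j r = set_lebesgue_integral lborel (I n r) (scaled_kernel K (h n) (x j))" for n j r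
  define E where "E n r \<omega> = (1 + 1 / real (num_points (N n \<omega>) (region_below f (I n r)))) * Y_star (N n \<omega>) (region_below f (I n r))" for n r \<omega>
  define Z where "Z n j \<omega> = V n * c * ((\<Sum>r=1..k n. w n j r * E n r \<omega>) - f (x j))" for n j \<omega>
  have kn: "0 < k n" and hn: "0 < h n" and part: "equidistant_partition (k n) (I n)" if "1 \<le> n" for n
    using that k_pos h_pos partition by auto
  have row: "estimator_row f (real n * c) (k n) (I n) (M n) (N n) f0 f1 (\<Delta> n)" if n: "1 \<le> n" for n
  proof
    show "\<bar>f s - f t\<bar> \<le> \<Delta> n" if "r \<in> {1..k n}" "s \<in> I n r" "t \<in> I n r" for r s t
    proof -
      note c = partition_cell[OF part[OF n] that(1)]
      have "\<bar>f s - f t\<bar> \<le> Lf * norm (s - t) powr \<alpha>" using c(2) that by (intro Lf(2)) auto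
      also have "\<dots> \<le> \<Delta> n"
        unfolding \<Delta>_def l_def d_def using c(4)[OF that(2,3)] alpha by (intro mult_left_mono powr_mono2 Lf(1)) auto
      finally show ?thesis .
    qed
  qed (use n c_pos cont_f kn part f0 f0_le f1 poisson in auto)

  have qpos: "0 < q n" if "1 \<le> n" for n using kn[OF that] hn[OF that] by (simp add: q_def)
  have q_lim: "filterlim q at_top sequentially"
    using bw by (simp add: bandwidth_conditions_def q_def[abs_def] d_def)
  have inv_q: "(\<lambda>n. 1 / q n) \<longlonglongrightarrow> 0"
    using tendsto_inverse_0_at_top[OF q_lim] by (simp add: inverse_eq_divide)
  have inv_sqrt_q: "(\<lambda>n. 1 / sqrt (q n)) \<longlonglongrightarrow> 0"
    using tendsto_real_sqrt[OF inv_q] by (simp add: real_sqrt_divide)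
  have width: "(\<lambda>n. l n / h n) \<longlonglongrightarrow> 0"
  proof -
    have "(\<lambda>n. real d * q n powr (- 1 / real d)) \<longlonglongrightarrow> 0"
      using d by (intro tendsto_mult_right_zero tendsto_neg_powr q_lim) auto
    then show ?thesis
    proof (rule Lim_transform_eventually, intro eventually_sequentiallyI[of 1])
      fix n :: nat assume n: "1 \<le> n"
      show "real d * q n powr (- 1 / real d) = l n / h n"
        unfolding l_def q_def cell_width_ratio[OF hn[OF n] kn[OF n] d, symmetric] by simp
    qed
  qed
  have Vh: "(\<lambda>n. V n * h n powr \<alpha>) \<longlonglongrightarrow> 0"
  proof -
    have "(\<lambda>n. real n * real (k n) powr (- 1 / 2) * h n powr (\<alpha> + real d / 2)) \<longlonglongrightarrow> 0"
      using bw by (simp add: bandwidth_conditions_def d_def)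
    then show ?thesis
      by (rule Lim_transform_eventually) (auto intro!: eventually_sequentiallyI[of 1] simp: V_def norming_hoelder_bias hn)
  qed
  have l0: "0 \<le> l n" for n by (simp add: l_def)
  have width_pow: "(\<lambda>n. (l n / h n) powr \<alpha>) \<longlonglongrightarrow> 0"
    using width hn alpha l0 by (intro powr_tendsto_zero) (auto simp: less_imp_le)
  \<comment> \<open>the cells are small compared with the bandwidth, so their oscillation is \<open>o(h powr \<alpha>)\<close>\<close>
  have \<Delta>_split: "\<Delta> n = Lf * (h n powr \<alpha> * (l n / h n) powr \<alpha>)" if "1 \<le> n" for n
    using l0[of n] hn[OF that] by (simp add: \<Delta>_def powr_mult[symmetric])
  have V\<Delta>: "(\<lambda>n. V n * \<Delta> n) \<longlonglongrightarrow> 0"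
  proof -
    have "(\<lambda>n. Lf * (V n * h n powr \<alpha> * (l n / h n) powr \<alpha>)) \<longlonglongrightarrow> 0"
      by (intro tendsto_mult_right_zero tendsto_mult_zero Vh width_pow)
    then show ?thesis
      by (rule Lim_transform_eventually) (auto intro!: eventually_sequentiallyI[of 1] simp: \<Delta>_split)
  qed
  have hpow: "(\<lambda>n. h n powr \<alpha>) \<longlonglongrightarrow> 0"
    using h_lim hn alpha by (intro powr_tendsto_zero) (auto simp: less_imp_le)
  have \<Delta>_lim: "\<Delta> \<longlonglongrightarrow> 0"
  proof -
    have "(\<lambda>n. Lf * (h n powr \<alpha> * (l n / h n) powr \<alpha>)) \<longlonglongrightarrow> 0"
      by (intro tendsto_mult_right_zero tendsto_mult_zero hpow width_pow)
    then show ?thesis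
      by (rule Lim_transform_eventually) (auto intro!: eventually_sequentiallyI[of 1] simp: \<Delta>_split)
  qed
  have V\<eta>: "(\<lambda>n. V n * \<eta> n) \<longlonglongrightarrow> 0"
  proof -
    have "(\<lambda>n. Lf * R powr \<alpha> * (V n * h n powr \<alpha>)) \<longlonglongrightarrow> 0"
      by (intro tendsto_mult_right_zero Vh)
    then show ?thesis
      by (rule Lim_transform_eventually)
        (auto intro!: eventually_sequentiallyI[of 1] simp: \<eta>_def powr_mult hn K.R(1) less_imp_le)
  qed
  have cond1: "(\<lambda>n. real (k n) * ln (real n) / real n) \<longlonglongrightarrow> 0"
    using bw by (simp add: bandwidth_conditions_def)
  have Vexp: "(\<lambda>n. V n * exp (- (real n * c * f0 / real (k n)))) \<longlonglongrightarrow> 0"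
    using norming_empty_cell_bias[where b="c * f0", OF hn h_lim kn d] c_pos f0 cond1 by (simp add: V_def mult.assoc)
  have kn_lim: "(\<lambda>n. real (k n) / real n) \<longlonglongrightarrow> 0"
  proof (rule Lim_null_comparison[OF _ cond1])
    have "\<forall>\<^sub>F n in sequentially. 1 \<le> ln (real n)"
      using filterlim_compose[OF ln_at_top filterlim_real_sequentially] by (simp add: filterlim_at_top)
    then show "\<forall>\<^sub>F n in sequentially. norm (real (k n) / real n) \<le> real (k n) * ln (real n) / real n"
      by eventually_elim (auto intro!: divide_right_mono simp: mult_le_cancel_left1)
  qed

  have inside: "\<forall>\<^sub>F n in sequentially. \<forall>j. cball (x j) (R * h n) \<subseteq> cbox 0 1"
  proof (rule eventually_all_finite)
    fix j
    have "x j \<in> box 0 1" using x_interior by auto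
    then obtain \<delta> where \<delta>: "0 < \<delta>" "cball (x j) \<delta> \<subseteq> box 0 1"
      using open_contains_cball[of "box 0 (1 :: real^'d)"] open_box by blast
    have "(\<lambda>n. R * h n) \<longlonglongrightarrow> 0" using h_lim by (intro tendsto_mult_right_zero)
    then have "\<forall>\<^sub>F n in sequentially. R * h n < \<delta>" using \<delta>(1) by (rule order_tendstoD(2))
    then show "\<forall>\<^sub>F n in sequentially. cball (x j) (R * h n) \<subseteq> cbox 0 1"
      by eventually_elim (use \<delta>(2) box_subset_cbox[of 0 "1::real^'d"] in \<open>force simp: mem_cball\<close>)
  qed
  \<comment> \<open>two windows that meet the same cell have centres within twice their radius plus the cell diameter\<close>
  have separated: "\<forall>\<^sub>F n in sequentially. \<forall>i j. i \<noteq> j \<longrightarrow> 2 * (R * h n) + l n < norm (x i - x j)"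
  proof (intro eventually_all_finite)
    fix i j
    show "\<forall>\<^sub>F n in sequentially. i \<noteq> j \<longrightarrow> 2 * (R * h n) + l n < norm (x i - x j)"
    proof (cases "i = j")
      case False
      then have pos: "0 < norm (x i - x j)" using x_distinct by (auto dest: injD)
      have "l \<longlonglongrightarrow> 0"
      proof -
        have "(\<lambda>n. l n / h n * h n) \<longlonglongrightarrow> 0" by (intro tendsto_mult_zero width h_lim)
        then show ?thesis
          by (rule Lim_transform_eventually) (use hn in \<open>force intro!: eventually_sequentiallyI[of 1]\<close>)
      qed
      then have "(\<lambda>n. 2 * (R * h n) + l n) \<longlonglongrightarrow> 2 * (R * 0) + 0" by (intro tendsto_intros h_lim)
      then have "(\<lambda>n. 2 * (R * h n) + l n) \<longlonglongrightarrow> 0" by simp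
      from order_tendstoD(2)[OF this pos] show ?thesis by eventually_elim simp
    qed simp
  qed

  have Z_eq: "(\<lambda>n \<omega>. \<chi> j. norming CARD('d) n (k n) (h n) * c *
                       (f_hat f K (h n) (k n) (I n) (N n \<omega>) (x j) - f (x j))) = (\<lambda>n \<omega>. \<chi> j. Z n j \<omega>)"
    by (simp add: Z_def V_def d_def f_hat_def w_def E_def)
  have good: "\<forall>\<^sub>F n in sequentially. 1 \<le> n \<and> (\<forall>j. cball (x j) (R * h n) \<subseteq> cbox 0 1)"
    using inside eventually_ge_at_top[of 1] by eventually_elim simp
  have weights: "(\<Sum>r=1..k n. w n j r) = 1" "\<And>r. r \<in> {1..k n} \<Longrightarrow> 0 \<le> w n j r"
    "\<And>r. r \<in> {1..k n} \<Longrightarrow> w n j r \<le> B / q n" "\<bar>q n * (\<Sum>r=1..k n. (w n j r)\<^sup>2) - S2\<bar> \<le> L * (l n / h n)"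
    "\<And>r. w n j r \<noteq> 0 \<Longrightarrow> \<exists>t\<in>I n r. norm (x j - t) \<le> R * h n"
    if n: "1 \<le> n" and ins: "cball (x j) (R * h n) \<subseteq> cbox 0 1" for n j
    using K.scaled_kernel_weights[OF part[OF n] kn[OF n] hn[OF n] ins]
    unfolding w_def q_def S2_def l_def d_def by blast+

  have indep: "\<forall>\<^sub>F n in sequentially. prob_space (M n) \<and> prob_space.indep_vars (M n) (\<lambda>_. borel) (Z n) UNIV"
    using good separated
  proof eventually_elim
    case (elim n)
    then have n: "1 \<le> n" by simp
    interpret Row: estimator_row f "real n * c" "k n" "I n" "M n" "N n" f0 f1 "\<Delta> n" by (rule row[OF n])
    have "Row.indep_vars (\<lambda>_. borel) (\<lambda>j \<omega>. V n * c * ((\<Sum>r=1..k n. w n j r * Row.est r \<omega>) - f (x j))) UNIV"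
    proof (rule Row.weighted_sums_indep)
      fix i j r assume r: "r \<in> {1..k n}" "w n i r \<noteq> 0" "w n j r \<noteq> 0"
      obtain s where s: "s \<in> I n r" "norm (x i - s) \<le> R * h n" using weights(5)[OF n _ r(2)] elim by blast
      obtain t where t: "t \<in> I n r" "norm (x j - t) \<le> R * h n" using weights(5)[OF n _ r(3)] elim by blast
      have st: "norm (s - t) \<le> l n"
        using partition_cell(4)[OF part[OF n] r(1) s(1) t(1)] by (simp add: l_def d_def)
      have "x i - x j = (x i - s) + ((s - t) - (x j - t))" by simp
      then have "norm (x i - x j) \<le> norm (x i - s) + (norm (s - t) + norm (x j - t))"
        using norm_triangle_ineq[of "x i - s" "(s - t) - (x j - t)"] norm_triangle_ineq4[of "s - t" "x j - t"] by simp
      then have "norm (x i - x j) \<le> 2 * (R * h n) + l n" using s(2) t(2) st by simp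
      then show "i = j" using elim by force
    qed
    then show ?case
      unfolding Z_def[abs_def] E_def using Row.prob_space_axioms by simp
  qed

  have char: "(\<lambda>n. char (distr (M n) borel (Z n j)) t) \<longlonglongrightarrow> char (density lborel (normal_density 0 (sqrt S2))) t" for j t
  proof -
    define B2 where "B2 n = q n * (\<Sum>r=1..k n. (w n j r)\<^sup>2)" for n
    define \<tau> where "\<tau> n = 4 * real (k n) / (real n * c * f0) * B2 n" for n
    define T1 where "T1 n = \<bar>t\<bar> * (V n * c * (6 * \<Delta> n + \<eta> n + (f1 + \<Delta> n) * exp (- (real n * c * f0 / real (k n)))))" for n
    define T2 where "T2 n s = \<bar>t\<bar>^3 / 6 * (1 / sqrt (q n) * s + 24 * (B / sqrt (q n))\<^sup>2 * B2 n / (1 / sqrt (q n)))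
        + t ^ 4 * (24 * (B / sqrt (q n))\<^sup>2 * B2 n) / 8" for n s
    let ?P = "\<lambda>n s. \<bar>s - B2 n\<bar> \<le> \<tau> n \<and> cmod (char (distr (M n) borel (Z n j)) t - exp (- (t\<^sup>2 * s) / 2)) \<le> T1 n + T2 n s"
    \<comment> \<open>the variance \<open>s\<close> of the approximating row sum depends on \<open>n\<close> and on the point, so it is chosen\<close>
    have "\<forall>\<^sub>F n in sequentially. \<exists>s. ?P n s"
      using good
    proof eventually_elim
      case (elim n)
      then have n: "1 \<le> n" and ins: "cball (x j) (R * h n) \<subseteq> cbox 0 1" by auto
      interpret Row: estimator_row f "real n * c" "k n" "I n" "M n" "N n" f0 f1 "\<Delta> n" by (rule row[OF n])
      note wts = weights[OF n ins]
      let ?b = "\<lambda>r. w n j r * sqrt (q n)"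
      have scale: "V n * c * real (k n) / (real n * c) = sqrt (q n)"
        using norming_cell_scale[of n "k n" "h n" d] n kn[OF n] hn[OF n] c_pos by (simp add: V_def q_def)
      have V0: "0 \<le> V n * c" using c_pos by (simp add: V_def norming_def)
      let ?S = "\<lambda>\<omega>. \<Sum>r=1..k n. (?b r * Row.mass r) * (Row.U r \<omega> - 1)"
      have b_le: "\<bar>?b r\<bar> \<le> B / sqrt (q n)" if "r \<in> {1..k n}" for r
      proof -
        have "w n j r * sqrt (q n) \<le> B / q n * sqrt (q n)" using wts(3)[OF that] qpos[OF n] by (intro mult_right_mono) auto
        also have "\<dots> = B / sqrt (q n)" using qpos[OF n] by (simp add: field_simps flip: real_sqrt_mult)
        finally show ?thesis using wts(2)[OF that] qpos[OF n] by simp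
      qed
      have B2: "(\<Sum>r=1..k n. (?b r)\<^sup>2) = B2 n"
        using qpos[OF n] by (simp add: B2_def power_mult_distrib sum_distrib_left mult.commute)
      have eps: "0 < 1 / sqrt (q n)" using qpos[OF n] by simp
      obtain s where s: "\<bar>s - B2 n\<bar> \<le> \<tau> n" "cmod (char (distr (M n) borel ?S) t - exp (- (t\<^sup>2 * s) / 2)) \<le> T2 n s"
      proof (rule Row.ratio_sum_char[where b="?b" and \<beta>="B / sqrt (q n)" and \<epsilon>="1 / sqrt (q n)" and t=t])
        show "\<bar>?b r\<bar> \<le> B / sqrt (q n)" if "r \<in> {1..k n}" for r by (rule b_le[OF that])
        show "0 < 1 / sqrt (q n)" by (rule eps)
        let ?B2 = "\<Sum>r=1..k n. (?b r)\<^sup>2"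
        fix s
        assume "\<bar>s - ?B2\<bar> \<le> 4 * real (k n) / (real n * c * f0) * ?B2"
          and "cmod (char (distr (M n) borel ?S) t - exp (- (t\<^sup>2 * s) / 2))
            \<le> \<bar>t\<bar>^3 / 6 * (1 / sqrt (q n) * s + 24 * (B / sqrt (q n))\<^sup>2 * ?B2 / (1 / sqrt (q n)))
              + t ^ 4 * (24 * (B / sqrt (q n))\<^sup>2 * ?B2) / 8"
        then show thesis unfolding B2 by (intro that[of s]) (simp_all only: \<tau>_def T2_def)
      qed
      have loc: "\<exists>s\<in>I n r. \<bar>f s - f (x j)\<bar> \<le> \<eta> n" if r: "r \<in> {1..k n}" "w n j r \<noteq> 0" for r
      proof -
        obtain s where s: "s \<in> I n r" "norm (x j - s) \<le> R * h n" using wts(5)[OF r(2)] by blast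
        have "s \<in> cbox 0 1" using partition_cell(2)[OF part[OF n] r(1)] s(1) by blast
        moreover have "x j \<in> cbox 0 1" using x_interior box_subset_cbox by blast
        ultimately have "\<bar>f s - f (x j)\<bar> \<le> Lf * norm (s - x j) powr \<alpha>" by (rule Lf(2))
        also have "\<dots> \<le> \<eta> n"
          unfolding \<eta>_def using s(2) alpha by (intro mult_left_mono powr_mono2 Lf(1)) (auto simp: norm_minus_commute)
        finally show ?thesis using s(1) by blast
      qed
      have S_eq: "(\<lambda>\<omega>. \<Sum>r=1..k n. (V n * c * w n j r * (Row.mass r * real (k n) / (real n * c))) * (Row.U r \<omega> - 1)) = ?S"
      proof -
        have "V n * c * w n j r * (Row.mass r * real (k n) / (real n * c)) = ?b r * Row.mass r" for r
          unfolding scale[symmetric] by simp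
        then show ?thesis by simp
      qed
      have "cmod (char (distr (M n) borel (Z n j)) t - char (distr (M n) borel ?S) t) \<le> T1 n"
        using Row.weighted_sum_near_ratios(2)[of "w n j" "f (x j)" "\<eta> n" "V n * c" t, OF wts(2) wts(1) loc V0]
        unfolding S_eq T1_def Z_def[abs_def] E_def by simp
      then have "cmod ((char (distr (M n) borel (Z n j)) t - char (distr (M n) borel ?S) t)
          + (char (distr (M n) borel ?S) t - exp (- (t\<^sup>2 * s) / 2))) \<le> T1 n + T2 n s"
        using s(2) by (intro norm_triangle_mono)
      then show ?case using s(1) by (intro exI[of _ s]) simp
    qed
    then have ex: "\<forall>\<^sub>F n in sequentially. ?P n (SOME s. ?P n s)"
      by eventually_elim (rule someI_ex)
    define s where "s n = (SOME s. ?P n s)" for n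
    have P: "\<forall>\<^sub>F n in sequentially. ?P n (s n)" using ex by (simp only: s_def)
    have B2_lim: "B2 \<longlonglongrightarrow> S2"
    proof (rule LIM_zero_cancel, rule Lim_null_comparison)
      show "(\<lambda>n. L * (l n / h n)) \<longlonglongrightarrow> 0" by (intro tendsto_mult_right_zero width)
      show "\<forall>\<^sub>F n in sequentially. norm (B2 n - S2) \<le> L * (l n / h n)"
        using good by eventually_elim (use weights(4) in \<open>simp add: B2_def\<close>)
    qed
    have \<tau>_lim: "\<tau> \<longlonglongrightarrow> 0"
    proof -
      have "(\<lambda>n. 4 / (c * f0) * (real (k n) / real n) * B2 n) \<longlonglongrightarrow> 4 / (c * f0) * 0 * S2"
        by (intro tendsto_intros kn_lim B2_lim)
      then show ?thesis by (simp add: \<tau>_def[abs_def] ac_simps)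
    qed
    have s_lim: "s \<longlonglongrightarrow> S2"
    proof -
      have "(\<lambda>n. s n - B2 n) \<longlonglongrightarrow> 0"
        by (rule Lim_null_comparison[OF _ \<tau>_lim]) (use P in \<open>auto elim: eventually_mono\<close>)
      from tendsto_add[OF this B2_lim] show ?thesis by simp
    qed
    have T1_lim: "T1 \<longlonglongrightarrow> 0"
    proof -
      have "(\<lambda>n. \<bar>t\<bar> * (c * (6 * (V n * \<Delta> n) + V n * \<eta> n + (f1 + \<Delta> n) * (V n * exp (- (real n * c * f0 / real (k n)))))))
          \<longlonglongrightarrow> \<bar>t\<bar> * (c * (6 * 0 + 0 + (f1 + 0) * 0))"
        by (intro tendsto_intros V\<Delta> V\<eta> Vexp \<Delta>_lim)
      then show ?thesis by (simp add: T1_def[abs_def] algebra_simps)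
    qed
    have T2_lim: "(\<lambda>n. T2 n (s n)) \<longlonglongrightarrow> 0"
    proof -
      have "(\<lambda>n. \<bar>t\<bar>^3 / 6 * (1 / sqrt (q n) * s n + 24 * B\<^sup>2 * B2 n * (1 / sqrt (q n)))
          + t ^ 4 * (24 * B\<^sup>2 * B2 n * (1 / q n)) / 8) \<longlonglongrightarrow> \<bar>t\<bar>^3 / 6 * (0 * S2 + 24 * B\<^sup>2 * S2 * 0) + t ^ 4 * (24 * B\<^sup>2 * S2 * 0) / 8"
        by (intro tendsto_intros inv_q inv_sqrt_q s_lim B2_lim) auto
      then have "(\<lambda>n. \<bar>t\<bar>^3 / 6 * (1 / sqrt (q n) * s n + 24 * B\<^sup>2 * B2 n * (1 / sqrt (q n)))
          + t ^ 4 * (24 * B\<^sup>2 * B2 n * (1 / q n)) / 8) \<longlonglongrightarrow> 0" by simp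
      then show ?thesis
      proof (rule Lim_transform_eventually, intro eventually_sequentiallyI[of 1])
        fix n :: nat assume "1 \<le> n"
        then have q0: "0 < q n" by (rule qpos)
        define y where "y = sqrt (q n)"
        have y: "0 < y" "q n = y\<^sup>2" using q0 by (simp_all add: y_def)
        have e2: "24 * (B / sqrt (q n))\<^sup>2 * B2 n / (1 / sqrt (q n)) = 24 * B\<^sup>2 * B2 n * (1 / sqrt (q n))"
          unfolding y_def[symmetric] using y(1) by (simp add: power_divide power2_eq_square)
        have e1: "24 * (B / sqrt (q n))\<^sup>2 * B2 n = 24 * B\<^sup>2 * B2 n * (1 / q n)"
          unfolding y_def[symmetric] y(2) by (simp add: power_divide)
        show "\<bar>t\<bar>^3 / 6 * (1 / sqrt (q n) * s n + 24 * B\<^sup>2 * B2 n * (1 / sqrt (q n)))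
          + t ^ 4 * (24 * B\<^sup>2 * B2 n * (1 / q n)) / 8 = T2 n (s n)"
          unfolding T2_def e2 unfolding e1 ..
      qed
    qed
    have "(\<lambda>n. char (distr (M n) borel (Z n j)) t - exp (- (t\<^sup>2 * s n) / 2)) \<longlonglongrightarrow> 0"
    proof (rule Lim_null_comparison)
      show "\<forall>\<^sub>F n in sequentially. cmod (char (distr (M n) borel (Z n j)) t - exp (- (t\<^sup>2 * s n) / 2)) \<le> T1 n + T2 n (s n)"
        using P by eventually_elim simp
      show "(\<lambda>n. T1 n + T2 n (s n)) \<longlonglongrightarrow> 0" using tendsto_add[OF T1_lim T2_lim] by simp
    qed
    moreover have "(\<lambda>n. complex_of_real (exp (- (t\<^sup>2 * s n) / 2))) \<longlonglongrightarrow> complex_of_real (exp (- (t\<^sup>2 * S2) / 2))"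
      by (intro tendsto_intros s_lim) auto
    ultimately have "(\<lambda>n. (char (distr (M n) borel (Z n j)) t - exp (- (t\<^sup>2 * s n) / 2)) + exp (- (t\<^sup>2 * s n) / 2))
        \<longlonglongrightarrow> 0 + complex_of_real (exp (- (t\<^sup>2 * S2) / 2))"
      by (rule tendsto_add)
    then show ?thesis using S2 by (simp add: char_normal_density)
  qed
  have "converges_in_distribution M (\<lambda>n \<omega>. \<chi> j. Z n j \<omega>)
      (distr (PiM UNIV (\<lambda>_::'p. density lborel (normal_density 0 (sqrt S2)))) borel (\<lambda>y. \<chi> j. y j))"
    using S2 by (intro converges_in_distribution_independent_coordinates indep char char_normal_density(1)) auto
  then show ?thesis
    unfolding Z_eq multivariate_normal_scaled_identity[OF S2, symmetric] unfolding S2_def .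
qed

theorem corollary2:
  fixes f K :: "real^'d \<Rightarrow> real"
    and \<alpha> c :: real
    and k :: "nat \<Rightarrow> nat"
    and h :: "nat \<Rightarrow> real"
    and I :: "nat \<Rightarrow> nat \<Rightarrow> (real^'d) set"
    and M :: "nat \<Rightarrow> 'w measure"
    and N :: "nat \<Rightarrow> 'w \<Rightarrow> ((real^'d) \<times> real) multiset"
    and x :: "'p::finite \<Rightarrow> real^'d"
  assumes alpha: "0 < \<alpha>" "\<alpha> \<le> 1"
    and f_nonneg: "\<forall>t\<in>cbox 0 1. 0 \<le> f t"
    and f_hoelder: "hoelder_on \<alpha> (cbox 0 1) f"
    and f_inf: "0 < (INF t\<in>cbox 0 1. f t)"
    and c_pos: "0 < c"
    and poisson: "\<forall>n\<ge>1. poisson_process (M n) (intensity f (real n * c)) (N n)"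
    and k_pos: "\<forall>n\<ge>1. 0 < k n"
    and k_mono: "mono_on {1..} k"
    and k_lim: "filterlim k at_top sequentially"
    and partition: "\<forall>n\<ge>1. equidistant_partition (k n) (I n)"
    and kernel: "Parzen_Rosenblatt_kernel K" "compactly_supported K" "hoelder_on 1 UNIV K"
    and h_pos: "\<forall>n\<ge>1. 0 < h n"
    and h_lim: "h \<longlonglongrightarrow> 0"
    and x_distinct: "inj x"
    and x_interior: "range x \<subseteq> box 0 1"
  shows
    "(bandwidth_conditions CARD('d) \<alpha> k h \<longrightarrow>
        converges_in_distribution M
          (\<lambda>n \<omega>. \<chi> j. norming CARD('d) n (k n) (h n) * c *
                       (f_hat f K (h n) (k n) (I n) (N n \<omega>) (x j) - f (x j)))
          (multivariate_normal 0 ((\<integral>u. (K u)\<^sup>2 \<partial>lborel) *\<^sub>R (mat 1 :: real^'p^'p))))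
     \<and>
     (\<forall>u. slowly_divergent CARD('d) \<alpha> u \<and>
          (\<forall>n\<ge>1. h n = real n powr (- 1 / (\<alpha> + real CARD('d))) \<and>
                 real (k n) = real n powr (real CARD('d) / (\<alpha> + real CARD('d))) * (u n)\<^sup>2) \<longrightarrow>
        bandwidth_conditions CARD('d) \<alpha> k h \<and>
        (\<forall>n\<ge>1. norming CARD('d) n (k n) (h n) = real n powr (\<alpha> / (\<alpha> + real CARD('d))) / u n) \<and>
        converges_in_distribution M
          (\<lambda>n \<omega>. \<chi> j. real n powr (\<alpha> / (\<alpha> + real CARD('d))) / u n * c *
                       (f_hat f K (h n) (k n) (I n) (N n \<omega>) (x j) - f (x j)))
          (multivariate_normal 0 ((\<integral>u. (K u)\<^sup>2 \<partial>lborel) *\<^sub>R (mat 1 :: real^'p^'p))))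
     \<and>
     (\<forall>w. filterlim w at_top sequentially \<longrightarrow>
        (\<exists>u (\<kappa>::nat \<Rightarrow> nat).
           slowly_divergent CARD('d) \<alpha> u \<and> (\<forall>\<^sub>F n in sequentially. u n \<le> w n) \<and>
           mono_on {1..} \<kappa> \<and> filterlim \<kappa> at_top sequentially \<and>
           (\<forall>n\<ge>1. 0 < \<kappa> n \<and> (\<exists>m. \<kappa> n = m ^ CARD('d)) \<and>
              real (\<kappa> n) = real n powr (real CARD('d) / (\<alpha> + real CARD('d))) * (u n)\<^sup>2)))"
proof -
  note clt = estimator_asymptotically_normal[OF alpha(1) f_nonneg f_hoelder f_inf c_pos poisson k_pos partition
      kernel h_pos h_lim x_distinct x_interior]
  have d: "0 < CARD('d)" by simp
  show ?thesis
  proof (intro conjI allI impI)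
    assume "bandwidth_conditions CARD('d) \<alpha> k h"
    then show "converges_in_distribution M
          (\<lambda>n \<omega>. \<chi> j. norming CARD('d) n (k n) (h n) * c *
                       (f_hat f K (h n) (k n) (I n) (N n \<omega>) (x j) - f (x j)))
          (multivariate_normal 0 ((\<integral>u. (K u)\<^sup>2 \<partial>lborel) *\<^sub>R (mat 1 :: real^'p^'p)))"
      by (rule clt)
  next
    fix u
    assume u: "slowly_divergent CARD('d) \<alpha> u \<and>
          (\<forall>n\<ge>1. h n = real n powr (- 1 / (\<alpha> + real CARD('d))) \<and>
                 real (k n) = real n powr (real CARD('d) / (\<alpha> + real CARD('d))) * (u n)\<^sup>2)"
    then have hk: "\<And>n. 1 \<le> n \<Longrightarrow> h n = real n powr (- 1 / (\<alpha> + real CARD('d)))"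
      "\<And>n. 1 \<le> n \<Longrightarrow> real (k n) = real n powr (real CARD('d) / (\<alpha> + real CARD('d))) * (u n)\<^sup>2"
      and u_pos: "\<And>n. 1 \<le> n \<Longrightarrow> 0 < u n"
      by (auto simp: slowly_divergent_def)
    show bw: "bandwidth_conditions CARD('d) \<alpha> k h"
      by (rule bandwidth_conditions_optimal_rate[OF d alpha(1) conjunct1[OF u] hk])
    show norming: "norming CARD('d) n (k n) (h n) = real n powr (\<alpha> / (\<alpha> + real CARD('d))) / u n" if "1 \<le> n" for n
      by (rule exponent_conditions(4)[OF d alpha(1) that u_pos[OF that] hk(1)[OF that] hk(2)[OF that]])
    show "converges_in_distribution M
          (\<lambda>n \<omega>. \<chi> j. real n powr (\<alpha> / (\<alpha> + real CARD('d))) / u n * c *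
                       (f_hat f K (h n) (k n) (I n) (N n \<omega>) (x j) - f (x j)))
          (multivariate_normal 0 ((\<integral>u. (K u)\<^sup>2 \<partial>lborel) *\<^sub>R (mat 1 :: real^'p^'p)))"
      by (rule converges_in_distribution_cong[OF clt[OF bw]], rule eventually_sequentiallyI[of 1]) (simp only: norming)
  next
    fix w :: "nat \<Rightarrow> real" assume "filterlim w at_top sequentially"
    then show "\<exists>u (\<kappa>::nat \<Rightarrow> nat).
           slowly_divergent CARD('d) \<alpha> u \<and> (\<forall>\<^sub>F n in sequentially. u n \<le> w n) \<and>
           mono_on {1..} \<kappa> \<and> filterlim \<kappa> at_top sequentially \<and>
           (\<forall>n\<ge>1. 0 < \<kappa> n \<and> (\<exists>m. \<kappa> n = m ^ CARD('d)) \<and>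
              real (\<kappa> n) = real n powr (real CARD('d) / (\<alpha> + real CARD('d))) * (u n)\<^sup>2)"
      by (rule slowly_divergent_grid_exists[OF d alpha(1)])
  qed
qed

end
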